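(* Let $(\mathcal{A},m)$ be a multiarrangement in $V=\mathbb{K}^\ell$ with $\mathcal{A}\neq\emptyset$ such that $$b_2(\mathcal{A},m)=b_2(\mathcal{A})+(|m|-|\mathcal{A}|)(|\mathcal{A}|-1).$$ Then: (1) there is a minimal (homogeneous) generating set $\theta_E,\theta_1,\ldots,\theta_s$ of $D(\mathcal{A})$ such that $\frac{Q(\mathcal{A},m)}{Q(\mathcal{A})}\theta_E,\theta_1,\ldots,\theta_s$ generate $D(\mathcal{A},m)$, and they form a minimal generating set of $D(\mathcal{A},m)$ if and only if $\langle\theta_1,\ldots,\theta_s\rangle_S\neq D(\mathcal{A},m)$; (2) if $(\mathcal{A},m)$ is free and $\mathcal{A}$ is not free, then there exists a minimal generating set $\theta_E,\theta_1,\ldots,\theta_\ell$ of $D(\mathcal{A})$ such that $\theta_1,\ldots,\theta_\ell$ form a basis of $D(\mathcal{A},m)$; (3) if $(\mathcal{A},m)$ and $\mathcal{A}$ are both free, then there is a free basis $\theta_E,\theta_1,\ldots,\theta_{\ell-1}$ of $D(\mathcal{A})$ such that $\theta_1,\ldots,\theta_{\ell-1},(Q(\mathcal{A},m)/Q(\mathcal{A}))\theta_E$ form a basis of $D(\mathcal{A},m)$.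
   Context: $\mathbb{K}$ is a field, $S=\mathbb{K}[x_1,\ldots,x_\ell]$, $\mathrm{Der}\,S=\bigoplus_i S\partial_{x_i}$, and $\theta_E=\sum_i x_i\partial_{x_i}$ is the Euler derivation. A central arrangement $\mathcal{A}$ is a finite set of linear hyperplanes $H=\ker\alpha_H$ in $V$, $Q(\mathcal{A})=\prod_{H}\alpha_H$. A multiarrangement is a pair $(\mathcal{A},m)$ with $m:\mathcal{A}\to\mathbb{Z}_{\ge1}$; $|m|=\sum_H m(H)$, $Q(\mathcal{A},m)=\prod_H\alpha_H^{m(H)}$, and $D(\mathcal{A},m)=\{\theta\in\mathrm{Der}\,S\mid\theta(\alpha_H)\in S\alpha_H^{m(H)}\ \forall H\}$; $D(\mathcal{A})=D(\mathcal{A},1)$. $(\mathcal{A},m)$ (resp. $\mathcal{A}$) is free if $D(\mathcal{A},m)$ (resp. $D(\mathcal{A})$) is a free $S$-module. $L(\mathcal{A})$ is the set of intersections of subsets of $\mathcal{A}$ ordered by reverse inclusion, $L_2(\mathcal{A})$ its elements of codimension $2$, $\mu$ its Möbius function ($\mu(V)=1$, $\mu(X)=-\sum_{X\subsetneq Y}\mu(Y)$), and $\chi(\mathcal{A};t)=\sum_X\mu(X)t^{\dim X}=\sum_i(-1)^ib_i(\mathcal{A})t^{\ell-i}$. For a multiarrangement, $b_2(\mathcal{A},m)$ is the second coefficient of its (Abe–Terao–Wakefield) characteristic polynomial; equivalently $b_2(\mathcal{A},m)=\sum_{X\in L_2(\mathcal{A})}d_1^Xd_2^X$, where for $\mathcal{A}_X=\{H\in\mathcal{A}\mid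 X\subseteq H\}$ the (always free) rank-2 multiarrangement $(\mathcal{A}_X,m|_{\mathcal{A}_X})$ has exponents $(d_1^X,d_2^X,0,\ldots,0)$. For $m\equiv 1$ this equals $b_2(\mathcal{A})$. Generators are homogeneous. *)

theory Defs
  imports
    "HOL-Library.Poly_Mapping"
    "HOL-Computational_Algebra.Polynomial"
    "HOL-Analysis.Cartesian_Space"
begin

section \<open>The polynomial ring\<close>

text \<open>The coordinates are indexed by a finite type \<open>'n\<close>, so the dimension of \<open>V\<close> is \<open>CARD('n)\<close>,
  and monomials are identified with their exponent vectors.\<close>

type_synonym ('n, 'k) mpoly = "('n \<Rightarrow>\<^sub>0 nat) \<Rightarrow>\<^sub>0 'k"

definition Var :: "'n \<Rightarrow> ('n, 'k::field) mpoly" where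
  "Var i = Poly_Mapping.single (Poly_Mapping.single i 1) 1"

definition Const :: "'k \<Rightarrow> ('n, 'k::field) mpoly" where
  "Const c = Poly_Mapping.single 0 c"

definition partial :: "'n \<Rightarrow> ('n, 'k::field) mpoly \<Rightarrow> ('n, 'k) mpoly" where
  "partial i f = (\<Sum>t\<in>Poly_Mapping.keys f.
     Poly_Mapping.single (t - Poly_Mapping.single i 1)
       (of_nat (Poly_Mapping.lookup t i) * Poly_Mapping.lookup f t))"

definition homogeneous_poly :: "nat \<Rightarrow> ('n::finite, 'k::field) mpoly \<Rightarrow> bool" where
  "homogeneous_poly d f \<longleftrightarrow>
     (\<forall>t\<in>Poly_Mapping.keys f. (\<Sum>i\<in>UNIV. Poly_Mapping.lookup t i) = d)"

section \<open>Derivations\<close>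

text \<open>The vector \<open>\<theta>\<close> stands for the derivation whose coefficient at the \<open>i\<close>-th partial derivative
  is \<open>\<theta> $ i\<close>.\<close>

type_synonym ('n, 'k) der = "('n, 'k) mpoly ^ 'n"

interpretation der: module "(*s) :: 'a::comm_ring_1 \<Rightarrow> 'a ^ 'n \<Rightarrow> 'a ^ 'n"
  by unfold_locales (simp_all add: vec_eq_iff algebra_simps)

definition der_apply :: "('n::finite, 'k::field) der \<Rightarrow> ('n, 'k) mpoly \<Rightarrow> ('n, 'k) mpoly" where
  "der_apply \<theta> f = (\<Sum>i\<in>UNIV. \<theta> $ i * partial i f)"

definition euler :: "('n::finite, 'k::field) der" where
  "euler = (\<chi> i. Var i)"

text \<open>The degree is the polynomial degree of the coefficients, so \<open>euler\<close> has degree 1.\<close>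

definition homogeneous_der :: "nat \<Rightarrow> ('n::finite, 'k::field) der \<Rightarrow> bool" where
  "homogeneous_der d \<theta> \<longleftrightarrow> (\<forall>i. homogeneous_poly d (\<theta> $ i))"

definition free_module :: "('n::finite, 'k::field) der set \<Rightarrow> bool" where
  "free_module M \<longleftrightarrow> (\<exists>B. der.independent B \<and> der.span B = M)"

definition homogeneous_basis :: "('n::finite, 'k::field) der set \<Rightarrow> ('n, 'k) der list \<Rightarrow> bool" where
  "homogeneous_basis M \<theta>s \<longleftrightarrow>
     (\<forall>\<theta>\<in>set \<theta>s. \<exists>d. homogeneous_der d \<theta>) \<and>
     distinct \<theta>s \<and> der.independent (set \<theta>s) \<and> der.span (set \<theta>s) = M"

definition minimal_generators :: "('n::finite, 'k::field) der set \<Rightarrow> ('n, 'k) der list \<Rightarrow> bool" where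
  "minimal_generators M \<theta>s \<longleftrightarrow>
     (\<forall>\<theta>\<in>set \<theta>s. \<exists>d. homogeneous_der d \<theta>) \<and>
     distinct \<theta>s \<and> der.span (set \<theta>s) = M \<and>
     (\<forall>T. T \<subset> set \<theta>s \<longrightarrow> der.span T \<noteq> M)"

section \<open>Multiarrangements\<close>

text \<open>A linear form is given by its coefficient vector.\<close>

definition linear_form :: "'k ^ 'n \<Rightarrow> ('n::finite, 'k::field) mpoly" where
  "linear_form a = (\<Sum>i\<in>UNIV. Const (a $ i) * Var i)"

definition hyperplane :: "'k ^ 'n \<Rightarrow> ('k::field ^ 'n::finite) set" where
  "hyperplane a = {v. (\<Sum>i\<in>UNIV. a $ i * v $ i) = 0}"

text \<open>\<open>\<alpha>\<close> is a choice of a defining linear form for every hyperplane; the value of \<open>m\<close> outside \<open>A\<close>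
  is irrelevant.\<close>

definition multiarrangement ::
  "(('k::field ^ 'n::finite) set \<Rightarrow> 'k ^ 'n) \<Rightarrow> ('k ^ 'n) set set \<Rightarrow> (('k ^ 'n) set \<Rightarrow> nat) \<Rightarrow> bool"
  where
  "multiarrangement \<alpha> A m \<longleftrightarrow>
     finite A \<and> (\<forall>H\<in>A. \<alpha> H \<noteq> 0 \<and> H = hyperplane (\<alpha> H) \<and> m H \<ge> 1)"

definition defining_poly ::
  "(('k::field ^ 'n::finite) set \<Rightarrow> 'k ^ 'n) \<Rightarrow> ('k ^ 'n) set set \<Rightarrow> (('k ^ 'n) set \<Rightarrow> nat) \<Rightarrow> ('n, 'k) mpoly"
  where
  "defining_poly \<alpha> A m = (\<Prod>H\<in>A. linear_form (\<alpha> H) ^ m H)"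

text \<open>The quotient \<open>Q(A,m) / Q(A)\<close>; the polynomial ring is a domain, so the lemma
  \<open>defining_quot_mult\<close> characterises it.\<close>

definition defining_quot ::
  "(('k::field ^ 'n::finite) set \<Rightarrow> 'k ^ 'n) \<Rightarrow> ('k ^ 'n) set set \<Rightarrow> (('k ^ 'n) set \<Rightarrow> nat) \<Rightarrow> ('n, 'k) mpoly"
  where
  "defining_quot \<alpha> A m = (\<Prod>H\<in>A. linear_form (\<alpha> H) ^ (m H - 1))"

lemma defining_quot_mult:
  assumes "multiarrangement \<alpha> A m"
  shows "defining_quot \<alpha> A m * defining_poly \<alpha> A (\<lambda>_. 1) = defining_poly \<alpha> A m"
proof -
  have "linear_form (\<alpha> H) ^ (m H - 1) * linear_form (\<alpha> H) ^ 1 = linear_form (\<alpha> H) ^ m H" if "H \<in> A" for H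
    using that assms power_minus_mult[of "m H" "linear_form (\<alpha> H)"]
    by (auto simp: multiarrangement_def Suc_le_eq)
  then show ?thesis
    by (simp add: defining_quot_def defining_poly_def flip: prod.distrib)
qed

definition log_der ::
  "(('k::field ^ 'n::finite) set \<Rightarrow> 'k ^ 'n) \<Rightarrow> ('k ^ 'n) set set \<Rightarrow> (('k ^ 'n) set \<Rightarrow> nat) \<Rightarrow> ('n, 'k) der set"
  where
  "log_der \<alpha> A m =
     {\<theta>. \<forall>H\<in>A. linear_form (\<alpha> H) ^ m H dvd der_apply \<theta> (linear_form (\<alpha> H))}"

section \<open>Intersection lattice and characteristic polynomial\<close>

definition int_lattice :: "('k::field ^ 'n::finite) set set \<Rightarrow> ('k ^ 'n) set set" where
  "int_lattice A = {\<Inter>B |B. B \<subseteq> A}"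

lemma finite_int_lattice: "finite A \<Longrightarrow> finite (int_lattice A)"
proof -
  assume "finite A"
  moreover have "int_lattice A = Inter ` Pow A"
    by (auto simp: int_lattice_def)
  ultimately show ?thesis by simp
qed

definition int_lattice_codim2 :: "('k::field ^ 'n::finite) set set \<Rightarrow> ('k ^ 'n) set set" where
  "int_lattice_codim2 A = {X \<in> int_lattice A. vec.dim X + 2 = CARD('n)}"

definition localization :: "('k::field ^ 'n::finite) set set \<Rightarrow> ('k ^ 'n) set \<Rightarrow> ('k ^ 'n) set set" where
  "localization A X = {H \<in> A. X \<subseteq> H}"

function moebius :: "('k::field ^ 'n::finite) set set \<Rightarrow> ('k ^ 'n) set \<Rightarrow> int" where
  "moebius A X =
     (if finite A \<and> X \<in> int_lattice A
      then if X = UNIV then 1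
           else - (\<Sum>Y\<in>{Y \<in> int_lattice A. X \<subset> Y}. moebius A Y)
      else 0)"
  by pat_completeness auto
termination
proof (relation "Wellfounded.measure (\<lambda>(A, X). card {Y \<in> int_lattice A. X \<subset> Y})", goal_cases)
  case (2 A X Y)
  then have "{Z \<in> int_lattice A. Y \<subset> Z} \<subset> {Z \<in> int_lattice A. X \<subset> Z}"
    by blast
  then show ?case
    using 2 by (simp add: psubset_card_mono finite_int_lattice)
qed simp

declare moebius.simps [simp del]

definition char_poly :: "('k::field ^ 'n::finite) set set \<Rightarrow> int poly" where
  "char_poly A = (\<Sum>X\<in>int_lattice A. monom (moebius A X) (vec.dim X))"

definition betti :: "nat \<Rightarrow> ('k::field ^ 'n::finite) set set \<Rightarrow> int" where
  "betti i A = (if i \<le> CARD('n) then (-1) ^ i * coeff (char_poly A) (CARD('n) - i) else 0)"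

section \<open>Exponents and the second Betti number of a multiarrangement\<close>

definition has_exponents ::
  "(('k::field ^ 'n::finite) set \<Rightarrow> 'k ^ 'n) \<Rightarrow> ('k ^ 'n) set set \<Rightarrow> (('k ^ 'n) set \<Rightarrow> nat) \<Rightarrow> nat list \<Rightarrow> bool"
  where
  "has_exponents \<alpha> A m ds \<longleftrightarrow>
     (\<exists>\<theta>s. homogeneous_basis (log_der \<alpha> A m) \<theta>s \<and> list_all2 homogeneous_der ds \<theta>s)"

text \<open>For \<open>X\<close> of codimension 2 the localization is free with exponents that are unique up to order,
  so the product of the two possibly nonzero exponents is well defined.\<close>

definition local_exponent_product ::
  "(('k::field ^ 'n::finite) set \<Rightarrow> 'k ^ 'n) \<Rightarrow> ('k ^ 'n) set set \<Rightarrow> (('k ^ 'n) set \<Rightarrow> nat) \<Rightarrow>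
     ('k ^ 'n) set \<Rightarrow> nat"
  where
  "local_exponent_product \<alpha> A m X =
     (THE e. \<exists>d\<^sub>1 d\<^sub>2. has_exponents \<alpha> (localization A X) m (d\<^sub>1 # d\<^sub>2 # replicate (CARD('n) - 2) 0) \<and>
        e = d\<^sub>1 * d\<^sub>2)"

definition multi_betti2 ::
  "(('k::field ^ 'n::finite) set \<Rightarrow> 'k ^ 'n) \<Rightarrow> ('k ^ 'n) set set \<Rightarrow> (('k ^ 'n) set \<Rightarrow> nat) \<Rightarrow> nat"
  where
  "multi_betti2 \<alpha> A m = (\<Sum>X\<in>int_lattice_codim2 A. local_exponent_product \<alpha> A m X)"

end

theory Submission
  imports Defs
begin

text \<open>
  For every \<open>X\<close> of codimension two the exponents of the localization have the sum
  \<open>(|A_X| - 1) + (|m_X| - |A_X| + 1)\<close>, and their product is at least the product of these two summands: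
  a derivation of degree below \<open>|A_X| - 1\<close> is a multiple of the Euler derivation, hence of
  \<open>Q(A_X,m)/Q(A_X)\<close> times it. Summing over \<open>X\<close>, the assumption on \<open>b_2\<close> says that equality holds for all
  \<open>X\<close>, and equality means \<open>D(A_X) = S \<theta>_E + D(A_X,m)\<close>. Writing \<open>\<theta>(\<alpha>_H) = \<alpha>_H g_H\<close> for \<open>\<theta> \<in> D(A)\<close>, the
  congruences \<open>f \<equiv> g_H\<close> modulo \<open>\<alpha>_H ^ (m(H) - 1)\<close> are thus solvable locally in codimension two; since
  the obstruction to a global solution lives only there, \<open>D(A) = S \<theta>_E + D(A,m)\<close>. All three claims
  then follow by choosing minimal generators and comparing ranks.
\<close>

text \<open>The global step is a regularity argument. For forms \<open>a\<close> and
  \<open>b\<close> of different hyperplanes, multiplication by \<open>b\<close> is injective modulo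
  the ideal (a, p) as soon as \<open>p\<close> avoids the prime ideal (a, b). Hence the ideal
  generated by a power of \<open>a\<close> and the product of all other powers is an intersection of
  ideals, one for each codimension two flat inside the hyperplane of \<open>a\<close>, and
  membership can be tested flat by flat. Locally everything is measured against the basis of D(A_X)
  formed by the Euler derivation and one derivation of degree |A_X| - 1. When the products agree,
  one exponent is |A_X| - 1; degrees and the determinant then force some element of D(A_X,m) to have
  coefficient one at the second basis element. A derivation is seen only through its values at
  linear forms, which the Euler derivation fixes, so that no division by a degree occurs. Minimal
  generating sets presuppose finite generation, which comes from a comparison of leading
  monomials.\<close>

section \<open>Polynomials and their evaluation\<close>

abbreviation look :: "('a \<Rightarrow>\<^sub>0 'b::zero) \<Rightarrow> 'a \<Rightarrow> 'b" where "look \<equiv> Poly_Mapping.lookup"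
abbreviation "keys \<equiv> Poly_Mapping.keys"
abbreviation "single \<equiv> Poly_Mapping.single"
abbreviation "lf \<equiv> linear_form"

lemma Const_0 [simp]: "Const 0 = 0"
  and Const_1 [simp]: "Const 1 = 1"
  and Const_add: "Const (a + b) = Const a + Const b"
  and Const_diff: "Const (a - b) = Const a - Const b"
  and Const_uminus: "Const (- a) = - Const a"
  and Const_mult: "Const (a * b) = Const a * Const b"
  by (simp_all add: Const_def single_add single_diff single_uminus mult_single)

lemma Const_sum: "Const (sum f I) = (\<Sum>i\<in>I. Const (f i))"
  by (induction I rule: infinite_finite_induct) (auto simp: Const_add)

lemma Const_eq_iff [simp]: "Const a = Const b \<longleftrightarrow> a = b"
  unfolding Const_def by (metis lookup_single_eq)

lemma Const_eq_0_iff [simp]: "Const a = 0 \<longleftrightarrow> a = 0"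
  using Const_eq_iff[of a 0] by (simp del: Const_eq_iff)

lemma lookup_Const_mult: "look (Const c * f) t = c * look f t"
proof -
  have "Const c * f = Poly_Mapping.map ((*) c) f"
    unfolding Const_def by (rule mult_map_scale_conv_mult[symmetric])
  then show ?thesis by (simp add: Poly_Mapping.map.rep_eq when_def)
qed

text \<open>Coefficients may be sent to any commutative ring, so that one evaluation map serves for
  substitutions (\<open>Const\<close>), for values at points (the identity) and for a change of the
  variables.\<close>

definition coeff_hom :: "('k::field \<Rightarrow> 'a::comm_ring_1) \<Rightarrow> bool" where
  "coeff_hom c \<longleftrightarrow> (\<forall>a b. c (a + b) = c a + c b) \<and> (\<forall>a b. c (a * b) = c a * c b) \<and> c 1 = 1"

definition insertion ::
  "('k::field \<Rightarrow> 'a::comm_ring_1) \<Rightarrow> ('n::finite \<Rightarrow> 'a) \<Rightarrow> ('n, 'k) mpoly \<Rightarrow> 'a" where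
  "insertion c v f = (\<Sum>t\<in>keys f. c (look f t) * (\<Prod>i\<in>UNIV. v i ^ look t i))"

lemma coeff_hom_0: "coeff_hom c \<Longrightarrow> c 0 = 0"
  unfolding coeff_hom_def by (metis add_cancel_left_right)

lemma insertion_superset:
  assumes "coeff_hom c" "finite T" "keys f \<subseteq> T"
  shows "insertion c v f = (\<Sum>t\<in>T. c (look f t) * (\<Prod>i\<in>UNIV. v i ^ look t i))"
  unfolding insertion_def using assms
  by (intro sum.mono_neutral_left) (auto simp: coeff_hom_0 in_keys_iff)

lemma insertion_add:
  assumes "coeff_hom c"
  shows "insertion c v (f + g) = insertion c v f + insertion c v g"
proof -
  let ?T = "keys f \<union> keys g"
  have "keys (f + g) \<subseteq> ?T" by (rule keys_add)
  then have "insertion c v (f + g) = (\<Sum>t\<in>?T. c (look (f+g) t) * (\<Prod>i\<in>UNIV. v i ^ look t i))"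
    using assms by (intro insertion_superset) auto
  also have "\<dots> = (\<Sum>t\<in>?T. c (look f t) * (\<Prod>i\<in>UNIV. v i ^ look t i)) +
      (\<Sum>t\<in>?T. c (look g t) * (\<Prod>i\<in>UNIV. v i ^ look t i))"
    using assms by (simp add: lookup_add coeff_hom_def algebra_simps sum.distrib)
  also have "\<dots> = insertion c v f + insertion c v g"
    using assms by (simp add: insertion_superset[of c ?T])
  finally show ?thesis .
qed

lemma insertion_0 [simp]: "insertion c v 0 = 0"
  by (simp add: insertion_def)

lemma insertion_single:
  assumes "coeff_hom c"
  shows "insertion c v (single t a) = c a * (\<Prod>i\<in>UNIV. v i ^ look t i)"
  using assms by (simp add: insertion_superset[of c "{t}"])

lemma insertion_sum:
  assumes "coeff_hom c"
  shows "insertion c v (sum f I) = (\<Sum>i\<in>I. insertion c v (f i))"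
  by (induction I rule: infinite_finite_induct) (auto simp: insertion_add assms)

lemma mpoly_expand: "f = (\<Sum>t\<in>keys f. single t (look f t))"
  for f :: "'a \<Rightarrow>\<^sub>0 'b::comm_monoid_add"
  by (rule poly_mapping_eqI) (simp add: lookup_sum lookup_single when_def in_keys_iff)

lemma insertion_mult:
  assumes "coeff_hom c"
  shows "insertion c v (f * g) = insertion c v f * insertion c v g"
proof -
  have "f * g = (\<Sum>t\<in>keys f. \<Sum>s\<in>keys g.
      single (t + s) (look f t * look g s))"
    by (subst mpoly_expand[of f], subst mpoly_expand[of g]) (simp add: sum_product mult_single)
  then have "insertion c v (f * g) = (\<Sum>t\<in>keys f. \<Sum>s\<in>keys g.
      c (look f t * look g s) * (\<Prod>i\<in>UNIV. v i ^ look (t + s) i))"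
    by (simp add: insertion_sum insertion_single assms)
  also have "\<dots> = insertion c v f * insertion c v g"
    using assms unfolding insertion_def
    by (simp add: sum_product lookup_add power_add prod.distrib coeff_hom_def algebra_simps)
  finally show ?thesis .
qed

lemma insertion_uminus:
  assumes "coeff_hom c" shows "insertion c v (- f) = - insertion c v f"
  using insertion_add[OF assms, of v f "- f"] by (simp add: add_eq_0_iff2)

lemma insertion_diff:
  assumes "coeff_hom c" shows "insertion c v (f - g) = insertion c v f - insertion c v g"
  using insertion_add[OF assms, of v f "- g"] by (simp add: insertion_uminus assms)

lemma insertion_Const:
  assumes "coeff_hom c" shows "insertion c v (Const a) = c a"
  by (simp add: Const_def insertion_single assms)

lemma insertion_1:
  assumes "coeff_hom c" shows "insertion c v 1 = 1"
  using insertion_Const[OF assms, of v 1] assms by (simp add: coeff_hom_def)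

lemma insertion_Var:
  assumes "coeff_hom c" shows "insertion c v (Var i) = v i"
proof -
  have "(\<Prod>j\<in>UNIV. v j ^ look (single i (Suc 0)) j) = (\<Prod>j\<in>UNIV. if j = i then v j else 1)"
    by (intro prod.cong) (auto simp: lookup_single when_def)
  then show ?thesis
    using assms by (simp add: Var_def insertion_single coeff_hom_def)
qed

lemma coeff_hom_Const: "coeff_hom Const"
  by (simp add: coeff_hom_def Const_add Const_mult)

lemma coeff_hom_id: "coeff_hom (\<lambda>x. x)"
  by (simp add: coeff_hom_def)

lemma single_conv_prod_Var:
  "single t a = Const a * (\<Prod>i\<in>UNIV. Var i ^ look t i)" for t :: "'n::finite \<Rightarrow>\<^sub>0 nat"
proof -
  have pw: "Var i ^ j = single (single i j) (1::'a)" for i :: 'n and j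
    by (induction j) (auto simp: Var_def mult_single simp flip: single_add)
  have pr: "(\<Prod>i\<in>I. single (s i) (1::'a)) = single (\<Sum>i\<in>I. s i) 1"
    for I :: "'n set" and s :: "'n \<Rightarrow> 'n \<Rightarrow>\<^sub>0 nat"
    by (induction I rule: infinite_finite_induct) (auto simp: mult_single)
  have "t = (\<Sum>i\<in>UNIV. single i (look t i))"
    by (rule poly_mapping_eqI) (simp add: lookup_sum lookup_single when_def)
  then show ?thesis
    by (simp add: pw pr Const_def mult_single)
qed

lemma insertion_Const_Var: "insertion Const Var f = f"
proof -
  have "insertion Const Var f = (\<Sum>t\<in>keys f. single t (look f t))"
    unfolding insertion_def by (intro sum.cong) (auto simp: single_conv_prod_Var)
  then show ?thesis
    using mpoly_expand[of f] by simp
qed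

lemma dvd_diff_trans: "p dvd x - y \<Longrightarrow> p dvd y - z \<Longrightarrow> p dvd x - (z::'a::comm_ring_1)"
  using dvd_add[of p "x - y" "y - z"] by simp

lemma dvd_diff_mult: "p dvd x - y \<Longrightarrow> p dvd x' - y' \<Longrightarrow> p dvd x * x' - y * (y'::'a::comm_ring_1)"
proof -
  assume a: "p dvd x - y" "p dvd x' - y'"
  have "x * x' - y * y' = x * (x' - y') + (x - y) * y'" by (simp add: algebra_simps)
  then show ?thesis using a by simp
qed

text \<open>Sums and products respect congruences, hence so does every polynomial expression. It is
  applied to a substitution that changes one variable by a multiple of \<open>p\<close>.\<close>

lemma dvd_insertion_diff:
  assumes "\<And>i. p dvd v i - w i"
  shows "p dvd insertion c v f - insertion c w f"
proof -
  have pw: "p dvd v i ^ j - w i ^ j" for i j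
    by (induction j) (auto intro: dvd_diff_mult assms)
  have "p dvd (\<Prod>i\<in>I. v i ^ h i) - (\<Prod>i\<in>I. w i ^ h i)" for I and h :: "_ \<Rightarrow> nat"
    by (induction I rule: infinite_finite_induct) (auto intro: dvd_diff_mult pw)
  then show ?thesis
    unfolding insertion_def
    by (simp flip: sum_subtractf right_diff_distrib) (intro dvd_sum dvd_mult)
qed

section \<open>The polynomial ring is a domain\<close>

text \<open>The library proves that polynomials over linearly ordered variables form a domain, so
  polynomials are embedded into polynomials in variables indexed by natural numbers.\<close>

lemma mpoly_mult_eq_0_iff:
  fixes f g :: "('n::finite, 'k::field) mpoly"
  shows "f * g = 0 \<longleftrightarrow> f = 0 \<or> g = 0"
proof -
  obtain e :: "'n \<Rightarrow> nat" where e: "inj e"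
    using finite_imp_inj_to_nat_seg[of "UNIV :: 'n set"] by auto
  define c :: "'k \<Rightarrow> (nat \<Rightarrow>\<^sub>0 nat) \<Rightarrow>\<^sub>0 'k" where "c = single 0"
  define v :: "'n \<Rightarrow> (nat \<Rightarrow>\<^sub>0 nat) \<Rightarrow>\<^sub>0 'k"
    where "v i = single (single (e i) 1) 1" for i
  \<comment> \<open>\<open>push\<close> relabels exponent vectors along \<open>e\<close>. It is
    injective, so every coefficient of \<open>f\<close> can be read off the evaluated polynomial,
    and the evaluation has trivial kernel.\<close>
  define push :: "('n \<Rightarrow>\<^sub>0 nat) \<Rightarrow> nat \<Rightarrow>\<^sub>0 nat"
    where "push t = (\<Sum>i\<in>UNIV. single (e i) (look t i))" for t
  have c: "coeff_hom c"
    by (simp add: c_def coeff_hom_def single_add mult_single)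
  have pw: "v i ^ j = single (single (e i) j) (1::'k)" for i j
    by (induction j) (auto simp: v_def mult_single simp flip: single_add)
  have pr: "(\<Prod>i\<in>I. single (s i) (1::'k)) = single (\<Sum>i\<in>I. s i) 1"
    for I :: "'n set" and s :: "'n \<Rightarrow> nat \<Rightarrow>\<^sub>0 nat"
    by (induction I rule: infinite_finite_induct) (auto simp: mult_single)
  have ins: "insertion c v f = (\<Sum>t\<in>keys f. single (push t) (look f t))" for f
    unfolding insertion_def by (intro sum.cong) (auto simp: pw pr c_def mult_single push_def)
  have look_push: "look (push t) (e i) = look t i" for t i
    using e by (simp add: push_def lookup_sum lookup_single when_def inj_eq)
  have inj_push: "push s = push t \<longleftrightarrow> s = t" for s t
    by (metis look_push poly_mapping_eqI)
  have inj0: "f = 0" if "insertion c v f = 0" for f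
  proof (rule poly_mapping_eqI)
    fix t
    have "look (insertion c v f) (push t) = (\<Sum>s\<in>keys f. look f s when s = t)"
      by (simp add: ins lookup_sum lookup_single inj_push)
    also have "\<dots> = look f t" by (simp add: when_def in_keys_iff)
    finally show "look f t = look 0 t" using that by simp
  qed
  show ?thesis
    using inj0[of f] inj0[of g] insertion_mult[OF c, of v f g] by auto
qed

lemma mpoly_power_eq_0_iff: "f ^ j = 0 \<longleftrightarrow> f = 0 \<and> j > 0"
  for f :: "('n::finite, 'k::field) mpoly"
  by (induction j) (auto simp: mpoly_mult_eq_0_iff)

lemma mpoly_prod_eq_0_iff: "finite I \<Longrightarrow> prod f I = 0 \<longleftrightarrow> (\<exists>i\<in>I. f i = 0)"
  for f :: "'b \<Rightarrow> ('n::finite, 'k::field) mpoly"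
  by (induction I rule: finite_induct) (auto simp: mpoly_mult_eq_0_iff)

lemma mpoly_mult_left_cancel: "h \<noteq> 0 \<Longrightarrow> h * f = h * g \<longleftrightarrow> f = g"
  for f :: "('n::finite, 'k::field) mpoly"
  using mpoly_mult_eq_0_iff[of h "f - g"] by (auto simp: right_diff_distrib)

lemma mpoly_dvd_mult_cancel: "h \<noteq> 0 \<Longrightarrow> h * f dvd h * g \<longleftrightarrow> f dvd g"
  for f :: "('n::finite, 'k::field) mpoly"
  unfolding dvd_def by (simp add: mult.assoc mpoly_mult_left_cancel)

section \<open>Linear forms\<close>

definition scalar_prod :: "'k::field ^ 'n::finite \<Rightarrow> 'k ^ 'n \<Rightarrow> 'k" (infix "\<bullet>\<bullet>" 70) where
  "a \<bullet>\<bullet> v = (\<Sum>i\<in>UNIV. a $ i * v $ i)"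

lemma scalar_prod_simps:
  "(a + b) \<bullet>\<bullet> v = a \<bullet>\<bullet> v + b \<bullet>\<bullet> v" "(a - b) \<bullet>\<bullet> v = a \<bullet>\<bullet> v - b \<bullet>\<bullet> v"
  "a \<bullet>\<bullet> (u + v) = a \<bullet>\<bullet> u + a \<bullet>\<bullet> v" "a \<bullet>\<bullet> (u - v) = a \<bullet>\<bullet> u - a \<bullet>\<bullet> v"
  "(c *s a) \<bullet>\<bullet> v = c * (a \<bullet>\<bullet> v)" "a \<bullet>\<bullet> (c *s v) = c * (a \<bullet>\<bullet> v)"
  "0 \<bullet>\<bullet> v = 0" "a \<bullet>\<bullet> 0 = 0"
  by (simp_all add: scalar_prod_def sum.distrib sum_subtractf sum_distrib_left algebra_simps)

lemma scalar_prod_axis [simp]: "a \<bullet>\<bullet> axis i 1 = a $ i"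
proof -
  have "a \<bullet>\<bullet> axis i 1 = (\<Sum>j\<in>UNIV. if j = i then a $ j else 0)"
    unfolding scalar_prod_def by (intro sum.cong) (auto simp: axis_def)
  then show ?thesis by simp
qed

lemma mem_hyperplane: "v \<in> hyperplane a \<longleftrightarrow> a \<bullet>\<bullet> v = 0"
  by (simp add: hyperplane_def scalar_prod_def)

lemma linear_form_add: "lf (a + b) = lf a + lf b"
  and linear_form_diff: "lf (a - b) = lf a - lf b"
  and linear_form_scale: "lf (c *s a) = Const c * lf a"
  by (simp_all add: linear_form_def Const_add Const_diff Const_mult sum.distrib sum_subtractf
      sum_distrib_left algebra_simps)

lemma insertion_linear_form:
  assumes "coeff_hom c"
  shows "insertion c v (lf a) = (\<Sum>i\<in>UNIV. c (a $ i) * v i)"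
  by (simp add: linear_form_def insertion_sum insertion_mult insertion_Const insertion_Var assms)

lemma insertion_linear_form_point: "insertion (\<lambda>x. x) (($) v) (lf a) = a \<bullet>\<bullet> v"
  by (simp add: insertion_linear_form coeff_hom_id scalar_prod_def)

lemma linear_form_0 [simp]: "lf 0 = 0"
  by (simp add: linear_form_def)

lemma linear_form_eq_0_iff: "lf a = 0 \<longleftrightarrow> a = 0"
proof
  assume "lf a = 0"
  then have "a $ i = 0" for i
    using insertion_linear_form_point[of "axis i 1" a] by simp
  then show "a = 0" by (simp add: vec_eq_iff)
qed simp

text \<open>Solving \<open>a = 0\<close> for the \<open>i\<close>-th coordinate; the kernel of this endomorphism is the
  ideal generated by the form of \<open>a\<close>, which therefore is prime.\<close>

definition elim :: "'k ^ 'n \<Rightarrow> 'n \<Rightarrow> ('n::finite, 'k::field) mpoly \<Rightarrow> ('n, 'k) mpoly" where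
  "elim a i = insertion Const (\<lambda>j. if j = i then Var i - Const (1 / a $ i) * lf a else Var j)"

lemma elim_ring_hom:
  "elim a i (f + g) = elim a i f + elim a i g"
  "elim a i (f - g) = elim a i f - elim a i g"
  "elim a i (f * g) = elim a i f * elim a i g"
  by (simp_all add: elim_def insertion_add insertion_diff insertion_mult coeff_hom_Const)

text \<open>The \<open>i\<close>-th coefficient of the resulting form is zero: the variable is
  eliminated from \<open>b\<close>, and \<open>a\<close> itself is sent to zero.\<close>

lemma elim_linear_form:
  assumes "a $ i \<noteq> 0"
  shows "elim a i (lf b) = lf (b - (b $ i / a $ i) *s a)"
proof -
  have "elim a i (lf b) =
     (\<Sum>j\<in>UNIV. Const (b $ j) * Var j - (if j = i then Const (b $ j) * (Const (1 / a $ i) * lf a) else 0))"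
    unfolding elim_def insertion_linear_form[OF coeff_hom_Const]
    by (intro sum.cong) (auto simp: algebra_simps)
  also have "\<dots> = lf b - Const (b $ i) * (Const (1 / a $ i) * lf a)"
    by (simp add: sum_subtractf linear_form_def)
  also have "\<dots> = lf b - Const (b $ i / a $ i) * lf a"
    by (simp flip: mult.assoc Const_mult)
  finally show ?thesis
    by (simp add: linear_form_diff linear_form_scale)
qed

lemma elim_cong: "lf a dvd f - elim a i f"
proof -
  have "lf a dvd Var j - (if j = i then Var i - Const (1 / a $ i) * lf a else Var j)" for j
    by auto
  from dvd_insertion_diff[of "lf a" Var, OF this, of Const f]
  show ?thesis by (simp add: elim_def insertion_Const_Var)
qed

lemma elim_eq_0_iff:
  assumes "a $ i \<noteq> 0"
  shows "elim a i f = 0 \<longleftrightarrow> lf a dvd f"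
proof
  assume "elim a i f = 0" then show "lf a dvd f" using elim_cong[of a f i] by simp
next
  have "elim a i (lf a) = 0" using assms by (simp add: elim_linear_form)
  then show "lf a dvd f \<Longrightarrow> elim a i f = 0"
    by (auto simp: dvd_def elim_ring_hom)
qed

lemma vec_nonzero_component: "a \<noteq> 0 \<Longrightarrow> \<exists>i. a $ i \<noteq> 0"
  by (auto simp: vec_eq_iff)

lemma linear_form_dvd_mult_iff:
  assumes "a \<noteq> 0"
  shows "lf a dvd f * g \<longleftrightarrow> lf a dvd f \<or> lf a dvd g"
  using vec_nonzero_component[OF assms] elim_eq_0_iff[of a]
  by (metis elim_ring_hom(3) mpoly_mult_eq_0_iff)

lemma linear_form_not_dvd_1:
  assumes "a \<noteq> 0" shows "\<not> lf a dvd 1"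
  using vec_nonzero_component[OF assms] elim_eq_0_iff[of a _ 1]
  by (auto simp: elim_def insertion_1 coeff_hom_Const)

lemma linear_form_dvd_power:
  assumes "a \<noteq> 0" shows "lf a dvd f ^ j \<Longrightarrow> lf a dvd f"
  by (induction j) (use assms in \<open>auto simp: linear_form_dvd_mult_iff linear_form_not_dvd_1\<close>)

lemma linear_form_dvd_prod:
  assumes "a \<noteq> 0" "finite I" "lf a dvd (\<Prod>i\<in>I. f i)"
  shows "\<exists>i\<in>I. lf a dvd f i"
  using assms(2,3)
  by (induction I rule: finite_induct)
     (use assms(1) in \<open>auto simp: linear_form_dvd_mult_iff linear_form_not_dvd_1\<close>)

section \<open>Ideals generated by two linear forms\<close>

definition in_ideal2 :: "'a::comm_ring_1 \<Rightarrow> 'a \<Rightarrow> 'a \<Rightarrow> bool" where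
  "in_ideal2 p q f \<longleftrightarrow> (\<exists>r s. f = r * p + s * q)"

text \<open>Eliminating one variable by means of \<open>a\<close>, and a second one by means of the
  image \<open>b'\<close> of \<open>b\<close>, is a ring endomorphism of a domain whose kernel is
  the ideal in question.\<close>

lemma linear_forms_ideal_prime:
  assumes "a \<noteq> 0" "\<And>c. b \<noteq> c *s a"
    and "in_ideal2 (lf a) (lf b) (f * g)"
  shows "in_ideal2 (lf a) (lf b) f \<or> in_ideal2 (lf a) (lf b) g"
proof -
  obtain i where i: "a $ i \<noteq> 0" using vec_nonzero_component[OF assms(1)] by blast
  define b' where "b' = b - (b $ i / a $ i) *s a"
  have "b' \<noteq> 0" using assms(2) by (simp add: b'_def)
  then obtain j where j: "b' $ j \<noteq> 0" using vec_nonzero_component by blast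
  let ?h = "\<lambda>f. elim b' j (elim a i f)"
  have eb: "elim a i (lf b) = lf b'" by (simp add: elim_linear_form i b'_def)
  have ea: "elim a i (lf a) = 0" by (simp add: elim_linear_form i)
  have z: "elim b' j 0 = 0" "elim b' j (lf b') = 0" using j by (simp_all add: elim_eq_0_iff)
  obtain r s where "f * g = r * lf a + s * lf b"
    using assms(3) by (auto simp: in_ideal2_def)
  then have "?h (f * g) = ?h (r * lf a + s * lf b)" by simp
  also have "\<dots> = 0" using z by (simp add: elim_ring_hom ea eb)
  finally have "?h (f * g) = 0" .
  then have "?h f = 0 \<or> ?h g = 0" by (simp add: elim_ring_hom mpoly_mult_eq_0_iff)
  moreover have "in_ideal2 (lf a) (lf b) f" if "?h f = 0" for f
  proof -
    have "lf b' dvd elim a i f" using that j by (simp add: elim_eq_0_iff)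
    then obtain r where "elim a i f = lf b' * r" by (auto simp: dvd_def)
    moreover obtain s where "f - elim a i f = lf a * s"
      using elim_cong[of a f i] by (auto simp: dvd_def)
    ultimately have "f = lf a * s + lf b' * r"
      by (metis diff_add_cancel)
    moreover have "lf b' = lf b - Const (b $ i / a $ i) * lf a"
      by (simp add: b'_def linear_form_diff linear_form_scale)
    ultimately have "f = (s - Const (b $ i / a $ i) * r) * lf a + r * lf b"
      by (simp add: algebra_simps)
    then show ?thesis unfolding in_ideal2_def by blast
  qed
  ultimately show ?thesis by blast
qed

lemma linear_form_in_ideal2_hyperplane:
  assumes "in_ideal2 (lf a) (lf b) (lf c)"
  shows "hyperplane a \<inter> hyperplane b \<subseteq> hyperplane c"
proof
  fix v assume v: "v \<in> hyperplane a \<inter> hyperplane b"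
  obtain r s where "lf c = r * lf a + s * lf b"
    using assms by (auto simp: in_ideal2_def)
  from arg_cong[where f = "insertion (\<lambda>x. x) (($) v)", OF this]
  show "v \<in> hyperplane c"
    using v by (simp add: insertion_add insertion_mult coeff_hom_id insertion_linear_form_point mem_hyperplane)
qed

lemma linear_form_dvd_hyperplane:
  assumes "lf a dvd lf b" shows "hyperplane a \<subseteq> hyperplane b"
proof -
  obtain r where "lf b = r * lf a + 0 * lf a"
    using assms by (auto simp: dvd_def mult.commute)
  then have "in_ideal2 (lf a) (lf a) (lf b)"
    unfolding in_ideal2_def by blast
  from linear_form_in_ideal2_hyperplane[OF this] show ?thesis by simp
qed

section \<open>Homogeneous components\<close>

definition tdeg :: "('n::finite \<Rightarrow>\<^sub>0 nat) \<Rightarrow> nat" where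
  "tdeg t = (\<Sum>i\<in>UNIV. look t i)"

lemma homogeneous_poly_iff: "homogeneous_poly d f \<longleftrightarrow> (\<forall>t. look f t \<noteq> 0 \<longrightarrow> tdeg t = d)"
  by (auto simp: homogeneous_poly_def tdeg_def in_keys_iff)

lemma tdeg_add: "tdeg (s + t) = tdeg s + tdeg t"
  by (simp add: tdeg_def lookup_add sum.distrib)

definition hcomp :: "nat \<Rightarrow> ('n::finite, 'k::field) mpoly \<Rightarrow> ('n, 'k) mpoly" where
  "hcomp d f = (\<Sum>t\<in>keys f. single t (look f t when tdeg t = d))"

lemma lookup_hcomp: "look (hcomp d f) t = (look f t when tdeg t = d)"
  by (simp add: hcomp_def lookup_sum lookup_single when_def in_keys_iff)

lemma hcomp_add: "hcomp d (f + g) = hcomp d f + hcomp d g"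
  and hcomp_diff: "hcomp d (f - g) = hcomp d f - hcomp d g"
  and hcomp_0 [simp]: "hcomp d 0 = 0"
  by (auto intro!: poly_mapping_eqI simp: lookup_hcomp lookup_add lookup_minus when_def)

lemma hcomp_sum: "hcomp d (sum f I) = (\<Sum>i\<in>I. hcomp d (f i))"
  by (induction I rule: infinite_finite_induct) (auto simp: hcomp_add)

lemma homogeneous_hcomp: "homogeneous_poly d (hcomp d f)"
  by (auto simp: homogeneous_poly_iff lookup_hcomp when_def split: if_splits)

lemma hcomp_homogeneous: "homogeneous_poly e f \<Longrightarrow> hcomp d f = (if d = e then f else 0)"
  by (rule poly_mapping_eqI) (auto simp: homogeneous_poly_iff lookup_hcomp when_def)

lemma homogeneous_0 [simp]: "homogeneous_poly d 0"
  by (simp add: homogeneous_poly_iff)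

lemma homogeneous_add: "homogeneous_poly d f \<Longrightarrow> homogeneous_poly d g \<Longrightarrow> homogeneous_poly d (f + g)"
  by (auto simp: homogeneous_poly_iff lookup_add) (metis add.right_neutral)

lemma homogeneous_diff: "homogeneous_poly d f \<Longrightarrow> homogeneous_poly d g \<Longrightarrow> homogeneous_poly d (f - g)"
  by (auto simp: homogeneous_poly_iff lookup_minus) (metis diff_zero)

lemma homogeneous_sum: "(\<And>i. i \<in> I \<Longrightarrow> homogeneous_poly d (f i)) \<Longrightarrow> homogeneous_poly d (sum f I)"
  by (induction I rule: infinite_finite_induct) (auto intro: homogeneous_add)

lemma homogeneous_mult:
  assumes "homogeneous_poly d f" "homogeneous_poly e g"
  shows "homogeneous_poly (d + e) (f * g)"
  unfolding homogeneous_poly_iff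
proof (intro allI impI)
  fix t assume "look (f * g) t \<noteq> 0"
  then have "t \<in> keys (f * g)" by (simp add: in_keys_iff)
  then obtain a b where "t = a + b" "look f a \<noteq> 0" "look g b \<noteq> 0"
    using keys_mult[of f g] by (auto simp: in_keys_iff)
  then show "tdeg t = d + e" using assms by (simp add: homogeneous_poly_iff tdeg_add)
qed

lemma homogeneous_Const: "homogeneous_poly 0 (Const c)"
  by (simp add: homogeneous_poly_iff Const_def lookup_single when_def tdeg_def)

lemma homogeneous_1: "homogeneous_poly 0 1"
  using homogeneous_Const[of 1] by simp

lemma homogeneous_Const_mult: "homogeneous_poly d f \<Longrightarrow> homogeneous_poly d (Const c * f)"
  using homogeneous_mult[OF homogeneous_Const, of d f c] by simp

lemma homogeneous_Var: "homogeneous_poly 1 (Var i)"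
  by (simp add: homogeneous_poly_iff Var_def lookup_single when_def tdeg_def)

lemma homogeneous_linear_form: "homogeneous_poly 1 (lf a)"
  unfolding linear_form_def by (intro homogeneous_sum homogeneous_Const_mult homogeneous_Var)

lemma homogeneous_power: "homogeneous_poly d f \<Longrightarrow> homogeneous_poly (j * d) (f ^ j)"
  by (induction j) (auto intro: homogeneous_mult homogeneous_1)

lemma homogeneous_prod:
  "(\<And>i. i \<in> I \<Longrightarrow> homogeneous_poly (d i) (f i)) \<Longrightarrow> homogeneous_poly (sum d I) (prod f I)"
  by (induction I rule: infinite_finite_induct) (auto intro: homogeneous_mult homogeneous_1)

lemma homogeneous_degree_0:
  assumes "homogeneous_poly 0 f" shows "\<exists>c. f = Const c"
proof
  show "f = Const (look f 0)"
  proof (rule poly_mapping_eqI)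
    fix t
    have "look f t = 0" if "t \<noteq> 0"
    proof (rule ccontr)
      assume "look f t \<noteq> 0"
      then have "tdeg t = 0" using assms by (simp add: homogeneous_poly_iff)
      then have "t = 0" by (intro poly_mapping_eqI) (simp add: tdeg_def)
      with that show False ..
    qed
    then show "look f t = look (Const (look f 0)) t"
      by (auto simp: Const_def lookup_single when_def)
  qed
qed

lemma hcomp_eq_0: "d \<notin> tdeg ` keys f \<Longrightarrow> hcomp d f = 0"
  by (rule poly_mapping_eqI) (auto simp: lookup_hcomp when_def in_keys_iff image_iff)

lemma sum_hcomp: "f = (\<Sum>d\<in>tdeg ` keys f. hcomp d f)"
  by (rule poly_mapping_eqI)
     (auto simp: lookup_sum lookup_hcomp when_def in_keys_iff image_iff)

lemma hcomp_mult:
  assumes "homogeneous_poly e p"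
  shows "hcomp d (f * p) = (if e \<le> d then hcomp (d - e) f * p else 0)"
proof -
  let ?D = "tdeg ` keys f"
  have "hcomp d (f * p) = hcomp d (\<Sum>j\<in>?D. hcomp j f * p)"
    by (subst sum_hcomp[of f]) (simp add: sum_distrib_right)
  also have "\<dots> = (\<Sum>j\<in>?D. if d = j + e then hcomp j f * p else 0)"
    unfolding hcomp_sum
    by (intro sum.cong) (auto simp: hcomp_homogeneous[OF homogeneous_mult[OF homogeneous_hcomp assms]])
  also have "\<dots> = (\<Sum>j\<in>?D. if j = d - e then (if e \<le> d then hcomp j f * p else 0) else 0)"
    by (intro sum.cong) auto
  also have "\<dots> = (if d - e \<in> ?D then (if e \<le> d then hcomp (d - e) f * p else 0) else 0)"
    by (subst sum.delta) auto
  also have "\<dots> = (if e \<le> d then hcomp (d - e) f * p else 0)"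
  proof (cases "d - e \<in> ?D")
    case False
    then have "hcomp (d - e) f = 0" by (rule hcomp_eq_0)
    then show ?thesis by simp
  qed simp
  finally show ?thesis .
qed

lemma hcomp_Const_mult: "hcomp d (Const c * f) = Const c * hcomp d f"
  using hcomp_mult[OF homogeneous_Const, of d f c] by (simp add: mult.commute)

text \<open>The product equals its component of degree \<open>d\<close>, which is
  \<open>hcomp (d - e) f * p\<close>; cancelling \<open>p\<close> identifies \<open>f\<close> with
  one of its own components.\<close>

lemma homogeneous_factor:
  assumes "homogeneous_poly e p" "p \<noteq> 0" "homogeneous_poly d (f * p)" "f \<noteq> 0"
  shows "e \<le> d \<and> homogeneous_poly (d - e) f"
proof -
  have nz: "f * p \<noteq> 0" using assms by (simp add: mpoly_mult_eq_0_iff)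
  have "f * p = hcomp d (f * p)" using assms(3) by (simp add: hcomp_homogeneous)
  then have *: "f * p = (if e \<le> d then hcomp (d - e) f * p else 0)"
    using hcomp_mult[OF assms(1)] by simp
  with nz have "e \<le> d" by (auto split: if_splits)
  with * have "p * f = p * hcomp (d - e) f" by (simp add: mult.commute)
  then have "f = hcomp (d - e) f" using assms(2) by (simp add: mpoly_mult_left_cancel)
  then show ?thesis using \<open>e \<le> d\<close> homogeneous_hcomp[of "d - e" f] by simp
qed

lemma homogeneous_0_linear_form_dvd:
  assumes "homogeneous_poly 0 f" "a \<noteq> 0" "lf a dvd f" shows "f = 0"
proof (rule ccontr)
  assume "f \<noteq> 0"
  obtain g where g: "f = g * lf a" using assms(3) by (auto simp: dvd_def mult.commute)
  moreover have "g \<noteq> 0" using g \<open>f \<noteq> 0\<close> by auto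
  ultimately show False
    using homogeneous_factor[OF homogeneous_linear_form, of a 0 g] assms by (simp add: linear_form_eq_0_iff)
qed

section \<open>Homogeneous components of derivations\<close>

definition dcomp :: "nat \<Rightarrow> ('n::finite, 'k::field) der \<Rightarrow> ('n, 'k) der" where
  "dcomp d \<theta> = (\<chi> i. hcomp d (\<theta> $ i))"

lemma dcomp_add: "dcomp d (\<theta> + \<eta>) = dcomp d \<theta> + dcomp d \<eta>"
  and dcomp_0 [simp]: "dcomp d 0 = 0"
  by (simp_all add: dcomp_def vec_eq_iff hcomp_add)

lemma dcomp_sum: "dcomp d (sum f I) = (\<Sum>i\<in>I. dcomp d (f i))"
  by (induction I rule: infinite_finite_induct) (auto simp: dcomp_add)

lemma homogeneous_dcomp: "homogeneous_der d (dcomp d \<theta>)"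
  by (simp add: homogeneous_der_def dcomp_def homogeneous_hcomp)

lemma dcomp_homogeneous: "homogeneous_der e \<theta> \<Longrightarrow> dcomp d \<theta> = (if d = e then \<theta> else 0)"
  by (auto simp: homogeneous_der_def dcomp_def vec_eq_iff hcomp_homogeneous[of e])

lemma dcomp_scale:
  assumes "homogeneous_der e \<theta>"
  shows "dcomp d (f *s \<theta>) = (if e \<le> d then hcomp (d - e) f *s \<theta> else 0)"
  using assms by (auto simp: homogeneous_der_def dcomp_def vec_eq_iff hcomp_mult[of e])

lemma homogeneous_der_scale:
  "homogeneous_poly d f \<Longrightarrow> homogeneous_der e \<theta> \<Longrightarrow> homogeneous_der (d + e) (f *s \<theta>)"
  by (simp add: homogeneous_der_def homogeneous_mult)

lemma sum_dcomp:
  fixes \<theta> :: "('n::finite, 'k::field) der"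
  shows "\<exists>D. finite D \<and> \<theta> = (\<Sum>d\<in>D. dcomp d \<theta>)"
proof -
  define D where "D = (\<Union>i. tdeg ` keys (\<theta> $ i))"
  have fin: "finite D" by (simp add: D_def)
  have "\<theta> $ i = (\<Sum>d\<in>D. hcomp d (\<theta> $ i))" for i
  proof -
    have "(\<Sum>d\<in>tdeg ` keys (\<theta> $ i). hcomp d (\<theta> $ i)) = (\<Sum>d\<in>D. hcomp d (\<theta> $ i))"
      using fin by (intro sum.mono_neutral_left)
        (auto simp: D_def hcomp_eq_0)
    then show ?thesis using sum_hcomp[of "\<theta> $ i"] by simp
  qed
  then have "\<theta> = (\<Sum>d\<in>D. dcomp d \<theta>)" by (simp add: vec_eq_iff dcomp_def)
  with fin show ?thesis by blast
qed

section \<open>Derivations of linear forms\<close>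

text \<open>\<open>ap \<theta> a\<close> is \<open>\<theta>\<close> applied to the linear form of \<open>a\<close>, see \<open>der_apply_linear_form\<close>.\<close>

definition ap :: "('n::finite, 'k::field) der \<Rightarrow> 'k ^ 'n \<Rightarrow> ('n, 'k) mpoly" where
  "ap \<theta> a = (\<Sum>i\<in>UNIV. Const (a $ i) * \<theta> $ i)"

lemma ap_simps:
  "ap (\<theta> + \<eta>) a = ap \<theta> a + ap \<eta> a" "ap (\<theta> - \<eta>) a = ap \<theta> a - ap \<eta> a"
  "ap (f *s \<theta>) a = f * ap \<theta> a" "ap 0 a = 0"
  "ap \<theta> (a + b) = ap \<theta> a + ap \<theta> b" "ap \<theta> (c *s a) = Const c * ap \<theta> a"
  by (simp_all add: ap_def algebra_simps sum.distrib sum_subtractf sum_distrib_left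
      Const_add Const_mult)

lemma ap_euler: "ap euler a = lf a"
  by (simp add: ap_def euler_def linear_form_def)

lemma hcomp_ap: "hcomp d (ap \<theta> a) = ap (dcomp d \<theta>) a"
  by (simp add: ap_def dcomp_def hcomp_sum hcomp_Const_mult)

lemma homogeneous_ap: "homogeneous_der d \<theta> \<Longrightarrow> homogeneous_poly d (ap \<theta> a)"
  unfolding ap_def by (intro homogeneous_sum homogeneous_Const_mult) (simp add: homogeneous_der_def)

lemma partial_superset:
  assumes "finite T" "keys f \<subseteq> T"
  shows "partial i f = (\<Sum>t\<in>T. single (t - single i 1)
       (of_nat (look t i) * look f t))"
  unfolding partial_def using assms by (intro sum.mono_neutral_left) (auto simp: in_keys_iff)

lemma partial_add: "partial i (f + g) = partial i f + partial i g"
proof -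
  let ?T = "keys f \<union> keys g"
  have "keys (f + g) \<subseteq> ?T" by (rule keys_add)
  then show ?thesis
    by (simp add: partial_superset[of ?T] lookup_add distrib_left single_add sum.distrib)
qed

lemma partial_sum: "partial i (sum f I) = (\<Sum>j\<in>I. partial i (f j))"
  by (induction I rule: infinite_finite_induct) (auto simp: partial_add, simp_all add: partial_def)

lemma partial_linear_form:
  fixes a :: "'k::field ^ 'n::finite"
  shows "partial i (lf a) = Const (a $ i)"
proof -
  have "partial i (Const (c :: 'k) * Var j) = (if j = i then Const c else 0)" for c and j :: 'n
    by (auto simp: Const_def Var_def mult_single partial_superset[of "{single j 1}"]
        lookup_single)
  then show ?thesis
    by (simp add: linear_form_def partial_sum)
qed

lemma der_apply_linear_form: "der_apply \<theta> (lf a) = ap \<theta> a"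
  by (simp add: der_apply_def ap_def partial_linear_form mult.commute)

lemma log_der_iff: "\<theta> \<in> log_der \<alpha> A m \<longleftrightarrow> (\<forall>H\<in>A. lf (\<alpha> H) ^ m H dvd ap \<theta> (\<alpha> H))"
  by (simp add: log_der_def der_apply_linear_form)

lemma subspace_log_der: "der.subspace (log_der \<alpha> A m)"
  by (rule der.subspaceI) (simp_all add: log_der_iff ap_simps)

lemma dvd_hcomp:
  assumes "homogeneous_poly e p" "p dvd f" shows "p dvd hcomp d f"
proof -
  obtain g where "f = g * p" using assms(2) by (auto simp: dvd_def mult.commute)
  then show ?thesis using assms(1) by (simp add: hcomp_mult)
qed

text \<open>Powers of linear forms are homogeneous, so divisibility by them passes to components:
  the logarithmic modules are graded.\<close>

lemma dcomp_log_der: "\<theta> \<in> log_der \<alpha> A m \<Longrightarrow> dcomp d \<theta> \<in> log_der \<alpha> A m"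
  unfolding log_der_iff hcomp_ap[symmetric]
  using dvd_hcomp[OF homogeneous_power[OF homogeneous_linear_form]] by blast

lemma homogeneous_euler: "homogeneous_der 1 euler"
  unfolding homogeneous_der_def euler_def by (simp only: vec_lambda_beta homogeneous_Var) simp

section \<open>Hyperplanes and linear forms\<close>

lemma scalar_prod_eqI: "(\<And>v. a \<bullet>\<bullet> v = b \<bullet>\<bullet> v) \<Longrightarrow> a = b"
  by (metis scalar_prod_axis vec_eq_iff)

lemma exists_scalar_prod_1:
  assumes "a \<noteq> 0" shows "\<exists>u. a \<bullet>\<bullet> u = 1"
proof -
  obtain i where "a $ i \<noteq> 0" using vec_nonzero_component[OF assms] by blast
  then have "a \<bullet>\<bullet> ((1 / a $ i) *s axis i 1) = 1" by (simp add: scalar_prod_simps)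
  then show ?thesis ..
qed

text \<open>Projecting along \<open>u\<close> moves every vector into the hyperplane of
  \<open>a\<close>, where \<open>b\<close> vanishes; so \<open>b\<close> is determined by its value
  at \<open>u\<close>.\<close>

lemma hyperplane_subset_imp_scale:
  assumes "a \<noteq> 0" "hyperplane a \<subseteq> hyperplane b" shows "\<exists>c. b = c *s a"
proof -
  obtain u where u: "a \<bullet>\<bullet> u = 1" using exists_scalar_prod_1[OF assms(1)] by blast
  have "b = (b \<bullet>\<bullet> u) *s a"
  proof (rule scalar_prod_eqI)
    fix v
    have "v - (a \<bullet>\<bullet> v) *s u \<in> hyperplane a"
      by (simp add: mem_hyperplane scalar_prod_simps u)
    then have "v - (a \<bullet>\<bullet> v) *s u \<in> hyperplane b" using assms(2) by blast
    then show "b \<bullet>\<bullet> v = ((b \<bullet>\<bullet> u) *s a) \<bullet>\<bullet> v"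
      by (simp add: mem_hyperplane scalar_prod_simps)
  qed
  then show ?thesis ..
qed

lemma hyperplane_scale: "c \<noteq> 0 \<Longrightarrow> hyperplane (c *s a) = hyperplane a"
  by (auto simp: mem_hyperplane scalar_prod_simps)

lemma hyperplane_subset_imp_eq:
  assumes "a \<noteq> 0" "b \<noteq> 0" "hyperplane a \<subseteq> hyperplane b" shows "hyperplane a = hyperplane b"
proof -
  obtain c where "b = c *s a" using hyperplane_subset_imp_scale assms by blast
  with assms(2) show ?thesis using hyperplane_scale[of c a] by (cases "c = 0") auto
qed

text \<open>The vectors \<open>u\<close> and \<open>w\<close> serve as coordinate directions
  transversal to the flat cut out by \<open>a\<close> and \<open>b\<close>.\<close>

lemma dual_pair:
  assumes "a \<noteq> 0" "b \<noteq> 0" "hyperplane a \<noteq> hyperplane b"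
  shows "\<exists>u w. a \<bullet>\<bullet> u = 1 \<and> b \<bullet>\<bullet> u = 0 \<and> a \<bullet>\<bullet> w = 0 \<and> b \<bullet>\<bullet> w = 1"
proof -
  have half: "\<exists>u. a \<bullet>\<bullet> u = 1 \<and> b \<bullet>\<bullet> u = 0"
    if ab: "a \<noteq> 0" "b \<noteq> 0" "hyperplane a \<noteq> hyperplane b" for a b :: "'a ^ 'b"
  proof -
    obtain v where v: "b \<bullet>\<bullet> v = 0" "a \<bullet>\<bullet> v \<noteq> 0"
      using hyperplane_subset_imp_eq[of b a] ab by (auto simp: mem_hyperplane subset_iff)
    then have "a \<bullet>\<bullet> ((1 / (a \<bullet>\<bullet> v)) *s v) = 1 \<and> b \<bullet>\<bullet> ((1 / (a \<bullet>\<bullet> v)) *s v) = 0"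
      by (simp add: scalar_prod_simps)
    then show ?thesis by blast
  qed
  from half[OF assms] half[OF assms(2,1) assms(3)[symmetric]] show ?thesis by blast
qed

text \<open>Removing the transversal part of \<open>v\<close> leaves a point of the flat, and
  \<open>c\<close> vanishes there.\<close>

lemma dual_pair_expand:
  assumes uw: "a \<bullet>\<bullet> u = 1" "b \<bullet>\<bullet> u = 0" "a \<bullet>\<bullet> w = 0" "b \<bullet>\<bullet> w = 1"
    and "hyperplane a \<inter> hyperplane b \<subseteq> hyperplane c"
  shows "c = (c \<bullet>\<bullet> u) *s a + (c \<bullet>\<bullet> w) *s b"
proof (rule scalar_prod_eqI)
  fix v
  have "v - (a \<bullet>\<bullet> v) *s u - (b \<bullet>\<bullet> v) *s w \<in> hyperplane a \<inter> hyperplane b"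
    by (simp add: mem_hyperplane scalar_prod_simps uw)
  then have "v - (a \<bullet>\<bullet> v) *s u - (b \<bullet>\<bullet> v) *s w \<in> hyperplane c"
    using assms(5) by blast
  then show "c \<bullet>\<bullet> v = ((c \<bullet>\<bullet> u) *s a + (c \<bullet>\<bullet> w) *s b) \<bullet>\<bullet> v"
    by (simp add: mem_hyperplane scalar_prod_simps algebra_simps)
qed

lemma linear_form_dvd_iff:
  assumes "a \<noteq> 0" "b \<noteq> 0"
  shows "lf a dvd lf b \<longleftrightarrow> hyperplane a = hyperplane b"
proof
  assume "hyperplane a = hyperplane b"
  then obtain c where "b = c *s a" using hyperplane_subset_imp_scale assms(1) by blast
  then show "lf a dvd lf b" by (simp add: linear_form_scale)
qed (use assms linear_form_dvd_hyperplane hyperplane_subset_imp_eq in blast)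

text \<open>In \<open>c = p *s a + q *s b\<close> the coefficient \<open>q\<close> is nonzero, since
  otherwise \<open>c\<close> would define the hyperplane of \<open>a\<close>. Hence a flat inside a
  fixed hyperplane is determined by any other hyperplane through it.\<close>

lemma hyperplane_exchange:
  assumes "a \<noteq> 0" "b \<noteq> 0" "c \<noteq> 0" "hyperplane a \<noteq> hyperplane b" "hyperplane a \<noteq> hyperplane c"
    and "hyperplane a \<inter> hyperplane b \<subseteq> hyperplane c"
  shows "hyperplane a \<inter> hyperplane c = hyperplane a \<inter> hyperplane b"
proof -
  obtain u w where uw: "a \<bullet>\<bullet> u = 1" "b \<bullet>\<bullet> u = 0" "a \<bullet>\<bullet> w = 0" "b \<bullet>\<bullet> w = 1"
    using dual_pair[OF assms(1,2,4)] by blast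
  obtain p q where c: "c = p *s a + q *s b"
    using dual_pair_expand[OF uw assms(6)] by blast
  have "q \<noteq> 0"
  proof
    assume "q = 0"
    with c assms(3) have "p \<noteq> 0" "c = p *s a" by auto
    with assms(5) show False by (simp add: hyperplane_scale)
  qed
  then show ?thesis by (auto simp: mem_hyperplane c scalar_prod_simps)
qed

section \<open>A Chinese remainder theorem in codimension two\<close>

text \<open>The form is prime and does not divide \<open>p\<close>, so its factors can be moved into
  \<open>h\<close> one at a time.\<close>

lemma power_dvd_mult_cancel:
  assumes "a \<noteq> 0" "\<not> lf a dvd p" "lf a ^ j dvd p * h"
  shows "lf a ^ j dvd h"
  using assms(3)
proof (induction j arbitrary: h)
  case (Suc j)
  have la: "lf a \<noteq> 0" using assms(1) by (simp add: linear_form_eq_0_iff)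
  have "lf a dvd p * h" using Suc.prems by (metis dvd_mult_left power_Suc)
  then obtain h' where h': "h = lf a * h'"
    using assms(1,2) by (auto simp: linear_form_dvd_mult_iff)
  have "lf a * lf a ^ j dvd lf a * (p * h')"
    using Suc.prems by (simp add: h' algebra_simps)
  then have "lf a ^ j dvd p * h'" using la by (simp add: mpoly_dvd_mult_cancel)
  from Suc.IH[OF this] show ?case using la by (simp add: h' mpoly_dvd_mult_cancel)
qed simp

lemma linear_form_dvd_prod_power:
  assumes "a \<noteq> 0" "finite I" "lf a dvd (\<Prod>i\<in>I. lf (\<gamma> i) ^ n i)"
  shows "\<exists>i\<in>I. lf a dvd lf (\<gamma> i)"
  using linear_form_dvd_prod[OF assms] linear_form_dvd_power[OF assms(1)] by blast

text \<open>The forms are primes none of which divides another; the cofactor left by the earlier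
  powers therefore has to absorb the next one.\<close>

lemma prod_power_dvd:
  assumes "finite I" "\<And>i. i \<in> I \<Longrightarrow> \<gamma> i \<noteq> 0"
    and "\<And>i j. i \<in> I \<Longrightarrow> j \<in> I \<Longrightarrow> i \<noteq> j \<Longrightarrow> \<not> lf (\<gamma> i) dvd lf (\<gamma> j)"
    and "\<And>i. i \<in> I \<Longrightarrow> lf (\<gamma> i) ^ n i dvd f"
  shows "(\<Prod>i\<in>I. lf (\<gamma> i) ^ n i) dvd f"
  using assms
proof (induction I rule: finite_induct)
  case (insert i I)
  have "(\<Prod>i\<in>I. lf (\<gamma> i) ^ n i) dvd f" using insert by auto
  then obtain h where h: "f = (\<Prod>i\<in>I. lf (\<gamma> i) ^ n i) * h" by (auto simp: dvd_def)
  have i: "\<gamma> i \<noteq> 0" using insert.prems(1) by simp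
  have "\<not> lf (\<gamma> i) dvd lf (\<gamma> j)" if "j \<in> I" for j
    using insert.prems(2)[of i j] insert.hyps(2) that by auto
  then have nd: "\<not> lf (\<gamma> i) dvd (\<Prod>i\<in>I. lf (\<gamma> i) ^ n i)"
    using linear_form_dvd_prod_power[OF i insert.hyps(1), of \<gamma> n] by blast
  have "lf (\<gamma> i) ^ n i dvd f" using insert.prems(3) by simp
  then have "lf (\<gamma> i) ^ n i dvd h"
    unfolding h by (rule power_dvd_mult_cancel[OF i nd])
  then show ?case using insert.hyps by (simp add: h mult.commute mult_dvd_mono)
qed simp

text \<open>In a relation \<open>lf b * f = d * lf a + c * p\<close> primality of the ideal of
  \<open>a\<close> and \<open>b\<close> moves \<open>c\<close> into that ideal. Substituting this,
  everything but a multiple of \<open>lf a\<close> carries the factor \<open>lf b\<close>, which is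
  cancelled modulo \<open>lf a\<close>.\<close>

lemma linear_form_ideal_cancel:
  assumes ab: "a \<noteq> 0" "b \<noteq> 0" "hyperplane a \<noteq> hyperplane b"
    and p: "\<not> in_ideal2 (lf a) (lf b) p"
    and "in_ideal2 (lf a) p (lf b * f)"
  shows "in_ideal2 (lf a) p f"
proof -
  obtain d c where dc: "lf b * f = d * lf a + c * p"
    using assms(5) by (auto simp: in_ideal2_def)
  have "b \<noteq> z *s a" for z
    using ab hyperplane_scale[of z a] by auto
  moreover have "in_ideal2 (lf a) (lf b) (c * p)"
    unfolding in_ideal2_def by (rule exI[of _ "- d"], rule exI[of _ f]) (use dc in \<open>simp add: algebra_simps\<close>)
  ultimately have "in_ideal2 (lf a) (lf b) c"
    using linear_forms_ideal_prime[OF ab(1)] p by blast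
  then obtain c1 c2 where c: "c = c1 * lf a + c2 * lf b"
    by (auto simp: in_ideal2_def)
  have "lf b * (f - c2 * p) = (d + c1 * p) * lf a"
    using dc by (simp add: c algebra_simps)
  then have "lf a dvd lf b * (f - c2 * p)" by simp
  then have "lf a dvd f - c2 * p"
    using ab by (simp add: linear_form_dvd_mult_iff linear_form_dvd_iff)
  then obtain e where "f - c2 * p = lf a * e" by (auto simp: dvd_def)
  then have "f = e * lf a + c2 * p" by (simp add: algebra_simps)
  then show ?thesis unfolding in_ideal2_def by blast
qed

lemma in_ideal2_prod_power:
  assumes ab: "a \<noteq> 0" "b \<noteq> 0" "hyperplane a \<noteq> hyperplane b" and "finite J"
    and "in_ideal2 (lf a) (lf b) (\<Prod>j\<in>J. lf (\<gamma> j) ^ n j)"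
  shows "\<exists>j\<in>J. in_ideal2 (lf a) (lf b) (lf (\<gamma> j))"
proof -
  let ?I = "in_ideal2 (lf a) (lf b)"
  have "b \<noteq> z *s a" for z
    using ab hyperplane_scale[of z a] by auto
  then have prime: "?I (f * g) \<Longrightarrow> ?I f \<or> ?I g" for f g
    using linear_forms_ideal_prime[OF ab(1)] by blast
  have one: "\<not> ?I 1"
  proof
    assume "?I 1"
    then obtain r s where "1 = r * lf a + s * lf b" by (auto simp: in_ideal2_def)
    \<comment> \<open>Both linear forms vanish at the origin, the constant one does not.\<close>
    from arg_cong[where f = "insertion (\<lambda>x. x) (($) 0)", OF this] show False
      by (simp add: insertion_add insertion_mult insertion_1 coeff_hom_id insertion_linear_form_point
          scalar_prod_simps)
  qed
  have pw: "?I (f ^ k) \<Longrightarrow> ?I f" for f k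
    by (induction k) (use one prime in auto)
  from assms(4,5) show ?thesis
    by (induction J rule: finite_induct) (use one pw prime in auto)
qed

lemma prod_ideal_cancel:
  assumes a: "a \<noteq> 0" and "finite I"
    and "\<And>i. i \<in> I \<Longrightarrow> \<beta> i \<noteq> 0 \<and> hyperplane a \<noteq> hyperplane (\<beta> i) \<and>
           \<not> in_ideal2 (lf a) (lf (\<beta> i)) p"
    and "in_ideal2 (lf a) p ((\<Prod>i\<in>I. lf (\<beta> i) ^ n i) * f)"
  shows "in_ideal2 (lf a) p f"
  using assms(2-)
proof (induction I arbitrary: f rule: finite_induct)
  case (insert i I)
  have "in_ideal2 (lf a) p ((\<Prod>i\<in>I. lf (\<beta> i) ^ n i) * (lf (\<beta> i) ^ n i * f))"
    using insert by (simp add: algebra_simps)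
  with insert have "in_ideal2 (lf a) p (lf (\<beta> i) ^ n i * f)" by auto
  moreover have "in_ideal2 (lf a) p (lf (\<beta> i) ^ j * f) \<Longrightarrow> in_ideal2 (lf a) p f" for j
  proof (induction j)
    case (Suc j)
    then show ?case
      using linear_form_ideal_cancel[OF a, of "\<beta> i" p "lf (\<beta> i) ^ j * f"] insert.prems(1)[of i]
      by (simp add: algebra_simps)
  qed simp
  ultimately show ?case by blast
qed simp

text \<open>Passage from \<open>lf a\<close> to its powers. Writing
  \<open>f = d * lf a + c * p\<close> and using that \<open>lf a\<close> does not divide
  \<open>p\<close>, one factor \<open>lf a\<close> cancels from the whole relation; what remains is
  the claim for \<open>d\<close> with exponent \<open>k\<close>.\<close>

lemma prod_ideal_power_cancel:
  assumes a: "a \<noteq> 0" and p: "\<not> lf a dvd p"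
    and q: "\<And>f. in_ideal2 (lf a) p (q * f) \<Longrightarrow> in_ideal2 (lf a) p f"
    and "in_ideal2 (lf a ^ k) p (q * f)"
  shows "in_ideal2 (lf a ^ k) p f"
  using assms(4)
proof (induction k arbitrary: f)
  case 0
  show ?case unfolding in_ideal2_def by (rule exI[of _ f], rule exI[of _ 0]) simp
next
  case (Suc k)
  let ?a = "lf a"
  have a0: "?a \<noteq> 0" using a by (simp add: linear_form_eq_0_iff)
  obtain r s where rs: "q * f = r * ?a ^ Suc k + s * p" using Suc.prems by (auto simp: in_ideal2_def)
  have "in_ideal2 ?a p (q * f)" unfolding in_ideal2_def
    by (rule exI[of _ "r * ?a ^ k"], rule exI[of _ s]) (use rs in \<open>simp add: algebra_simps\<close>)
  from q[OF this] obtain d c where f: "f = d * ?a + c * p" by (auto simp: in_ideal2_def)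
  have "p * (s - c * q) = ?a * (d * q - r * ?a ^ k)"
    using rs by (simp add: f algebra_simps)
  then have "?a dvd p * (s - c * q)" by simp
  then obtain e where e: "s - c * q = ?a * e"
    using a p by (auto simp: linear_form_dvd_mult_iff)
  have "?a * (q * d) = ?a * (r * ?a ^ k + e * p)"
  proof -
    have "?a * (q * d) = r * ?a ^ Suc k + (s - c * q) * p"
      using rs by (simp add: f algebra_simps)
    then show ?thesis by (simp add: e algebra_simps)
  qed
  then have "q * d = r * ?a ^ k + e * p" using a0 by (simp add: mpoly_mult_left_cancel)
  then have "in_ideal2 (?a ^ k) p (q * d)" unfolding in_ideal2_def by blast
  from Suc.IH[OF this] obtain r' s' where d: "d = r' * ?a ^ k + s' * p" by (auto simp: in_ideal2_def)
  show ?case unfolding in_ideal2_def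
    by (rule exI[of _ r'], rule exI[of _ "s' * ?a + c"]) (simp add: f d algebra_simps)
qed

text \<open>If \<open>q\<close> is cancellable modulo (x, p), then (x, p) and (x, q) intersect in
  (x, q p): the difference of the two representations of \<open>u\<close> puts \<open>q * s'\<close>
  into (x, p), and cancelling \<open>q\<close> puts \<open>s'\<close> there.\<close>

lemma in_ideal2_mult:
  assumes "in_ideal2 x p u" "in_ideal2 x q u" "\<And>f. in_ideal2 x p (q * f) \<Longrightarrow> in_ideal2 x p f"
  shows "in_ideal2 x (q * p) u"
proof -
  obtain r s r' s' where u: "u = r * x + s * p" "u = r' * x + s' * q"
    using assms(1,2) unfolding in_ideal2_def by blast
  have "in_ideal2 x p (q * s')"
    unfolding in_ideal2_def by (rule exI[of _ "r - r'"], rule exI[of _ s]) (use u in \<open>simp add: algebra_simps\<close>)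
  from assms(3)[OF this] obtain r'' s'' where "s' = r'' * x + s'' * p" by (auto simp: in_ideal2_def)
  then have "u = (r' + r'' * q) * x + s'' * (q * p)" using u(2) by (simp add: algebra_simps)
  then show ?thesis unfolding in_ideal2_def by blast
qed

text \<open>The hyperplanes are grouped by their trace on the hyperplane of \<open>a\<close>, that
  is by codimension two flats. The product belonging to one flat is cancellable modulo a power of
  \<open>lf a\<close> and the product belonging to the others, so the ideals can be intersected one
  flat after the other.\<close>

lemma in_ideal2_prod_union:
  fixes \<alpha> :: "'h \<Rightarrow> 'k::field ^ 'n::finite"
  assumes a: "a \<noteq> 0" and "finite A"
    and nz: "\<And>H. H \<in> A \<Longrightarrow> \<alpha> H \<noteq> 0 \<and> hyperplane a \<noteq> hyperplane (\<alpha> H)"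
    and "finite Xs"
    and "\<And>X. X \<in> Xs \<Longrightarrow> in_ideal2 (lf a ^ k)
           (\<Prod>H\<in>{H\<in>A. hyperplane a \<inter> hyperplane (\<alpha> H) = X}. lf (\<alpha> H) ^ n H) u"
  shows "in_ideal2 (lf a ^ k)
           (\<Prod>H\<in>{H\<in>A. hyperplane a \<inter> hyperplane (\<alpha> H) \<in> Xs}. lf (\<alpha> H) ^ n H) u"
  using assms(4,5)
proof (induction Xs rule: finite_induct)
  case empty
  show ?case unfolding in_ideal2_def by (rule exI[of _ 0], rule exI[of _ u]) simp
next
  case (insert X Xs)
  let ?B = "{H\<in>A. hyperplane a \<inter> hyperplane (\<alpha> H) = X}"
  let ?C = "{H\<in>A. hyperplane a \<inter> hyperplane (\<alpha> H) \<in> Xs}"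
  let ?P = "\<lambda>B. \<Prod>H\<in>B. lf (\<alpha> H) ^ n H"
  have fin: "finite ?B" "finite ?C" using assms(2) by auto
  \<comment> \<open>By primality some factor of the other product would lie in the ideal of
    \<open>a\<close> and \<open>\<alpha> H\<close>; its hyperplane would then have the trace
    \<open>X\<close>, which is not in \<open>Xs\<close>.\<close>
  have sep: "\<not> in_ideal2 (lf a) (lf (\<alpha> H)) (?P ?C)" if "H \<in> ?B" for H
  proof
    assume *: "in_ideal2 (lf a) (lf (\<alpha> H)) (?P ?C)"
    have H: "\<alpha> H \<noteq> 0" "hyperplane a \<noteq> hyperplane (\<alpha> H)" using nz that by auto
    obtain K where K: "K \<in> ?C" "in_ideal2 (lf a) (lf (\<alpha> H)) (lf (\<alpha> K))"
      using in_ideal2_prod_power[OF a H fin(2) *] by blast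
    have "hyperplane a \<inter> hyperplane (\<alpha> K) = hyperplane a \<inter> hyperplane (\<alpha> H)"
      using hyperplane_exchange[OF a H(1) _ H(2) _ linear_form_in_ideal2_hyperplane[OF K(2)]] K(1) nz
      by auto
    with K(1) that insert.hyps(2) show False by auto
  qed
  have nd: "\<not> lf a dvd ?P ?C"
  proof
    assume "lf a dvd ?P ?C"
    then obtain H where "H \<in> ?C" "lf a dvd lf (\<alpha> H)"
      using linear_form_dvd_prod_power[OF a fin(2)] by blast
    then show False using nz[of H] linear_form_dvd_iff[OF a, of "\<alpha> H"] by auto
  qed
  have cancel: "in_ideal2 (lf a) (?P ?C) (?P ?B * f) \<Longrightarrow> in_ideal2 (lf a) (?P ?C) f" for f
    by (rule prod_ideal_cancel[OF a fin(1)]) (use nz sep in auto)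
  have "in_ideal2 (lf a ^ k) (?P ?B * ?P ?C) u"
    by (rule in_ideal2_mult) (use insert prod_ideal_power_cancel[OF a nd cancel] in auto)
  also have "?P ?B * ?P ?C = ?P (?B \<union> ?C)"
    using fin insert.hyps by (subst prod.union_disjoint) auto
  also have "?B \<union> ?C = {H\<in>A. hyperplane a \<inter> hyperplane (\<alpha> H) \<in> insert X Xs}" by auto
  finally show ?case .
qed

text \<open>Induction on the number of hyperplanes. A solution \<open>f\<close> for \<open>A\<close>
  may be changed by multiples of the product over \<open>A\<close>; this reaches the congruence at
  the new \<open>K\<close> once \<open>g K - f\<close> lies in the ideal of the power at
  \<open>K\<close> and that product, and the local solutions prove this membership for each
  flat.\<close>

theorem codim2_chinese_remainder:
  fixes \<alpha> :: "'h \<Rightarrow> 'k::field ^ 'n::finite"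
  assumes "finite A"
    and "\<And>H. H \<in> A \<Longrightarrow> \<alpha> H \<noteq> 0"
    and "inj_on (\<lambda>H. hyperplane (\<alpha> H)) A"
    and "\<And>H K. H \<in> A \<Longrightarrow> K \<in> A \<Longrightarrow> H \<noteq> K \<Longrightarrow>
      \<exists>f. \<forall>L\<in>A. hyperplane (\<alpha> H) \<inter> hyperplane (\<alpha> K) \<subseteq> hyperplane (\<alpha> L) \<longrightarrow>
        lf (\<alpha> L) ^ n L dvd f - g L"
  shows "\<exists>f. \<forall>L\<in>A. lf (\<alpha> L) ^ n L dvd f - g L"
  using assms
proof (induction A rule: finite_induct)
  case (insert K A)
  have "\<exists>f. \<forall>L\<in>A. lf (\<alpha> L) ^ n L dvd f - g L"
  proof (rule insert.IH)
    fix H L assume "H \<in> A" "L \<in> A" "H \<noteq> L"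
    with insert.prems(3)[of H L]
    show "\<exists>f. \<forall>M\<in>A. hyperplane (\<alpha> H) \<inter> hyperplane (\<alpha> L) \<subseteq> hyperplane (\<alpha> M) \<longrightarrow>
        lf (\<alpha> M) ^ n M dvd f - g M" by auto
  qed (use insert.prems in auto)
  then obtain f where f: "\<And>L. L \<in> A \<Longrightarrow> lf (\<alpha> L) ^ n L dvd f - g L" by blast
  let ?P = "\<lambda>B. \<Prod>H\<in>B. lf (\<alpha> H) ^ n H"
  have K: "\<alpha> K \<noteq> 0" using insert.prems by simp
  have nz: "\<alpha> H \<noteq> 0 \<and> hyperplane (\<alpha> K) \<noteq> hyperplane (\<alpha> H)" if "H \<in> A" for H
    using insert.prems(1,2) insert.hyps(2) that by (auto simp: inj_on_def)
  let ?Xs = "(\<lambda>H. hyperplane (\<alpha> K) \<inter> hyperplane (\<alpha> H)) ` A"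
  have "in_ideal2 (lf (\<alpha> K) ^ n K)
      (?P {H\<in>A. hyperplane (\<alpha> K) \<inter> hyperplane (\<alpha> H) \<in> ?Xs}) (g K - f)"
  proof (rule in_ideal2_prod_union[OF K insert.hyps(1) nz])
    fix X assume "X \<in> ?Xs"
    then obtain H where H: "H \<in> A" and X: "X = hyperplane (\<alpha> K) \<inter> hyperplane (\<alpha> H)" by blast
    have "K \<noteq> H" using H insert.hyps(2) by blast
    then obtain fX where fX: "\<And>L. L \<in> insert K A \<Longrightarrow> X \<subseteq> hyperplane (\<alpha> L) \<Longrightarrow>
        lf (\<alpha> L) ^ n L dvd fX - g L"
      using insert.prems(3)[of K H] H X by auto
    let ?B = "{H\<in>A. hyperplane (\<alpha> K) \<inter> hyperplane (\<alpha> H) = X}"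
    \<comment> \<open>Both polynomials solve the congruences at the hyperplanes that meet
      \<open>K\<close> in \<open>X\<close>.\<close>
    have "?P ?B dvd fX - f"
    proof (rule prod_power_dvd)
      fix L assume L: "L \<in> ?B"
      then have "lf (\<alpha> L) ^ n L dvd fX - g L" using fX by auto
      moreover have "lf (\<alpha> L) ^ n L dvd g L - f"
        using f[of L] L dvd_minus_iff[of _ "f - g L"] by simp
      ultimately show "lf (\<alpha> L) ^ n L dvd fX - f" by (rule dvd_diff_trans)
    next
      fix H L assume "H \<in> ?B" "L \<in> ?B" "H \<noteq> L"
      then show "\<not> lf (\<alpha> H) dvd lf (\<alpha> L)"
        using insert.prems(2) nz[of H] nz[of L] by (auto simp: linear_form_dvd_iff inj_on_def)
    qed (use insert.hyps nz in auto)
    moreover have "lf (\<alpha> K) ^ n K dvd fX - g K" using fX X by auto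
    ultimately obtain r s where rs: "fX - f = ?P ?B * r" "fX - g K = lf (\<alpha> K) ^ n K * s"
      by (auto simp: dvd_def)
    have "g K - f = (fX - f) - (fX - g K)" by simp
    also have "\<dots> = (- s) * lf (\<alpha> K) ^ n K + r * ?P ?B"
      by (simp only: rs) (simp add: algebra_simps)
    finally show "in_ideal2 (lf (\<alpha> K) ^ n K) (?P ?B) (g K - f)"
      unfolding in_ideal2_def by blast
  qed (use insert.hyps in auto)
  moreover have "{H\<in>A. hyperplane (\<alpha> K) \<inter> hyperplane (\<alpha> H) \<in> ?Xs} = A" by auto
  ultimately obtain r s where rs: "g K - f = r * lf (\<alpha> K) ^ n K + s * ?P A"
    by (auto simp: in_ideal2_def)
  have "lf (\<alpha> L) ^ n L dvd f + s * ?P A - g L" if L: "L \<in> insert K A" for L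
  proof (cases "L = K")
    case True
    have "f + s * ?P A - g K = lf (\<alpha> K) ^ n K * (- r)"
      using rs by (simp add: algebra_simps)
    then show ?thesis unfolding True by simp
  next
    case False
    with L have L: "L \<in> A" by simp
    then have "lf (\<alpha> L) ^ n L dvd ?P A"
      using insert.hyps(1) by (intro dvd_prodI)
    then have "lf (\<alpha> L) ^ n L dvd (f - g L) + s * ?P A"
      using f[OF L] by (intro dvd_add dvd_mult)
    then show ?thesis by (simp add: algebra_simps)
  qed
  then show ?case by blast
qed simp

section \<open>Arrangements of rank two\<close>

text \<open>A derivation enters only through its values at the forms of \<open>H1\<close> and
  \<open>H2\<close>; the dual vectors \<open>u\<close> and \<open>w\<close> yield the coefficients
  of all other forms in terms of these two.\<close>

locale rank2 =
  fixes \<gamma> :: "'h \<Rightarrow> 'k::field ^ 'n::finite" and I :: "'h set" and H1 H2 :: 'h and u w :: "'k ^ 'n"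
  assumes fin: "finite I" and H1: "H1 \<in> I" and H2: "H2 \<in> I"
    and nz: "\<And>H. H \<in> I \<Longrightarrow> \<gamma> H \<noteq> 0"
    and inj: "inj_on (\<lambda>H. hyperplane (\<gamma> H)) I"
    and dual: "\<gamma> H1 \<bullet>\<bullet> u = 1" "\<gamma> H2 \<bullet>\<bullet> u = 0" "\<gamma> H1 \<bullet>\<bullet> w = 0" "\<gamma> H2 \<bullet>\<bullet> w = 1"
    and sub: "\<And>H. H \<in> I \<Longrightarrow> hyperplane (\<gamma> H1) \<inter> hyperplane (\<gamma> H2) \<subseteq> hyperplane (\<gamma> H)"
begin

abbreviation x :: "('n, 'k) mpoly" where "x \<equiv> lf (\<gamma> H1)"
abbreviation y :: "('n, 'k) mpoly" where "y \<equiv> lf (\<gamma> H2)"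
abbreviation form :: "'h \<Rightarrow> ('n, 'k) mpoly" where "form H \<equiv> lf (\<gamma> H)"

definition ev :: "'h \<Rightarrow> ('n, 'k) mpoly \<Rightarrow> ('n, 'k) mpoly \<Rightarrow> ('n, 'k) mpoly" where
  "ev H P Q = Const (\<gamma> H \<bullet>\<bullet> u) * P + Const (\<gamma> H \<bullet>\<bullet> w) * Q"

text \<open>The derivation taking the values \<open>P\<close> and \<open>Q\<close> at \<open>x\<close> and \<open>y\<close> is logarithmic.\<close>

definition mem :: "('h \<Rightarrow> nat) \<Rightarrow> ('n, 'k) mpoly \<Rightarrow> ('n, 'k) mpoly \<Rightarrow> bool" where
  "mem m P Q \<longleftrightarrow> (\<forall>H\<in>I. form H ^ m H dvd ev H P Q)"

lemma ev_simps:
  "ev H (P + P') (Q + Q') = ev H P Q + ev H P' Q'"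
  "ev H (P - P') (Q - Q') = ev H P Q - ev H P' Q'"
  "ev H (f * P) (f * Q) = f * ev H P Q"
  by (simp_all add: ev_def algebra_simps)

lemma expand: "H \<in> I \<Longrightarrow> \<gamma> H = (\<gamma> H \<bullet>\<bullet> u) *s \<gamma> H1 + (\<gamma> H \<bullet>\<bullet> w) *s \<gamma> H2"
  using dual_pair_expand[OF dual sub] .

lemma form_eq: "H \<in> I \<Longrightarrow> form H = ev H x y"
  using arg_cong[where f = lf, OF expand]
  by (simp add: linear_form_add linear_form_scale ev_def)

lemma H12: "H1 \<noteq> H2"
  using dual by auto

lemma form_nz: "H \<in> I \<Longrightarrow> form H \<noteq> 0"
  using nz by (simp add: linear_form_eq_0_iff)

lemma form_dvd_iff: "H \<in> I \<Longrightarrow> K \<in> I \<Longrightarrow> form H dvd form K \<longleftrightarrow> H = K"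
  using nz inj by (auto simp: linear_form_dvd_iff inj_on_def)

lemma mem_diff: "mem m P Q \<Longrightarrow> mem m P' Q' \<Longrightarrow> mem m (P - P') (Q - Q')"
  and mem_scale: "mem m P Q \<Longrightarrow> mem m (f * P) (f * Q)"
  by (simp_all add: mem_def ev_simps)

definition qpoly :: "('h \<Rightarrow> nat) \<Rightarrow> ('n, 'k) mpoly" where
  "qpoly m = (\<Prod>H\<in>I. form H ^ m H)"

lemma qpoly_nz: "qpoly m \<noteq> 0"
  using fin form_nz by (simp add: qpoly_def mpoly_prod_eq_0_iff mpoly_power_eq_0_iff)

lemma homogeneous_qpoly: "homogeneous_poly (\<Sum>H\<in>I. m H) (qpoly m)"
  unfolding qpoly_def using homogeneous_power[OF homogeneous_linear_form]
  by (intro homogeneous_prod) simp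

lemma qpoly_dvd:
  assumes "\<And>H. H \<in> I \<Longrightarrow> form H ^ m H dvd f" shows "qpoly m dvd f"
  unfolding qpoly_def using fin nz assms form_dvd_iff by (intro prod_power_dvd) auto

text \<open>Multiplied by a coefficient of \<open>\<gamma> H\<close>, the determinant becomes a
  combination of the values of the two derivations at the form of \<open>H\<close>, and one of the
  two coefficients is nonzero.\<close>

lemma qpoly_dvd_det:
  assumes "mem m P Q" "mem m P' Q'" shows "qpoly m dvd P * Q' - P' * Q"
proof (rule qpoly_dvd)
  fix H assume H: "H \<in> I"
  let ?p = "Const (\<gamma> H \<bullet>\<bullet> u) :: ('n, 'k) mpoly" and ?q = "Const (\<gamma> H \<bullet>\<bullet> w) :: ('n, 'k) mpoly"
  have dv: "form H ^ m H dvd ev H P Q" "form H ^ m H dvd ev H P' Q'"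
    using assms H by (auto simp: mem_def)
  have "?p * (P * Q' - P' * Q) = Q' * ev H P Q - Q * ev H P' Q'"
    "?q * (P * Q' - P' * Q) = P * ev H P' Q' - P' * ev H P Q"
    by (simp_all add: ev_def algebra_simps)
  then have *: "form H ^ m H dvd ?p * (P * Q' - P' * Q)" "form H ^ m H dvd ?q * (P * Q' - P' * Q)"
    using dv by (simp_all add: dvd_mult)
  have cancel: "z dvd f" if "c \<noteq> 0" "z dvd Const c * f" for c :: 'k and z f :: "('n, 'k) mpoly"
  proof -
    have "z dvd Const (1 / c) * (Const c * f)" using that(2) by (rule dvd_mult)
    also have "\<dots> = f" using that(1) by (simp flip: mult.assoc Const_mult)
    finally show ?thesis .
  qed
  have "\<gamma> H \<bullet>\<bullet> u \<noteq> 0 \<or> \<gamma> H \<bullet>\<bullet> w \<noteq> 0"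
    using expand[OF H] nz[OF H] by (metis add.right_neutral vec.scale_zero_left)
  then show "form H ^ m H dvd P * Q' - P' * Q" using * cancel by blast
qed

text \<open>Cramer's rule. The numerators are determinants of pairs of logarithmic derivations,
  hence divisible by \<open>qpoly m\<close>, which up to a constant is the denominator.\<close>

lemma saito_criterion:
  assumes "mem m P1 Q1" "mem m P2 Q2" "c \<noteq> 0" "P1 * Q2 - P2 * Q1 = Const c * qpoly m"
    and "mem m P Q"
  shows "\<exists>f g. P = f * P1 + g * P2 \<and> Q = f * Q1 + g * Q2"
proof -
  obtain f g where f: "P * Q2 - P2 * Q = qpoly m * f" and g: "P1 * Q - P * Q1 = qpoly m * g"
    using qpoly_dvd_det[OF assms(5,2)] qpoly_dvd_det[OF assms(1,5)] by (auto simp: dvd_def)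
  let ?D = "Const c * qpoly m"
  have D: "?D \<noteq> 0" using assms(3) qpoly_nz by (simp add: mpoly_mult_eq_0_iff)
  have cc: "Const c * Const (1 / c) = (1 :: ('n, 'k) mpoly)"
    using assms(3) by (simp flip: Const_mult)
  have "qpoly m * (f * P1 + g * P2) = (P * Q2 - P2 * Q) * P1 + (P1 * Q - P * Q1) * P2"
    by (simp add: f g algebra_simps)
  also have "\<dots> = (P1 * Q2 - P2 * Q1) * P" by (simp add: algebra_simps)
  finally have "qpoly m * (f * P1 + g * P2) = qpoly m * (Const c * P)"
    by (simp add: assms(4) algebra_simps)
  then have "f * P1 + g * P2 = Const c * P" using qpoly_nz by (simp add: mpoly_mult_left_cancel)
  then have P: "P = Const (1 / c) * (f * P1 + g * P2)"
    using cc by (simp add: mult.left_commute flip: mult.assoc)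
  have "qpoly m * (f * Q1 + g * Q2) = (P * Q2 - P2 * Q) * Q1 + (P1 * Q - P * Q1) * Q2"
    by (simp add: f g algebra_simps)
  also have "\<dots> = (P1 * Q2 - P2 * Q1) * Q" by (simp add: algebra_simps)
  finally have "qpoly m * (f * Q1 + g * Q2) = qpoly m * (Const c * Q)"
    by (simp add: assms(4) algebra_simps)
  then have "f * Q1 + g * Q2 = Const c * Q" using qpoly_nz by (simp add: mpoly_mult_left_cancel)
  then have Q: "Q = Const (1 / c) * (f * Q1 + g * Q2)"
    using cc by (simp add: mult.left_commute flip: mult.assoc)
  show ?thesis
    by (rule exI[of _ "Const (1 / c) * f"], rule exI[of _ "Const (1 / c) * g"])
       (use P Q in \<open>simp add: algebra_simps\<close>)
qed

subsection \<open>Existence of homogeneous bases\<close>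

text \<open>Binary forms in \<open>x\<close> and \<open>y\<close>.\<close>

primrec bform :: "nat \<Rightarrow> ('n, 'k) mpoly \<Rightarrow> bool" where
  "bform 0 f \<longleftrightarrow> (\<exists>c. f = Const c)"
| "bform (Suc j) f \<longleftrightarrow> (\<exists>g h. bform j g \<and> bform j h \<and> f = x * g + y * h)"

lemma bform_SucI: "bform j g \<Longrightarrow> bform j h \<Longrightarrow> f = x * g + y * h \<Longrightarrow> bform (Suc j) f"
  by auto

lemma bform_SucE:
  assumes "bform (Suc j) f"
  obtains g h where "bform j g" "bform j h" "f = x * g + y * h"
  using assms by auto

declare bform.simps(2) [simp del]

lemma bform_0 [simp]: "bform j 0"
proof (induction j)
  case 0 show ?case by (auto intro: exI[of _ 0])
next
  case (Suc j) then show ?case by (rule bform_SucI[OF _ Suc]) simp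
qed

lemma bform_add: "bform j f \<Longrightarrow> bform j g \<Longrightarrow> bform j (f + g)"
proof (induction j arbitrary: f g)
  case 0 then show ?case by (auto simp flip: Const_add)
next
  case (Suc j)
  obtain f1 f2 where f: "bform j f1" "bform j f2" "f = x * f1 + y * f2"
    using Suc.prems(1) by (rule bform_SucE)
  obtain g1 g2 where g: "bform j g1" "bform j g2" "g = x * g1 + y * g2"
    using Suc.prems(2) by (rule bform_SucE)
  show ?case
    by (rule bform_SucI[OF Suc.IH[OF f(1) g(1)] Suc.IH[OF f(2) g(2)]]) (simp add: f g algebra_simps)
qed

lemma bform_Const: "bform j f \<Longrightarrow> bform j (Const c * f)"
proof (induction j arbitrary: f)
  case 0 then show ?case by (auto simp flip: Const_mult)
next
  case (Suc j)
  obtain f1 f2 where f: "bform j f1" "bform j f2" "f = x * f1 + y * f2"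
    using Suc.prems by (rule bform_SucE)
  show ?case
    by (rule bform_SucI[OF Suc.IH[OF f(1)] Suc.IH[OF f(2)]]) (simp add: f algebra_simps)
qed

lemma bform_diff: "bform j f \<Longrightarrow> bform j g \<Longrightarrow> bform j (f - g)"
  using bform_add[of j f "Const (- 1) * g"] bform_Const[of j g "- 1"] by (simp add: Const_uminus)

lemma bform_mult: "bform i f \<Longrightarrow> bform j g \<Longrightarrow> bform (i + j) (f * g)"
proof (induction i arbitrary: f)
  case 0 then show ?case by (auto intro: bform_Const)
next
  case (Suc i)
  obtain f1 f2 where f: "bform i f1" "bform i f2" "f = x * f1 + y * f2"
    using Suc.prems(1) by (rule bform_SucE)
  have "bform (Suc (i + j)) (f * g)"
    by (rule bform_SucI[OF Suc.IH[OF f(1) Suc.prems(2)] Suc.IH[OF f(2) Suc.prems(2)]])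
       (simp add: f algebra_simps)
  then show ?case by simp
qed

lemma bform_1: "bform 0 1"
  using Const_1 by (metis bform.simps(1))

lemma bform_lin: "bform 1 (Const p * x + Const q * y)"
  unfolding One_nat_def
  by (rule bform_SucI[of 0 "Const p" "Const q"]) (auto simp: mult.commute)

lemma bform_power: "bform 1 f \<Longrightarrow> bform j (f ^ j)"
proof (induction j)
  case (Suc j) then show ?case using bform_mult[of 1 f j "f ^ j"] by simp
qed (simp only: power_0 bform_1)

lemma bform_homogeneous: "bform j f \<Longrightarrow> homogeneous_poly j f"
proof (induction j arbitrary: f)
  case 0 then show ?case by (auto intro: homogeneous_Const)
next
  case (Suc j)
  obtain f1 f2 where f: "bform j f1" "bform j f2" "f = x * f1 + y * f2"
    using Suc.prems by (rule bform_SucE)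
  have "homogeneous_poly (1 + j) f" unfolding f(3)
    using Suc.IH f(1,2) by (intro homogeneous_add homogeneous_mult homogeneous_linear_form)
  then show ?case by simp
qed

text \<open>The second coordinate \<open>t\<close> is \<open>x\<close> or \<open>y\<close>: the form
  \<open>x\<close> if \<open>H\<close> is the hyperplane of \<open>y\<close>, and \<open>y\<close>
  in all other cases.\<close>

lemma complement:
  assumes "H \<in> I"
  shows "\<exists>t r s r' s'. bform 1 t \<and> x = Const r * form H + Const s * t \<and>
    y = Const r' * form H + Const s' * t \<and> \<not> form H dvd t"
proof -
  let ?p = "\<gamma> H \<bullet>\<bullet> u" and ?q = "\<gamma> H \<bullet>\<bullet> w"
  have f: "form H = Const ?p * x + Const ?q * y" using form_eq[OF assms] by (simp add: ev_def)
  show ?thesis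
  proof (cases "?p = 0")
    case True
    then have q: "?q \<noteq> 0" using f form_nz[OF assms] by auto
    have "H \<noteq> H1" using True dual by auto
    then have "\<not> form H dvd x" using form_dvd_iff[OF assms H1] by simp
    moreover have "y = Const (1 / ?q) * form H + Const 0 * x"
      using q by (simp add: f True flip: mult.assoc Const_mult)
    moreover have "bform 1 x" using bform_lin[of 1 0] by simp
    moreover have "x = Const 0 * form H + Const 1 * x" by simp
    ultimately show ?thesis by blast
  next
    case False
    have "H \<noteq> H2" using False dual by auto
    then have "\<not> form H dvd y" using form_dvd_iff[OF assms H2] by simp
    moreover have "x = Const (1 / ?p) * form H + Const (- ?q / ?p) * y"
      using False by (simp add: f distrib_left Const_uminus flip: mult.assoc Const_mult)
    moreover have "bform 1 y" using bform_lin[of 0 1] by simp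
    moreover have "y = Const 0 * form H + Const 1 * y" by simp
    ultimately show ?thesis by blast
  qed
qed

text \<open>In the coordinates \<open>form H\<close> and \<open>t\<close> only the pure power of
  \<open>t\<close> is free of the factor \<open>form H\<close>. The case distinction encodes a
  cofactor of degree \<open>j - 1\<close>: a constant has none.\<close>

lemma bform_reduce:
  assumes "bform 1 t" "x = Const r * form H + Const s * t" "y = Const r' * form H + Const s' * t"
    and H: "H \<in> I" and "bform j f"
  shows "\<exists>c g. f = Const c * t ^ j + form H * g \<and> (case j of 0 \<Rightarrow> g = 0 | Suc i \<Rightarrow> bform i g)"
  using assms(5)
proof (induction j arbitrary: f)
  case 0 then show ?case by (auto intro: exI[of _ 0])
next
  case (Suc j)
  obtain f1 f2 where f: "bform j f1" "bform j f2" "f = x * f1 + y * f2"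
    using Suc.prems by (rule bform_SucE)
  obtain c1 g1 where 1: "f1 = Const c1 * t ^ j + form H * g1" "case j of 0 \<Rightarrow> g1 = 0 | Suc i \<Rightarrow> bform i g1"
    using Suc.IH[OF f(1)] by blast
  obtain c2 g2 where 2: "f2 = Const c2 * t ^ j + form H * g2" "case j of 0 \<Rightarrow> g2 = 0 | Suc i \<Rightarrow> bform i g2"
    using Suc.IH[OF f(2)] by blast
  have b: "bform j (form H * g)" if "case j of 0 \<Rightarrow> g = 0 | Suc i \<Rightarrow> bform i g" for g
  proof (cases j)
    case (Suc i)
    then show ?thesis using that bform_mult[of 1 "form H" i g] bform_lin form_eq[OF H] by (simp add: ev_def)
  qed (use that in simp)
  have b': "bform j (t * g)" if "case j of 0 \<Rightarrow> g = 0 | Suc i \<Rightarrow> bform i g" for g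
    using that assms(1) bform_mult[of 1 t] by (cases j) auto
  let ?g = "Const r * f1 + Const r' * f2 + Const s * (t * g1) + Const s' * (t * g2)"
  have "f = (Const r * form H + Const s * t) * f1 + (Const r' * form H + Const s' * t) * f2"
    using f(3) assms(2,3) by simp
  also have "\<dots> = form H * (Const r * f1 + Const r' * f2) + Const s * t * f1 + Const s' * t * f2"
    by (simp add: algebra_simps)
  also have "\<dots> = Const (s * c1 + s' * c2) * t ^ Suc j + form H * ?g"
    by (subst (2) 1(1), subst (2) 2(1)) (simp add: Const_add Const_mult algebra_simps)
  finally have "f = Const (s * c1 + s' * c2) * t ^ Suc j + form H * ?g" .
  moreover have "bform j ?g" using f(1,2) b'[OF 1(2)] b'[OF 2(2)] by (intro bform_add bform_Const)
  ultimately show ?case by auto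
qed

text \<open>The coefficient of the pure power of \<open>t\<close> has to vanish, because the prime
  \<open>form H\<close> divides neither \<open>t\<close> nor a nonzero constant. So dividing by the
  form stays within binary forms.\<close>

lemma bform_dvd:
  assumes H: "H \<in> I" and "bform j f" "form H dvd f"
  shows "\<exists>g. f = form H * g \<and> (case j of 0 \<Rightarrow> g = 0 | Suc i \<Rightarrow> bform i g)"
proof -
  obtain t r s r' s' where t: "bform 1 t" "x = Const r * form H + Const s * t"
    "y = Const r' * form H + Const s' * t" "\<not> form H dvd t"
    using complement[OF H] by blast
  obtain c g where f: "f = Const c * t ^ j + form H * g" and g: "case j of 0 \<Rightarrow> g = 0 | Suc i \<Rightarrow> bform i g"
    using bform_reduce[OF t(1-3) H assms(2)] by blast
  have "form H dvd Const c * t ^ j"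
    using assms(3) unfolding f by (metis dvd_add_left_iff dvd_triv_left)
  moreover have "\<not> form H dvd t ^ j" using t(4) linear_form_dvd_power[OF nz[OF H]] by blast
  ultimately have "form H dvd Const c" using linear_form_dvd_mult_iff[OF nz[OF H]] by blast
  have "c = 0"
  proof (rule ccontr)
    assume "c \<noteq> 0"
    have "form H dvd Const (1 / c) * Const c" using \<open>form H dvd Const c\<close> by (rule dvd_mult)
    also have "Const (1 / c) * Const c = (1 :: ('n, 'k) mpoly)" using \<open>c \<noteq> 0\<close> by (simp flip: Const_mult)
    finally show False using linear_form_not_dvd_1[OF nz[OF H]] by blast
  qed
  then show ?thesis using f g by auto
qed

lemma bform_dvd_power:
  assumes H: "H \<in> I" and "bform j f" "form H ^ k dvd f"
  shows "f = 0 \<or> k \<le> j \<and> (\<exists>g. f = form H ^ k * g \<and> bform (j - k) g)"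
  using assms(3)
proof (induction k)
  case 0 then show ?case using assms(2) by simp
next
  case (Suc k)
  have "form H ^ k dvd f" using Suc.prems by (metis dvd_mult_right power_Suc)
  from Suc.IH[OF this] show ?case
  proof
    assume "k \<le> j \<and> (\<exists>g. f = form H ^ k * g \<and> bform (j - k) g)"
    then obtain g where g: "k \<le> j" "f = form H ^ k * g" "bform (j - k) g" by blast
    have "form H ^ k * form H dvd form H ^ k * g" using Suc.prems g(2) by (simp add: mult.commute)
    then have "form H dvd g" using form_nz[OF H] by (simp add: mpoly_dvd_mult_cancel mpoly_power_eq_0_iff)
    then obtain h where h: "g = form H * h" "case j - k of 0 \<Rightarrow> h = 0 | Suc i \<Rightarrow> bform i h"
      using bform_dvd[OF H g(3)] by blast
    show ?thesis
    proof (cases "j - k")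
      case 0 then show ?thesis using h g by simp
    next
      case (Suc i)
      then have "Suc k \<le> j" "j - Suc k = i" by auto
      moreover have "f = form H ^ Suc k * h" using g(2) h(1) by (simp add: algebra_simps)
      moreover have "bform i h" using h(2) Suc by simp
      ultimately show ?thesis by blast
    qed
  qed simp
qed

text \<open>The hypotheses of Saito's criterion together with the degrees, as an invariant of the
  induction that raises the multiplicities one by one.\<close>

definition good_basis where
  "good_basis m d1 d2 P1 Q1 P2 Q2 \<longleftrightarrow> bform d1 P1 \<and> bform d1 Q1 \<and> bform d2 P2 \<and> bform d2 Q2 \<and>
     mem m P1 Q1 \<and> mem m P2 Q2 \<and> d1 + d2 = (\<Sum>H\<in>I. m H) \<and>
     (\<exists>c. c \<noteq> 0 \<and> P1 * Q2 - P2 * Q1 = Const c * qpoly m)"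

lemma good_basis_swap:
  assumes "good_basis m d1 d2 P1 Q1 P2 Q2" shows "good_basis m d2 d1 P2 Q2 P1 Q1"
proof -
  obtain c where c: "c \<noteq> 0" "P1 * Q2 - P2 * Q1 = Const c * qpoly m"
    using assms by (auto simp: good_basis_def)
  have "P2 * Q1 - P1 * Q2 = - (P1 * Q2 - P2 * Q1)" by simp
  also have "\<dots> = Const (- c) * qpoly m" by (simp add: c(2) Const_uminus)
  finally have "\<exists>c. c \<noteq> 0 \<and> P2 * Q1 - P1 * Q2 = Const c * qpoly m" using c(1) by (metis neg_equal_0_iff_equal)
  then show ?thesis using assms by (simp add: good_basis_def)
qed

lemma mem_upd:
  "mem m P Q \<Longrightarrow> form H ^ Suc (m H) dvd ev H P Q \<Longrightarrow> mem (m(H := Suc (m H))) P Q"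
  by (simp add: mem_def)

text \<open>Modulo the form of \<open>H\<close>, every binary form of degree \<open>j\<close> is a scalar multiple of \<open>t ^ j\<close>. So of the
  two basis elements the one of smaller degree can be used to raise the order of the other one
  along \<open>H\<close>.\<close>

lemma good_basis_step_aux:
  assumes H: "H \<in> I" and "good_basis m d1 d2 P1 Q1 P2 Q2"
    and t: "bform 1 t"
    and 1: "form H ^ Suc (m H) dvd ev H P1 Q1 - Const c1 * form H ^ m H * t ^ (d1 - m H)"
    and 2: "form H ^ Suc (m H) dvd ev H P2 Q2 - Const c2 * form H ^ m H * t ^ (d2 - m H)"
    and c2: "c1 \<noteq> 0 \<Longrightarrow> m H \<le> d1"
    and le: "c1 = 0 \<or> d1 \<le> d2"
  shows "\<exists>d1 d2 P1 Q1 P2 Q2. good_basis (m(H := Suc (m H))) d1 d2 P1 Q1 P2 Q2"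
proof -
  let ?m = "m(H := Suc (m H))"
  have b: "bform d1 P1" "bform d1 Q1" "bform d2 P2" "bform d2 Q2" "mem m P1 Q1" "mem m P2 Q2"
    "d1 + d2 = (\<Sum>H\<in>I. m H)"
    using assms(2) by (auto simp: good_basis_def)
  obtain c where c: "c \<noteq> 0" "P1 * Q2 - P2 * Q1 = Const c * qpoly m"
    using assms(2) by (auto simp: good_basis_def)
  have q: "qpoly ?m = form H * qpoly m"
    using fin H unfolding qpoly_def by (subst (1 2) prod.remove[of I H]) (auto simp: mult.assoc)
  have s: "(\<Sum>H\<in>I. ?m H) = Suc (\<Sum>H\<in>I. m H)"
    using fin H by (subst (1 2) sum.remove[of I H]) auto
  have bf: "bform (Suc d) (form H * f)" if "bform d f" for d f
    using that bform_mult[of 1 "form H" d f] bform_lin form_eq[OF H] by (simp add: ev_def)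
  have fm: "mem ?m (form H * P) (form H * Q)" if "mem m P Q" for P Q
  proof (rule mem_upd)
    have "form H ^ m H dvd ev H P Q" using that H by (simp add: mem_def)
    then show "form H ^ Suc (m H) dvd ev H (form H * P) (form H * Q)"
      by (simp add: ev_simps mult_dvd_mono)
  qed (rule mem_scale[OF that])
  show ?thesis
  proof (cases "c1 = 0")
    case True
    \<comment> \<open>The first element already has the higher order along \<open>H\<close>, so only
      the second one is multiplied by the form.\<close>
    have "mem ?m P1 Q1" using 1 True b by (intro mem_upd) auto
    moreover have "P1 * (form H * Q2) - (form H * P2) * Q1 = Const c * qpoly ?m"
    proof -
      have "P1 * (form H * Q2) - (form H * P2) * Q1 = form H * (P1 * Q2 - P2 * Q1)"
        by (simp add: algebra_simps)
      then show ?thesis by (simp add: c q algebra_simps)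
    qed
    ultimately have "good_basis ?m d1 (Suc d2) P1 Q1 (form H * P2) (form H * Q2)"
      unfolding good_basis_def using b c bf fm s by auto
    then show ?thesis by blast
  next
    case False
    then have d: "m H \<le> d1" "d1 \<le> d2" using c2 le by auto
    \<comment> \<open>The factor \<open>g\<close> carries the remainder of the first element along
      \<open>H\<close> to that of the second; the power of \<open>t\<close> makes up for the
      difference of the degrees.\<close>
    define g where "g = Const (c2 / c1) * t ^ (d2 - d1)"
    let ?P = "P2 - g * P1" and ?Q = "Q2 - g * Q1"
    have "bform (d2 - d1) g" unfolding g_def by (intro bform_Const bform_power t)
    then have "bform (d2 - d1 + d1) (g * P1)" "bform (d2 - d1 + d1) (g * Q1)"
      using b by (auto intro: bform_mult)
    then have bb: "bform d2 ?P" "bform d2 ?Q" using b d by (auto intro: bform_diff)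
    have gt: "g * (Const c1 * form H ^ m H * t ^ (d1 - m H)) = Const c2 * form H ^ m H * t ^ (d2 - m H)"
    proof -
      have "g * (Const c1 * form H ^ m H * t ^ (d1 - m H)) =
          (Const (c2 / c1) * Const c1) * form H ^ m H * (t ^ (d2 - d1) * t ^ (d1 - m H))"
        by (simp add: g_def algebra_simps)
      then show ?thesis using False d by (simp flip: Const_mult power_add)
    qed
    have "form H ^ Suc (m H) dvd (ev H P2 Q2 - Const c2 * form H ^ m H * t ^ (d2 - m H)) -
        g * (ev H P1 Q1 - Const c1 * form H ^ m H * t ^ (d1 - m H))"
      by (rule dvd_diff[OF 2 dvd_mult[OF 1]])
    also have "\<dots> = ev H ?P ?Q"
      unfolding right_diff_distrib gt by (simp add: ev_simps)
    finally have "mem ?m ?P ?Q" using b by (intro mem_upd mem_diff mem_scale)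
    moreover have "(form H * P1) * ?Q - ?P * (form H * Q1) = Const c * qpoly ?m"
    proof -
      have "(form H * P1) * ?Q - ?P * (form H * Q1) = form H * (P1 * Q2 - P2 * Q1)"
        by (simp add: algebra_simps)
      then show ?thesis by (simp add: c q algebra_simps)
    qed
    ultimately have "good_basis ?m (Suc d1) d2 (form H * P1) (form H * Q1) ?P ?Q"
      unfolding good_basis_def using b c bb bf fm s by auto
    then show ?thesis by blast
  qed
qed

lemma good_basis_step:
  assumes H: "H \<in> I" and good: "good_basis m d1 d2 P1 Q1 P2 Q2"
  shows "\<exists>d1 d2 P1 Q1 P2 Q2. good_basis (m(H := Suc (m H))) d1 d2 P1 Q1 P2 Q2"
proof -
  obtain t r s r' s' where t: "bform 1 t" "x = Const r * form H + Const s * t"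
    "y = Const r' * form H + Const s' * t" "\<not> form H dvd t"
    using complement[OF H] by blast
  \<comment> \<open>The bound \<open>m H \<le> d\<close> is recorded since \<open>d - m H\<close> is
    a truncated difference; it can fail only for a vanishing value, where \<open>c\<close> is taken
    to be zero.\<close>
  have red: "\<exists>c. form H ^ Suc (m H) dvd ev H P Q - Const c * form H ^ m H * t ^ (d - m H) \<and> (c \<noteq> 0 \<longrightarrow> m H \<le> d)"
    if P: "bform d P" "bform d Q" "mem m P Q" for d P Q
  proof -
    have "bform d (ev H P Q)" using P by (auto simp: ev_def intro!: bform_add bform_Const)
    moreover have "form H ^ m H dvd ev H P Q" using P H by (simp add: mem_def)
    ultimately have "ev H P Q = 0 \<or> m H \<le> d \<and> (\<exists>g. ev H P Q = form H ^ m H * g \<and> bform (d - m H) g)"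
      by (rule bform_dvd_power[OF H])
    then show ?thesis
    proof
      assume "ev H P Q = 0" then show ?thesis by (intro exI[of _ 0]) simp
    next
      assume "m H \<le> d \<and> (\<exists>g. ev H P Q = form H ^ m H * g \<and> bform (d - m H) g)"
      then obtain g where g: "m H \<le> d" "ev H P Q = form H ^ m H * g" "bform (d - m H) g" by blast
      obtain c h where "g = Const c * t ^ (d - m H) + form H * h"
        using bform_reduce[OF t(1-3) H g(3)] by blast
      then have "ev H P Q - Const c * form H ^ m H * t ^ (d - m H) = form H ^ Suc (m H) * h"
        by (simp add: g(2) algebra_simps)
      then show ?thesis using g(1) by (metis dvd_triv_left)
    qed
  qed
  have b: "bform d1 P1" "bform d1 Q1" "bform d2 P2" "bform d2 Q2" "mem m P1 Q1" "mem m P2 Q2"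
    using good by (auto simp: good_basis_def)
  obtain c1 where c1: "form H ^ Suc (m H) dvd ev H P1 Q1 - Const c1 * form H ^ m H * t ^ (d1 - m H)"
    "c1 \<noteq> 0 \<Longrightarrow> m H \<le> d1" using red[OF b(1,2,5)] by blast
  obtain c2 where c2: "form H ^ Suc (m H) dvd ev H P2 Q2 - Const c2 * form H ^ m H * t ^ (d2 - m H)"
    "c2 \<noteq> 0 \<Longrightarrow> m H \<le> d2" using red[OF b(3,4,6)] by blast
  show ?thesis
  proof (cases "c1 = 0 \<or> d1 \<le> d2")
    case True
    then show ?thesis using good_basis_step_aux[OF H good t(1) c1(1) c2(1) c1(2)] by blast
  next
    case False
    then show ?thesis
      using good_basis_step_aux[OF H good_basis_swap[OF good] t(1) c2(1) c1(1) c2(2)] by auto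
  qed
qed

text \<open>Induction on the total multiplicity, starting from the two coordinate derivations for
  multiplicity zero.\<close>

theorem good_basis_exists: "\<exists>d1 d2 P1 Q1 P2 Q2. good_basis m d1 d2 P1 Q1 P2 Q2"
proof (induction "\<Sum>H\<in>I. m H" arbitrary: m)
  case 0
  then have m0: "\<And>H. H \<in> I \<Longrightarrow> m H = 0" using fin by simp
  have "good_basis m 0 0 1 0 0 1"
    unfolding good_basis_def
    using m0 bform_1 by (auto simp: mem_def qpoly_def intro!: exI[of _ 1])
  then show ?case by blast
next
  case (Suc N)
  then obtain H where H: "H \<in> I" "m H > 0" by (metis less_zeroE not_gr_zero sum.neutral zero_less_Suc)
  let ?m = "m(H := m H - 1)"
  have "(\<Sum>K\<in>I. m K) = Suc (\<Sum>K\<in>I. ?m K)"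
    using fin H by (subst (1 2) sum.remove[of I H]) auto
  then have "N = (\<Sum>K\<in>I. ?m K)" using Suc.hyps(2) by simp
  from Suc.hyps(1)[OF this] obtain d1 d2 P1 Q1 P2 Q2 where "good_basis ?m d1 d2 P1 Q1 P2 Q2" by blast
  from good_basis_step[OF H(1) this] show ?case using H by simp
qed

end

context rank2
begin

subsection \<open>The extremal exponents\<close>

text \<open>The derivation with value zero at \<open>x\<close> and \<open>phi\<close> at
  \<open>y\<close> complements the Euler derivation in D(A_X); its degree is |A_X| - 1.\<close>

definition phi :: "('n, 'k) mpoly" where
  "phi = (\<Prod>H\<in>I - {H1}. form H)"

lemma phi_eq: "x * phi = qpoly (\<lambda>_. 1)"
  using fin H1 by (simp add: phi_def qpoly_def prod.remove[of I H1])

lemma phi_nz: "phi \<noteq> 0"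
  using phi_eq qpoly_nz[of "\<lambda>_. 1"] by auto

lemma homogeneous_phi: "homogeneous_poly (card I - 1) phi"
proof -
  have "homogeneous_poly (\<Sum>H\<in>I - {H1}. 1) phi"
    unfolding phi_def by (intro homogeneous_prod homogeneous_linear_form)
  then show ?thesis using fin H1 by simp
qed

lemma mem_euler: "mem (\<lambda>_. 1) x y"
  by (simp add: mem_def form_eq[symmetric])

lemma mem_phi: "mem (\<lambda>_. 1) 0 phi"
  unfolding mem_def
proof
  fix H assume H: "H \<in> I"
  show "form H ^ 1 dvd ev H 0 phi"
  proof (cases "H = H1")
    case True then show ?thesis using dual by (simp add: ev_def)
  next
    case False
    then have "form H dvd phi" unfolding phi_def using H fin by (intro dvd_prodI) auto
    then show ?thesis by (simp add: ev_def)
  qed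
qed

text \<open>Saito's criterion for the Euler derivation and the pair \<open>0\<close>,
  \<open>phi\<close>: their determinant \<open>x * phi\<close> is the defining polynomial.\<close>

lemma generate_1:
  assumes "mem (\<lambda>_. 1) P Q" shows "\<exists>f g. P = f * x \<and> Q = f * y + g * phi"
proof -
  have "x * phi - 0 * y = Const 1 * qpoly (\<lambda>_. 1)" by (simp add: phi_eq)
  from saito_criterion[OF mem_euler mem_phi _ this assms] show ?thesis by auto
qed

lemma mem_mono: "(\<And>H. H \<in> I \<Longrightarrow> m' H \<le> m H) \<Longrightarrow> mem m P Q \<Longrightarrow> mem m' P Q"
  unfolding mem_def using le_imp_power_dvd dvd_trans by blast

lemma qpoly_quot:
  assumes "\<And>H. H \<in> I \<Longrightarrow> m H \<ge> 1"
  shows "qpoly m = qpoly (\<lambda>H. m H - 1) * qpoly (\<lambda>_. 1)"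
proof -
  have "form H ^ m H = form H ^ (m H - 1) * form H" if "H \<in> I" for H
    using assms[OF that] by (cases "m H") (auto simp: mult.commute)
  then show ?thesis by (simp add: qpoly_def flip: prod.distrib)
qed

lemma mem_euler_multiple:
  assumes m: "\<And>H. H \<in> I \<Longrightarrow> m H \<ge> 1" and "mem m (f * x) (f * y)"
  shows "qpoly (\<lambda>H. m H - 1) dvd f"
proof (rule qpoly_dvd)
  fix H assume H: "H \<in> I"
  have "form H ^ m H dvd f * form H"
    using assms(2) H by (simp add: mem_def ev_simps form_eq[symmetric])
  then have "form H * form H ^ (m H - 1) dvd form H * f"
    using m[OF H] by (simp add: mult.commute[of f] flip: power_Suc)
  then show "form H ^ (m H - 1) dvd f" using form_nz[OF H] by (simp add: mpoly_dvd_mult_cancel)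
qed

lemma deg_quot:
  assumes "\<And>H. H \<in> I \<Longrightarrow> m H \<ge> 1"
  shows "(\<Sum>H\<in>I. m H - 1) = (\<Sum>H\<in>I. m H) - card I" "card I \<le> (\<Sum>H\<in>I. m H)"
proof -
  have "m H = (m H - 1) + 1" if "H \<in> I" for H using assms[OF that] by simp
  then have "(\<Sum>H\<in>I. m H) = (\<Sum>H\<in>I. (m H - 1) + 1)" by (rule sum.cong[OF refl])
  then have "(\<Sum>H\<in>I. m H) = (\<Sum>H\<in>I. m H - 1) + card I" by (simp only: sum.distrib) simp
  then show "(\<Sum>H\<in>I. m H - 1) = (\<Sum>H\<in>I. m H) - card I" "card I \<le> (\<Sum>H\<in>I. m H)" by auto
qed

lemma euler_phi_degrees:
  assumes "homogeneous_poly d (f * x)" "homogeneous_poly d (f * y + g * phi)"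
  shows "f = 0 \<or> 1 \<le> d \<and> homogeneous_poly (d - 1) f" "homogeneous_poly d (g * phi)"
proof -
  have x: "homogeneous_poly 1 x" "x \<noteq> 0" using homogeneous_linear_form form_nz[OF H1] by auto
  show f: "f = 0 \<or> 1 \<le> d \<and> homogeneous_poly (d - 1) f"
    using homogeneous_factor[OF x, of d f] assms(1) by blast
  have "homogeneous_poly d (f * y)"
  proof (cases "f = 0")
    case False
    with f have "homogeneous_poly (d - 1 + 1) (f * y)" "1 \<le> d"
      using homogeneous_mult[OF _ homogeneous_linear_form] by blast+
    then show ?thesis by simp
  qed simp
  from homogeneous_diff[OF assms(2) this] show "homogeneous_poly d (g * phi)" by simp
qed

lemma exponent_ge:
  assumes m: "\<And>H. H \<in> I \<Longrightarrow> m H \<ge> 1"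
    and "homogeneous_poly d P" "homogeneous_poly d Q" "mem m P Q" "P \<noteq> 0 \<or> Q \<noteq> 0"
    and d: "d < card I - 1"
  shows "(\<Sum>H\<in>I. m H) - card I + 1 \<le> d"
proof -
  obtain f g where fg: "P = f * x" "Q = f * y + g * phi"
    using generate_1[OF mem_mono[OF _ assms(4)]] m by blast
  have f: "f = 0 \<or> 1 \<le> d \<and> homogeneous_poly (d - 1) f" and "homogeneous_poly d (g * phi)"
    using euler_phi_degrees assms(2,3) fg by blast+
  then have g: "g = 0"
    using homogeneous_factor[OF homogeneous_phi phi_nz, of d g] d by auto
  then have f0: "f \<noteq> 0" using assms(5) fg by auto
  have "mem m (f * x) (f * y)" using assms(4) fg g by simp
  from mem_euler_multiple[OF m this] obtain h where h: "f = h * qpoly (\<lambda>H. m H - 1)"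
    unfolding dvd_def by (metis mult.commute)
  then have "h \<noteq> 0" using f0 by auto
  \<comment> \<open>The Euler derivation has degree one, so its coefficient \<open>f\<close> has
    degree \<open>d - 1\<close>; this is the source of the \<open>+ 1\<close> in the bound.\<close>
  then have "(\<Sum>H\<in>I. m H - 1) \<le> d - 1" "1 \<le> d"
    using homogeneous_factor[OF homogeneous_qpoly qpoly_nz, of "d - 1" h] f f0 h by auto
  then show ?thesis using deg_quot[of m, OF m] by auto
qed

lemma card_ge_2: "card I \<ge> 2"
  using card_mono[OF fin, of "{H1, H2}"] H1 H2 H12 by simp

lemma exponent_ge_min:
  assumes m: "\<And>H. H \<in> I \<Longrightarrow> m H \<ge> 1" and good: "good_basis m d1 d2 P1 Q1 P2 Q2"
  shows "min (card I - 1) ((\<Sum>H\<in>I. m H) - card I + 1) \<le> d1"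
proof (rule ccontr)
  assume *: "\<not> ?thesis"
  have b: "homogeneous_poly d1 P1" "homogeneous_poly d1 Q1" "mem m P1 Q1"
    using good bform_homogeneous by (auto simp: good_basis_def)
  have "P1 \<noteq> 0 \<or> Q1 \<noteq> 0" using good qpoly_nz by (auto simp: good_basis_def mpoly_mult_eq_0_iff)
  from exponent_ge[OF m b this] * show False by (auto simp: min_def split: if_splits)
qed

text \<open>With \<open>d1 = a + s\<close> and \<open>d2 = b - s\<close> the products differ by
  \<open>s * (b - a - s)\<close>, that is by (d1 - a)(b - d1). The bounds by the minimum give both
  factors the same sign, and the product vanishes only if one of them does.\<close>

lemma product_ge:
  fixes a b d1 d2 :: nat
  assumes "d1 + d2 = a + b" "min a b \<le> d1" "min a b \<le> d2"
  shows "a * b \<le> d1 * d2" "d1 * d2 = a * b \<Longrightarrow> d1 = a \<or> d2 = a"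
proof -
  define s where "s = int d1 - int a"
  have d: "int d1 = int a + s" "int d2 = int b - s" using assms(1) by (auto simp: s_def)
  have "s * (int b - int a - s) \<ge> 0"
  proof (cases "a \<le> b")
    case True
    then have "0 \<le> s" "0 \<le> int b - int a - s" using assms d by auto
    then show ?thesis by simp
  next
    case False
    then have "s \<le> 0" "int b - int a - s \<le> 0" using assms d by auto
    then show ?thesis by (simp add: mult_nonpos_nonpos)
  qed
  moreover have eq: "int (d1 * d2) = int (a * b) + s * (int b - int a - s)"
    by (simp add: d algebra_simps)
  ultimately show "a * b \<le> d1 * d2" by linarith
  assume "d1 * d2 = a * b"
  then have "s * (int b - int a - s) = 0" using eq by simp
  then show "d1 = a \<or> d2 = a" using d by auto
qed

lemma degree_sum:
  assumes m: "\<And>H. H \<in> I \<Longrightarrow> m H \<ge> 1" and good: "good_basis m d1 d2 P1 Q1 P2 Q2"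
  shows "d1 + d2 = (card I - 1) + ((\<Sum>H\<in>I. m H) - card I + 1)"
  using good deg_quot(2)[of m, OF m] card_ge_2 by (auto simp: good_basis_def)

lemma exponent_product_ge:
  assumes m: "\<And>H. H \<in> I \<Longrightarrow> m H \<ge> 1" and good: "good_basis m d1 d2 P1 Q1 P2 Q2"
  shows "(card I - 1) * ((\<Sum>H\<in>I. m H) - card I + 1) \<le> d1 * d2"
  using product_ge(1)[OF degree_sum[OF m good]]
    exponent_ge_min[OF m good] exponent_ge_min[OF m good_basis_swap[OF good]] by blast

text \<open>For degree reasons the basis element of degree |A_X| - 1 has a constant coefficient at
  \<open>phi\<close>. If that constant is zero, the element is a multiple of the Euler derivation,
  and the determinant makes the coefficient of the other basis element a unit.\<close>

lemma phi_split_aux: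
  assumes m: "\<And>H. H \<in> I \<Longrightarrow> m H \<ge> 1" and good: "good_basis m d1 d2 P1 Q1 P2 Q2"
    and d1: "d1 = card I - 1"
  shows "\<exists>r. mem m (r * x) (phi + r * y)"
proof -
  have b: "mem m P1 Q1" "mem m P2 Q2" "homogeneous_poly d1 P1" "homogeneous_poly d1 Q1"
    using good bform_homogeneous by (auto simp: good_basis_def)
  obtain c where c: "c \<noteq> 0" "P1 * Q2 - P2 * Q1 = Const c * qpoly m"
    using good by (auto simp: good_basis_def)
  obtain f1 g1 where 1: "P1 = f1 * x" "Q1 = f1 * y + g1 * phi"
    using generate_1[OF mem_mono[OF _ b(1)]] m by blast
  obtain f2 g2 where 2: "P2 = f2 * x" "Q2 = f2 * y + g2 * phi"
    using generate_1[OF mem_mono[OF _ b(2)]] m by blast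
  have inv: "\<exists>r. mem m (r * x) (phi + r * y)"
    if v: "mem m (f * x) (f * y + g * phi)" and s: "s * g = 1" for f g s
  proof -
    have "mem m (s * (f * x)) (s * (f * y + g * phi))" using v by (rule mem_scale)
    also have "s * (f * x) = (s * f) * x" by (simp add: algebra_simps)
    also have "s * (f * y + g * phi) = (s * g) * phi + (s * f) * y" by (simp add: algebra_simps)
    finally show ?thesis using s by auto
  qed
  have "homogeneous_poly d1 (g1 * phi)" using euler_phi_degrees b(3,4) 1 by blast
  then have g: "g1 = 0 \<or> homogeneous_poly 0 g1"
    using homogeneous_factor[OF homogeneous_phi phi_nz, of d1 g1] d1 by auto
  show ?thesis
  proof (cases "g1 = 0")
    case False
    then obtain e where e: "g1 = Const e" using g homogeneous_degree_0 by blast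
    with False have "Const (1 / e) * g1 = 1" by (simp flip: Const_mult)
    from inv[OF _ this] b(1) show ?thesis unfolding 1 by blast
  next
    case True
    then have "mem m (f1 * x) (f1 * y)" using b(1) 1 by simp
    from mem_euler_multiple[OF m this] obtain h where h: "f1 = h * qpoly (\<lambda>H. m H - 1)"
      unfolding dvd_def by (metis mult.commute)
    \<comment> \<open>Both sides are the determinant of the basis, hence
      \<open>Const c * qpoly m\<close>; so \<open>h * g2\<close> is a nonzero constant.\<close>
    have "qpoly m * (h * g2) = f1 * g2 * qpoly (\<lambda>_. 1)"
    proof -
      have "qpoly m = qpoly (\<lambda>H. m H - 1) * qpoly (\<lambda>_. 1)" by (rule qpoly_quot[OF m])
      then show ?thesis by (simp only: h) (simp add: algebra_simps)
    qed
    also have "\<dots> = P1 * Q2 - P2 * Q1"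
      by (simp add: 1 2 True phi_eq[unfolded One_nat_def, symmetric] algebra_simps)
    finally have "qpoly m * (h * g2) = qpoly m * Const c" by (simp add: c(2) mult.commute)
    then have "h * g2 = Const c" using qpoly_nz by (simp add: mpoly_mult_left_cancel)
    then have "(Const (1 / c) * h) * g2 = 1" using c(1) by (simp add: mult.assoc flip: Const_mult)
    from inv[OF _ this] b(2) show ?thesis unfolding 2 by blast
  qed
qed

theorem extremal_split:
  assumes m: "\<And>H. H \<in> I \<Longrightarrow> m H \<ge> 1" and good: "good_basis m d1 d2 P1 Q1 P2 Q2"
    and eq: "d1 * d2 = (card I - 1) * ((\<Sum>H\<in>I. m H) - card I + 1)"
    and PQ: "mem (\<lambda>_. 1) P Q"
  shows "\<exists>f. mem m (P - f * x) (Q - f * y)"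
proof -
  have "d1 = card I - 1 \<or> d2 = card I - 1"
    using product_ge(2)[OF degree_sum[OF m good] _ _ eq]
      exponent_ge_min[OF m good] exponent_ge_min[OF m good_basis_swap[OF good]] by blast
  then obtain r where r: "mem m (r * x) (phi + r * y)"
    using phi_split_aux[OF m good] phi_split_aux[OF m good_basis_swap[OF good]] by blast
  obtain f g where "P = f * x" "Q = f * y + g * phi" using generate_1[OF PQ] by blast
  \<comment> \<open>Taking \<open>g\<close> times the element with \<open>phi\<close>-coefficient
    one away from the given pair leaves \<open>f - g * r\<close> times the Euler derivation.\<close>
  then have "P - (f - g * r) * x = g * (r * x)" "Q - (f - g * r) * y = g * (phi + r * y)"
    by (simp_all add: algebra_simps)
  with mem_scale[OF r, of g] show ?thesis by metis
qed

end

section \<open>Exponents of localizations\<close>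

lemma subspace_hyperplane: "vec.subspace (hyperplane a)"
  by (rule vec.subspaceI) (simp_all add: mem_hyperplane scalar_prod_simps)

lemma dim_inter_hyperplane:
  assumes U: "vec.subspace U" and "\<not> U \<subseteq> hyperplane a"
  shows "vec.dim U = Suc (vec.dim (U \<inter> hyperplane a))"
proof -
  obtain v where v: "v \<in> U" "a \<bullet>\<bullet> v \<noteq> 0" using assms(2) unfolding subset_iff mem_hyperplane by blast
  let ?W = "U \<inter> hyperplane a"
  have W: "vec.subspace ?W" using U subspace_hyperplane by (rule vec.subspace_inter)
  have "U \<subseteq> vec.span (insert v ?W)"
  proof
    fix z assume z: "z \<in> U"
    let ?c = "(a \<bullet>\<bullet> z) / (a \<bullet>\<bullet> v)"
    have "z - ?c *s v \<in> ?W"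
      using z v U by (simp add: mem_hyperplane scalar_prod_simps vec.subspace_diff vec.subspace_scale)
    then show "z \<in> vec.span (insert v ?W)" by (meson vec.span_base vec.span_breakdown_eq)
  qed
  then have "vec.dim U = vec.dim (insert v ?W)"
    using v(1) by (metis IntE insert_subset subsetI vec.dim_mono vec.dim_subset order_antisym)
  also have "\<dots> = Suc (vec.dim ?W)"
  proof -
    have "v \<notin> vec.span ?W" using v W by (metis IntD2 mem_hyperplane vec.span_eq_iff)
    then show ?thesis by (simp add: vec.dim_insert)
  qed
  finally show ?thesis .
qed

lemma dim_hyperplane:
  fixes a :: "'k::field ^ 'n::finite"
  assumes "a \<noteq> 0" shows "CARD('n) = Suc (vec.dim (hyperplane a))"
proof -
  obtain v where "a \<bullet>\<bullet> v = 1" using exists_scalar_prod_1[OF assms] by blast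
  then have "v \<notin> hyperplane a" by (simp add: mem_hyperplane)
  then have "\<not> UNIV \<subseteq> hyperplane a" by blast
  from dim_inter_hyperplane[OF vec.subspace_UNIV this] show ?thesis
    by (simp add: vec_dim_card del: vec.dim_UNIV)
qed

lemma dim_hyperplane_inter:
  fixes a :: "'k::field ^ 'n::finite"
  assumes "a \<noteq> 0" "b \<noteq> 0" "hyperplane a \<noteq> hyperplane b"
  shows "CARD('n) = vec.dim (hyperplane a \<inter> hyperplane b) + 2"
proof -
  have "\<not> hyperplane a \<subseteq> hyperplane b" using hyperplane_subset_imp_eq assms by blast
  from dim_inter_hyperplane[OF subspace_hyperplane this] dim_hyperplane[OF assms(1)]
  show ?thesis by simp
qed

section \<open>Derivations with constant coefficients\<close>

definition cder :: "'k::field ^ 'n::finite \<Rightarrow> ('n, 'k) der" where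
  "cder v = (\<chi> i. Const (v $ i))"

lemma ap_cder: "ap (cder v) a = Const (a \<bullet>\<bullet> v)"
  by (simp add: ap_def cder_def scalar_prod_def Const_sum Const_mult)

lemma homogeneous_cder: "homogeneous_der 0 (cder v)"
  by (simp add: homogeneous_der_def cder_def homogeneous_Const)

text \<open>Over a ring it is not enough that \<open>a\<close> lies outside the span: all its
  nonzero multiples have to.\<close>

lemma independent_insert:
  fixes S :: "('a::comm_ring_1 ^ 'n::finite) set"
  assumes "der.independent S" "\<And>k. k *s a \<in> der.span S \<Longrightarrow> k = 0"
  shows "der.independent (insert a S)"
proof
  assume "der.dependent (insert a S)"
  then obtain T c v where T: "finite T" "T \<subseteq> insert a S" "(\<Sum>v\<in>T. c v *s v) = 0" "v \<in> T" "c v \<noteq> 0"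
    unfolding der.dependent_explicit by blast
  have sum: "(\<Sum>v\<in>T - {a}. c v *s v) \<in> der.span S"
    using T(2) by (intro der.span_sum der.span_scale der.span_base) auto
  show False
  proof (cases "a \<in> T")
    case True
    then have e: "c a *s a + (\<Sum>v\<in>T - {a}. c v *s v) = 0"
      using T(3) sum.remove[OF T(1) True, of "\<lambda>v. c v *s v"] by simp
    have "c a *s a = - (\<Sum>v\<in>T - {a}. c v *s v)" using e by (rule add_eq_0_iff2[THEN iffD1])
    then have "c a *s a \<in> der.span S" using der.span_neg[OF sum] by (rule ssubst)
    then have ca: "c a = 0" by (rule assms(2))
    then have "(\<Sum>v\<in>T - {a}. c v *s v) = 0" using e by simp
    moreover have "v \<in> T - {a}" using T ca by auto
    ultimately show False
      using der.independentD[OF assms(1), of "T - {a}" c v] T by auto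
  next
    case False
    then show False using der.independentD[OF assms(1), of T c v] T by auto
  qed
qed

lemma look_scale_cder: "look ((f *s cder b) $ i) t = look f t * b $ i"
proof -
  have "look ((f *s cder b) $ i) t = look (Const (b $ i) * f) t" by (simp add: cder_def mult.commute)
  also have "\<dots> = b $ i * look f t" by (rule lookup_Const_mult)
  finally show ?thesis by (simp add: mult.commute)
qed

text \<open>Comparing the coefficients at each monomial splits a polynomial relation into relations
  over the field.\<close>

lemma independent_cder:
  assumes "vec.independent B" shows "der.independent (cder ` B)"
proof
  assume "der.dependent (cder ` B)"
  then obtain T c v where T: "finite T" "T \<subseteq> cder ` B" "(\<Sum>v\<in>T. c v *s v) = 0" "v \<in> T" "c v \<noteq> 0"
    unfolding der.dependent_explicit by blast
  have inj: "inj cder" by (auto simp: inj_on_def cder_def vec_eq_iff)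
  define B' where "B' = {b \<in> B. cder b \<in> T}"
  have T': "T = cder ` B'" using T(2) by (auto simp: B'_def)
  have fin: "finite B'" using T(1) inj unfolding T' by (metis finite_image_iff inj_on_subset subset_UNIV)
  have 0: "(\<Sum>b\<in>B'. c (cder b) *s cder b) = 0"
    using T(3) inj by (simp add: T' sum.reindex[OF inj_on_subset[OF inj]])
  obtain b where b: "b \<in> B'" "v = cder b" using T(4) T' by blast
  have "look (c v) t = 0" for t
  proof -
    have "(\<Sum>b\<in>B'. look (c (cder b)) t *s b) = 0"
    proof (simp add: vec_eq_iff, rule allI)
      fix i
      have "look ((\<Sum>b\<in>B'. c (cder b) *s cder b) $ i) t = 0" by (simp add: 0)
      then show "(\<Sum>b\<in>B'. look (c (cder b)) t * b $ i) = 0"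
        by (simp add: lookup_sum look_scale_cder del: vector_smult_component)
    qed
    then show ?thesis
      using vec.independentD[OF assms fin _ _ b(1), of "\<lambda>b. look (c (cder b)) t"] b(2)
      by (auto simp: B'_def)
  qed
  then have "c v = 0" by (intro poly_mapping_eqI) simp
  with T(5) show False ..
qed

text \<open>The coefficient vector at each monomial is expanded in \<open>B\<close>, and the scalars
  belonging to one \<open>b\<close> are reassembled into the polynomial \<open>f b\<close>.\<close>

lemma span_cder:
  fixes B :: "('k::field ^ 'n::finite) set"
  assumes "finite B"
    and "\<And>t. (\<chi> i. look (\<kappa> $ i) t) \<in> vec.span B"
  shows "\<kappa> \<in> der.span (cder ` B)"
proof -
  have "\<exists>r. (\<chi> i. look (\<kappa> $ i) t) = (\<Sum>b\<in>B. r b *s b)" for t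
    using assms(2)[of t] unfolding vec.span_finite[OF assms(1)] by auto
  then obtain r where r: "\<And>t. (\<chi> i. look (\<kappa> $ i) t) = (\<Sum>b\<in>B. r t b *s b)" by metis
  define T where "T = (\<Union>i. keys (\<kappa> $ i))"
  have T: "finite T" by (simp add: T_def)
  define f where "f b = (\<Sum>t\<in>T. single t (r t b))" for b
  have "\<kappa> = (\<Sum>b\<in>B. f b *s cder b)"
  proof (rule vec_eq_iff[THEN iffD2], rule allI, rule poly_mapping_eqI)
    fix i t
    have "look ((\<Sum>b\<in>B. f b *s cder b) $ i) t = (\<Sum>b\<in>B. look (f b) t * b $ i)"
      by (simp add: lookup_sum look_scale_cder del: vector_smult_component)
    also have "\<dots> = (if t \<in> T then \<Sum>b\<in>B. r t b * b $ i else 0)"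
      using T by (simp add: f_def lookup_sum lookup_single when_def)
    also have "\<dots> = (if t \<in> T then look (\<kappa> $ i) t else 0)"
      using arg_cong[where f = "\<lambda>v. v $ i", OF r[of t]] by simp
    also have "\<dots> = look (\<kappa> $ i) t" by (auto simp: T_def in_keys_iff)
    finally show "look (\<kappa> $ i) t = look ((\<Sum>b\<in>B. f b *s cder b) $ i) t" by simp
  qed
  moreover have "(\<Sum>b\<in>B. f b *s cder b) \<in> der.span (cder ` B)"
    by (intro der.span_sum der.span_scale der.span_base imageI)
  ultimately show ?thesis by simp
qed

lemma scalar_prod_coeff_vector: "a \<bullet>\<bullet> (\<chi> i. look (\<kappa> $ i) t) = look (ap \<kappa> a) t"
  by (simp add: scalar_prod_def ap_def lookup_sum lookup_Const_mult)

text \<open>The abstract indices become the hyperplanes themselves, as \<open>log_der\<close> and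
  \<open>has_exponents\<close> require.\<close>

locale rank2_arrangement = rank2 \<gamma> I H1 H2 u w
  for \<gamma> :: "('k::field ^ 'n::finite) set \<Rightarrow> 'k ^ 'n" and I H1 H2 u w
begin

definition lift :: "('n, 'k) mpoly \<Rightarrow> ('n, 'k) mpoly \<Rightarrow> ('n, 'k) der" where
  "lift P Q = P *s cder u + Q *s cder w"

lemma ap_lift: "ap (lift P Q) (\<gamma> H1) = P" "ap (lift P Q) (\<gamma> H2) = Q"
  by (simp_all add: lift_def ap_simps ap_cder dual)

lemma homogeneous_lift:
  assumes "homogeneous_poly d P" "homogeneous_poly d Q" shows "homogeneous_der d (lift P Q)"
  using homogeneous_der_scale[OF assms(1) homogeneous_cder[of u]]
    homogeneous_der_scale[OF assms(2) homogeneous_cder[of w]]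
  by (simp add: lift_def homogeneous_der_def homogeneous_add)

lemma ap_ev: "H \<in> I \<Longrightarrow> ap \<theta> (\<gamma> H) = ev H (ap \<theta> (\<gamma> H1)) (ap \<theta> (\<gamma> H2))"
  by (subst expand) (simp_all add: ap_simps ev_def)

lemma log_der_mem: "\<theta> \<in> log_der \<gamma> I m \<longleftrightarrow> mem m (ap \<theta> (\<gamma> H1)) (ap \<theta> (\<gamma> H2))"
  by (auto simp: log_der_iff mem_def ap_ev[of _ \<theta>])

lemma ap_span_kernel:
  assumes "\<And>\<kappa>. \<kappa> \<in> K \<Longrightarrow> ap \<kappa> a = 0" "\<kappa> \<in> der.span K" shows "ap \<kappa> a = 0"
  using assms(2) by (induction rule: der.span_induct_alt) (simp_all add: ap_simps assms(1))

text \<open>The lifts of the two pairs are completed by the constant derivations along a basis of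
  the flat, which kill every form through it and account for the exponents zero.\<close>

lemma good_basis_exponents:
  assumes good: "good_basis m d1 d2 P1 Q1 P2 Q2"
  shows "has_exponents \<gamma> I m (d1 # d2 # replicate (CARD('n) - 2) 0)"
proof -
  have b: "mem m P1 Q1" "mem m P2 Q2" "homogeneous_poly d1 P1" "homogeneous_poly d1 Q1"
    "homogeneous_poly d2 P2" "homogeneous_poly d2 Q2"
    using good bform_homogeneous by (auto simp: good_basis_def)
  obtain c where c: "c \<noteq> 0" "P1 * Q2 - P2 * Q1 = Const c * qpoly m"
    using good by (auto simp: good_basis_def)
  have D: "P1 * Q2 - P2 * Q1 \<noteq> 0" using c qpoly_nz by (simp add: mpoly_mult_eq_0_iff)
  let ?X = "hyperplane (\<gamma> H1) \<inter> hyperplane (\<gamma> H2)"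
  have "vec.subspace ?X" by (intro vec.subspace_inter subspace_hyperplane)
  obtain B where B: "B \<subseteq> ?X" "vec.independent B" "?X \<subseteq> vec.span B" "card B = vec.dim ?X"
    by (rule vec.basis_exists)
  have finB: "finite B" using B(2) by (rule vec.finiteI_independent)
  have "hyperplane (\<gamma> H1) \<noteq> hyperplane (\<gamma> H2)" using inj H1 H2 H12 by (auto simp: inj_on_def)
  from dim_hyperplane_inter[OF nz[OF H1] nz[OF H2] this]
  have cardB: "card B = CARD('n) - 2" using B(4) by simp
  have "inj cder" by (auto simp: inj_on_def cder_def vec_eq_iff)
  then have cardC: "card (cder ` B) = CARD('n) - 2"
    using cardB by (metis card_image inj_on_subset subset_UNIV)
  obtain bs where bs: "set bs = cder ` B" "distinct bs"
    using finite_distinct_list[of "cder ` B"] finB by auto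
  have len: "length bs = CARD('n) - 2" using bs cardC by (metis distinct_card)
  let ?K = "der.span (cder ` B)"
  have gen: "ap \<kappa> (\<gamma> H1) = 0" "ap \<kappa> (\<gamma> H2) = 0" if "\<kappa> \<in> cder ` B" for \<kappa>
    using that B(1) by (auto simp: ap_cder mem_hyperplane subset_iff)
  have K: "ap \<kappa> (\<gamma> H1) = 0" "ap \<kappa> (\<gamma> H2) = 0" if "\<kappa> \<in> ?K" for \<kappa>
    using ap_span_kernel[OF gen(1) that] ap_span_kernel[OF gen(2) that] by blast+
  \<comment> \<open>If \<open>\<kappa>\<close> kills both forms, then its coefficient vector at
    every monomial is a point of the flat.\<close>
  have K': "\<kappa> \<in> ?K" if "ap \<kappa> (\<gamma> H1) = 0" "ap \<kappa> (\<gamma> H2) = 0" for \<kappa>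
  proof (rule span_cder[OF finB])
    fix t
    have "(\<chi> i. look (\<kappa> $ i) t) \<in> ?X"
      using that by (simp add: mem_hyperplane scalar_prod_coeff_vector)
    then show "(\<chi> i. look (\<kappa> $ i) t) \<in> vec.span B" using B(3) by blast
  qed
  let ?v1 = "lift P1 Q1" and ?v2 = "lift P2 Q2"
  have 2: "k = 0" if "k *s ?v2 \<in> ?K" for k
  proof -
    have "k * P2 = 0" "k * Q2 = 0" using K[OF that] by (simp_all add: ap_simps ap_lift)
    moreover have "k * (P1 * Q2 - P2 * Q1) = P1 * (k * Q2) - (k * P2) * Q1" by (simp add: algebra_simps)
    ultimately have "k * (P1 * Q2 - P2 * Q1) = 0" by simp
    then show ?thesis using D by (simp add: mpoly_mult_eq_0_iff)
  qed
  then have i2: "der.independent (insert ?v2 (cder ` B))"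
    by (rule independent_insert[OF independent_cder[OF B(2)]])
  have 1: "k = 0" if "k *s ?v1 \<in> der.span (insert ?v2 (cder ` B))" for k
  proof -
    obtain l where l: "k *s ?v1 - l *s ?v2 \<in> ?K" using \<open>k *s ?v1 \<in> _\<close> der.span_breakdown_eq by blast
    have e: "k * P1 = l * P2" "k * Q1 = l * Q2" using K[OF l] by (simp_all add: ap_simps ap_lift)
    have "k * (P1 * Q2 - P2 * Q1) = (k * P1) * Q2 - P2 * (k * Q1)" by (simp add: algebra_simps)
    also have "\<dots> = 0" unfolding e by (simp add: algebra_simps)
    finally show ?thesis using D by (simp add: mpoly_mult_eq_0_iff)
  qed
  then have i1: "der.independent (insert ?v1 (insert ?v2 (cder ` B)))"
    by (rule independent_insert[OF i2])
  have nin: "?v2 \<notin> cder ` B" "?v1 \<notin> insert ?v2 (cder ` B)"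
    using 2[of 1] 1[of 1] der.span_base[of ?v2 "cder ` B"]
      der.span_base[of ?v1 "insert ?v2 (cder ` B)"] by auto
  have span: "der.span (insert ?v1 (insert ?v2 (cder ` B))) = log_der \<gamma> I m"
  proof (rule der.span_subspace[OF _ _ subspace_log_der])
    show "insert ?v1 (insert ?v2 (cder ` B)) \<subseteq> log_der \<gamma> I m"
    proof -
      have "mem m 0 0" by (simp add: mem_def ev_def)
      then have "cder ` B \<subseteq> log_der \<gamma> I m" using gen by (simp add: subset_iff log_der_mem)
      then show ?thesis using b by (auto simp: log_der_mem ap_lift)
    qed
    show "log_der \<gamma> I m \<subseteq> der.span (insert ?v1 (insert ?v2 (cder ` B)))"
    proof
      fix \<theta> assume "\<theta> \<in> log_der \<gamma> I m"
      then have "mem m (ap \<theta> (\<gamma> H1)) (ap \<theta> (\<gamma> H2))" by (simp add: log_der_mem)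
      from saito_criterion[OF b(1,2) c this] obtain f g where fg:
        "ap \<theta> (\<gamma> H1) = f * P1 + g * P2" "ap \<theta> (\<gamma> H2) = f * Q1 + g * Q2" by blast
      have "(\<theta> - f *s ?v1) - g *s ?v2 \<in> ?K"
        by (rule K') (simp_all add: ap_simps ap_lift fg)
      then show "\<theta> \<in> der.span (insert ?v1 (insert ?v2 (cder ` B)))"
        by (meson der.span_breakdown_eq)
    qed
  qed
  have hom: "homogeneous_der d1 ?v1" "homogeneous_der d2 ?v2"
    using b homogeneous_lift by blast+
  have hbs: "homogeneous_der 0 \<theta>" if "\<theta> \<in> set bs" for \<theta>
    using that bs homogeneous_cder by auto
  have "\<forall>\<theta>\<in>set (?v1 # ?v2 # bs). \<exists>d. homogeneous_der d \<theta>" using hom hbs by auto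
  then have "homogeneous_basis (log_der \<gamma> I m) (?v1 # ?v2 # bs)"
    unfolding homogeneous_basis_def using i1 nin span bs by simp
  moreover have "list_all2 homogeneous_der (d1 # d2 # replicate (CARD('n) - 2) 0) (?v1 # ?v2 # bs)"
  proof -
    have "list_all2 homogeneous_der (replicate (CARD('n) - 2) 0) bs"
      using hbs len by (simp add: list_all2_conv_all_nth)
    then show ?thesis using hom by simp
  qed
  ultimately show ?thesis unfolding has_exponents_def by blast
qed

section \<open>Uniqueness of the two exponents\<close>

lemma min_degree:
  assumes "homogeneous_poly d P" "homogeneous_poly d Q" "P \<noteq> 0 \<or> Q \<noteq> 0"
    and "homogeneous_poly d1 P1" "homogeneous_poly d1 Q1" "homogeneous_poly d2 P2" "homogeneous_poly d2 Q2"
    and "P = f * P1 + g * P2" "Q = f * Q1 + g * Q2"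
  shows "min d1 d2 \<le> d"
proof (rule ccontr)
  assume "\<not> min d1 d2 \<le> d"
  then have "d < d1" "d < d2" by auto
  then have "hcomp d P = 0" "hcomp d Q = 0"
    using assms(4-) by (simp_all add: hcomp_add hcomp_mult)
  then show False using assms(1-3) by (simp add: hcomp_homogeneous)
qed

text \<open>The elements of degree zero vanish on all forms, so the values of the first two generate
  all logarithmic pairs. Determinants give the same degree sum for both bases, and each basis bounds
  the smaller degree of the other; so the degrees agree up to order.\<close>

lemma exponent_product_unique:
  assumes m: "\<And>H. H \<in> I \<Longrightarrow> m H \<ge> 1" and good: "good_basis m d1 d2 P1 Q1 P2 Q2"
    and "has_exponents \<gamma> I m (e1 # e2 # replicate j 0)"
  shows "e1 * e2 = d1 * d2"
proof -
  obtain \<theta>s where \<theta>s: "homogeneous_basis (log_der \<gamma> I m) \<theta>s"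
    "list_all2 homogeneous_der (e1 # e2 # replicate j 0) \<theta>s"
    using assms(3) unfolding has_exponents_def by blast
  obtain \<eta>1 \<eta>2 rest where \<eta>: "\<theta>s = \<eta>1 # \<eta>2 # rest" "homogeneous_der e1 \<eta>1" "homogeneous_der e2 \<eta>2"
    "list_all2 homogeneous_der (replicate j 0) rest"
    using \<theta>s(2) by (auto simp: list_all2_Cons1)
  have span: "der.span (set \<theta>s) = log_der \<gamma> I m" using \<theta>s(1) by (simp add: homogeneous_basis_def)
  have in_log: "\<theta> \<in> log_der \<gamma> I m" if "\<theta> \<in> set \<theta>s" for \<theta>
    using that der.span_base span by blast
  \<comment> \<open>The values of such an element are constants, and \<open>m H \<ge> 1\<close>
    makes them divisible by a linear form.\<close>
  have rest0: "ap \<theta> (\<gamma> H) = 0" if "\<theta> \<in> set rest" "H \<in> I" for \<theta> H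
  proof (rule homogeneous_0_linear_form_dvd[OF _ nz[OF that(2)]])
    have "homogeneous_der 0 \<theta>"
      using \<eta>(4) that(1) by (auto simp: list_all2_conv_all_nth in_set_conv_nth)
    then show "homogeneous_poly 0 (ap \<theta> (\<gamma> H))" by (rule homogeneous_ap)
    have "form H ^ m H dvd ap \<theta> (\<gamma> H)"
      using in_log[of \<theta>] that \<eta>(1) by (simp add: log_der_iff)
    moreover have "form H dvd form H ^ m H" using m[OF that(2)] by (simp add: dvd_power)
    ultimately show "form H dvd ap \<theta> (\<gamma> H)" by (rule dvd_trans[rotated])
  qed
  let ?p1 = "ap \<eta>1 (\<gamma> H1)" and ?q1 = "ap \<eta>1 (\<gamma> H2)"
  let ?p2 = "ap \<eta>2 (\<gamma> H1)" and ?q2 = "ap \<eta>2 (\<gamma> H2)"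
  have memp: "mem m ?p1 ?q1" "mem m ?p2 ?q2"
    using in_log[of \<eta>1] in_log[of \<eta>2] \<eta>(1) by (simp_all add: log_der_mem)
  have gen: "\<exists>f g. P = f * ?p1 + g * ?p2 \<and> Q = f * ?q1 + g * ?q2" if "mem m P Q" for P Q
  proof -
    have "lift P Q \<in> der.span (insert \<eta>1 (insert \<eta>2 (set rest)))"
      using that span \<eta>(1) by (simp add: log_der_mem ap_lift)
    then obtain f g where *: "lift P Q - f *s \<eta>1 - g *s \<eta>2 \<in> der.span (set rest)"
      using der.span_breakdown_eq by metis
    have "ap (lift P Q - f *s \<eta>1 - g *s \<eta>2) (\<gamma> H1) = 0" "ap (lift P Q - f *s \<eta>1 - g *s \<eta>2) (\<gamma> H2) = 0"
      using ap_span_kernel[OF rest0[OF _ H1] *] ap_span_kernel[OF rest0[OF _ H2] *] by blast+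
    then have "P = f * ?p1 + g * ?p2" "Q = f * ?q1 + g * ?q2"
      by (simp_all add: ap_simps ap_lift diff_eq_eq add.commute)
    then show ?thesis by blast
  qed
  have b: "mem m P1 Q1" "mem m P2 Q2" "homogeneous_poly d1 P1" "homogeneous_poly d1 Q1"
    "homogeneous_poly d2 P2" "homogeneous_poly d2 Q2" "d1 + d2 = (\<Sum>H\<in>I. m H)"
    using good bform_homogeneous by (auto simp: good_basis_def)
  obtain c where c: "c \<noteq> 0" "P1 * Q2 - P2 * Q1 = Const c * qpoly m"
    using good by (auto simp: good_basis_def)
  have D: "P1 * Q2 - P2 * Q1 \<noteq> 0" using c qpoly_nz by (simp add: mpoly_mult_eq_0_iff)
  have hp: "homogeneous_poly e1 ?p1" "homogeneous_poly e1 ?q1" "homogeneous_poly e2 ?p2" "homogeneous_poly e2 ?q2"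
    using \<eta> by (simp_all add: homogeneous_ap)
  obtain f1 g1 where 1: "P1 = f1 * ?p1 + g1 * ?p2" "Q1 = f1 * ?q1 + g1 * ?q2" using gen[OF b(1)] by blast
  obtain f2 g2 where 2: "P2 = f2 * ?p1 + g2 * ?p2" "Q2 = f2 * ?q1 + g2 * ?q2" using gen[OF b(2)] by blast
  let ?D' = "?p1 * ?q2 - ?p2 * ?q1"
  \<comment> \<open>The determinant of the transition matrix is nonzero, which bounds
    \<open>e1 + e2\<close> from above; divisibility of \<open>?D'\<close> by \<open>qpoly m\<close>
    bounds it from below.\<close>
  have DD': "P1 * Q2 - P2 * Q1 = (f1 * g2 - f2 * g1) * ?D'"
    unfolding 1 2 by (simp add: algebra_simps)
  have D': "?D' \<noteq> 0" using D unfolding DD' by auto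
  have homD': "homogeneous_poly (e1 + e2) ?D'"
    using homogeneous_mult[OF hp(1,4)] homogeneous_mult[OF hp(3,2)]
    by (intro homogeneous_diff) (simp_all add: add.commute)
  obtain r where r: "?D' = r * qpoly m"
    using qpoly_dvd_det[OF memp] by (metis dvd_def mult.commute)
  then have "r \<noteq> 0" using D' by auto
  with r homD' have le1: "(\<Sum>H\<in>I. m H) \<le> e1 + e2"
    using homogeneous_factor[OF homogeneous_qpoly qpoly_nz, of "e1 + e2" r] by simp
  have "homogeneous_poly (\<Sum>H\<in>I. m H) ((f1 * g2 - f2 * g1) * ?D')"
    unfolding DD'[symmetric] c(2) by (intro homogeneous_Const_mult homogeneous_qpoly)
  moreover have "f1 * g2 - f2 * g1 \<noteq> 0" using D unfolding DD' by auto
  ultimately have le2: "e1 + e2 \<le> (\<Sum>H\<in>I. m H)"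
    using homogeneous_factor[OF homD' D'] by blast
  have sum: "e1 + e2 = d1 + d2" using le1 le2 b(7) by simp
  have nzP: "P1 \<noteq> 0 \<or> Q1 \<noteq> 0" "P2 \<noteq> 0 \<or> Q2 \<noteq> 0" using D by auto
  have nzp: "?p1 \<noteq> 0 \<or> ?q1 \<noteq> 0" "?p2 \<noteq> 0 \<or> ?q2 \<noteq> 0" using D' by auto
  obtain f3 g3 where 3: "?p1 = f3 * P1 + g3 * P2" "?q1 = f3 * Q1 + g3 * Q2"
    using saito_criterion[OF b(1,2) c memp(1)] by blast
  obtain f4 g4 where 4: "?p2 = f4 * P1 + g4 * P2" "?q2 = f4 * Q1 + g4 * Q2"
    using saito_criterion[OF b(1,2) c memp(2)] by blast
  have "min e1 e2 \<le> d1" "min e1 e2 \<le> d2" "min d1 d2 \<le> e1" "min d1 d2 \<le> e2"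
    using min_degree[OF b(3,4) nzP(1) hp 1] min_degree[OF b(5,6) nzP(2) hp 2]
      min_degree[OF hp(1,2) nzp(1) b(3-6) 3] min_degree[OF hp(3,4) nzp(2) b(3-6) 4] by blast+
  then have "e1 = d1 \<and> e2 = d2 \<or> e1 = d2 \<and> e2 = d1" using sum by linarith
  then show ?thesis by (auto simp: mult.commute)
qed

end

lemma rank2_arrangement_localization:
  assumes ma: "multiarrangement \<alpha> A m" and H1: "H1 \<in> A" and H2: "H2 \<in> A" and ne: "H1 \<noteq> H2"
  shows "\<exists>u w. rank2_arrangement \<alpha> (localization A (H1 \<inter> H2)) H1 H2 u w"
proof -
  have hyp: "hyperplane (\<alpha> H) = H" "\<alpha> H \<noteq> 0" if "H \<in> A" for H
    using ma that by (auto simp: multiarrangement_def)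
  have "hyperplane (\<alpha> H1) \<noteq> hyperplane (\<alpha> H2)" using hyp H1 H2 ne by simp
  then obtain u w where "\<alpha> H1 \<bullet>\<bullet> u = 1 \<and> \<alpha> H2 \<bullet>\<bullet> u = 0 \<and> \<alpha> H1 \<bullet>\<bullet> w = 0 \<and> \<alpha> H2 \<bullet>\<bullet> w = 1"
    using dual_pair hyp H1 H2 by metis
  then have "rank2_arrangement \<alpha> (localization A (H1 \<inter> H2)) H1 H2 u w"
    unfolding rank2_arrangement_def using ma H1 H2 hyp
    by unfold_locales (auto simp: localization_def inj_on_def multiarrangement_def)
  then show ?thesis by blast
qed

theorem local_exponent_product_bound:
  assumes ma: "multiarrangement \<alpha> A m" and H: "H1 \<in> A" "H2 \<in> A" "H1 \<noteq> H2"
  defines "L \<equiv> localization A (H1 \<inter> H2)"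
  shows "(card L - 1) * ((\<Sum>H\<in>L. m H) - card L + 1) \<le> local_exponent_product \<alpha> A m (H1 \<inter> H2)"
    and "local_exponent_product \<alpha> A m (H1 \<inter> H2) = (card L - 1) * ((\<Sum>H\<in>L. m H) - card L + 1) \<Longrightarrow>
      \<theta> \<in> log_der \<alpha> A (\<lambda>_. 1) \<Longrightarrow>
      \<exists>f. \<forall>H\<in>L. lf (\<alpha> H) ^ m H dvd ap \<theta> (\<alpha> H) - f * lf (\<alpha> H)"
proof -
  obtain u w where "rank2_arrangement \<alpha> L H1 H2 u w"
    using rank2_arrangement_localization[OF ma H] unfolding L_def by blast
  then interpret rank2_arrangement \<alpha> L H1 H2 u w .
  have m: "m H \<ge> 1" if "H \<in> L" for H
    using ma that by (auto simp: L_def localization_def multiarrangement_def)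
  obtain d1 d2 P1 Q1 P2 Q2 where good: "good_basis m d1 d2 P1 Q1 P2 Q2"
    using good_basis_exists[of m] by blast
  \<comment> \<open>Existence and uniqueness of the product give the definite description its
    value.\<close>
  have lep: "local_exponent_product \<alpha> A m (H1 \<inter> H2) = d1 * d2"
    unfolding local_exponent_product_def L_def[symmetric]
    using good_basis_exponents[OF good] exponent_product_unique[OF m good]
    by (intro the_equality) blast+
  show "(card L - 1) * ((\<Sum>H\<in>L. m H) - card L + 1) \<le> local_exponent_product \<alpha> A m (H1 \<inter> H2)"
    unfolding lep by (rule exponent_product_ge[OF m good])
  assume eq: "local_exponent_product \<alpha> A m (H1 \<inter> H2) = (card L - 1) * ((\<Sum>H\<in>L. m H) - card L + 1)"
    and \<theta>: "\<theta> \<in> log_der \<alpha> A (\<lambda>_. 1)"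
  have "\<theta> \<in> log_der \<alpha> L (\<lambda>_. 1)" using \<theta> by (auto simp: log_der_iff L_def localization_def)
  then have "mem (\<lambda>_. 1) (ap \<theta> (\<alpha> H1)) (ap \<theta> (\<alpha> H2))" by (simp only: log_der_mem)
  from extremal_split[OF m good eq[unfolded lep] this]
  obtain f where f: "mem m (ap \<theta> (\<alpha> H1) - f * lf (\<alpha> H1)) (ap \<theta> (\<alpha> H2) - f * lf (\<alpha> H2))"
    by blast
  have "lf (\<alpha> H) ^ m H dvd ap \<theta> (\<alpha> H) - f * lf (\<alpha> H)" if "H \<in> L" for H
    using f that by (simp add: mem_def ev_simps ap_ev[symmetric] form_eq[symmetric])
  then show "\<exists>f. \<forall>H\<in>L. lf (\<alpha> H) ^ m H dvd ap \<theta> (\<alpha> H) - f * lf (\<alpha> H)" by blast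
qed

section \<open>The second Betti number and the global splitting\<close>

locale arrangement =
  fixes \<alpha> :: "('k::field ^ 'n::finite) set \<Rightarrow> 'k ^ 'n" and A :: "('k ^ 'n) set set"
    and m :: "('k ^ 'n) set \<Rightarrow> nat"
  assumes ma: "multiarrangement \<alpha> A m"
begin

lemma fin: "finite A"
  and hyp: "H \<in> A \<Longrightarrow> hyperplane (\<alpha> H) = H"
  and nz: "H \<in> A \<Longrightarrow> \<alpha> H \<noteq> 0"
  and m1: "H \<in> A \<Longrightarrow> m H \<ge> 1"
  using ma by (auto simp: multiarrangement_def)

lemma sub: "H \<in> A \<Longrightarrow> vec.subspace H"
  using subspace_hyperplane[of "\<alpha> H"] hyp by simp

lemma dimH: "H \<in> A \<Longrightarrow> CARD('n) = Suc (vec.dim H)"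
  using dim_hyperplane[OF nz] hyp by simp

lemma dimHK: "H \<in> A \<Longrightarrow> K \<in> A \<Longrightarrow> H \<noteq> K \<Longrightarrow> CARD('n) = vec.dim (H \<inter> K) + 2"
  using dim_hyperplane_inter[OF nz nz] hyp by simp

lemma subsetH: "H \<in> A \<Longrightarrow> K \<in> A \<Longrightarrow> H \<subseteq> K \<Longrightarrow> H = K"
  using hyperplane_subset_imp_eq[OF nz nz] hyp by simp

lemma H_not_UNIV: "H \<in> A \<Longrightarrow> H \<noteq> UNIV"
  using dimH vec_dim_card[where ?'a = 'k and ?'n = 'n] by fastforce

lemma sub_Inter: "B \<subseteq> A \<Longrightarrow> vec.subspace (\<Inter>B)"
  using sub by (intro vec.subspace_Inter) blast

text \<open>Two distinct hyperplanes already meet in codimension two, so a flat of that codimension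
  equals the intersection of any two of the members that define it.\<close>

lemma codim2_iff:
  "X \<in> int_lattice_codim2 A \<longleftrightarrow> (\<exists>H\<in>A. \<exists>K\<in>A. H \<noteq> K \<and> X = H \<inter> K)"
proof
  assume "X \<in> int_lattice_codim2 A"
  then obtain B where B: "B \<subseteq> A" "X = \<Inter>B" "vec.dim X + 2 = CARD('n)"
    by (auto simp: int_lattice_codim2_def int_lattice_def)
  have "B \<noteq> {}" using B vec_dim_card[where ?'a = 'k and ?'n = 'n] by auto
  then obtain H where H: "H \<in> B" by blast
  have "B \<noteq> {H}" using B dimH[of H] by auto
  then obtain K where K: "K \<in> B" "K \<noteq> H" using H by blast
  have "X = H \<inter> K"
  proof (rule vec.subspace_dim_equal)
    have "H \<in> A" "K \<in> A" "H \<noteq> K" using B H K by auto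
    then have "CARD('n) = vec.dim (H \<inter> K) + 2" by (rule dimHK)
    then show "vec.dim (H \<inter> K) \<le> vec.dim X" using B by simp
    show "X \<subseteq> H \<inter> K" using B H K by auto
    show "vec.subspace X" using sub_Inter B by simp
    show "vec.subspace (H \<inter> K)" using sub B H K by (intro vec.subspace_inter) auto
  qed
  then show "\<exists>H\<in>A. \<exists>K\<in>A. H \<noteq> K \<and> X = H \<inter> K" using B H K by blast
next
  assume "\<exists>H\<in>A. \<exists>K\<in>A. H \<noteq> K \<and> X = H \<inter> K"
  then obtain H K where HK: "H \<in> A" "K \<in> A" "H \<noteq> K" "X = H \<inter> K" by blast
  then have "X = \<Inter>{H, K}" "{H, K} \<subseteq> A" by auto
  then have "X \<in> int_lattice A" unfolding int_lattice_def by blast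
  then show "X \<in> int_lattice_codim2 A" using dimHK HK by (simp add: int_lattice_codim2_def)
qed

lemma codim2_eq_inter:
  assumes "X \<in> int_lattice_codim2 A" "H \<in> A" "K \<in> A" "H \<noteq> K" "X \<subseteq> H" "X \<subseteq> K"
  shows "X = H \<inter> K"
proof (rule vec.subspace_dim_equal)
  obtain B where "B \<subseteq> A" "X = \<Inter>B"
    using assms(1) by (auto simp: int_lattice_codim2_def int_lattice_def)
  then show "vec.subspace X" using sub_Inter by simp
  show "vec.dim (H \<inter> K) \<le> vec.dim X"
    using assms(1) dimHK[OF assms(2-4)] by (simp add: int_lattice_codim2_def)
  show "vec.subspace (H \<inter> K)" using sub assms by (intro vec.subspace_inter) auto
qed (use assms in auto)

lemma UNIV_in_lattice: "UNIV \<in> int_lattice A"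
  unfolding int_lattice_def by (auto intro!: exI[of _ "{}"])

lemma H_in_lattice: "H \<in> A \<Longrightarrow> H \<in> int_lattice A"
  unfolding int_lattice_def by (auto intro!: exI[of _ "{H}"])

lemma moebius_UNIV: "moebius A UNIV = 1"
  using fin UNIV_in_lattice by (subst moebius.simps) simp

lemma moebius_hyperplane:
  assumes "H \<in> A" shows "moebius A H = - 1"
proof -
  have "{Y \<in> int_lattice A. H \<subset> Y} = {UNIV}"
  proof (intro set_eqI iffI)
    fix Y assume "Y \<in> {Y \<in> int_lattice A. H \<subset> Y}"
    then obtain B where B: "B \<subseteq> A" "Y = \<Inter>B" "H \<subset> Y" by (auto simp: int_lattice_def)
    have "B = {}"
    proof (rule ccontr)
      assume "B \<noteq> {}"
      then obtain K where K: "K \<in> B" by blast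
      then have "H = K" using B assms by (intro subsetH) auto
      then show False using B K by auto
    qed
    then show "Y \<in> {UNIV}" using B by simp
  next
    fix Y :: "('k ^ 'n) set" assume "Y \<in> {UNIV}"
    then show "Y \<in> {Y \<in> int_lattice A. H \<subset> Y}"
      using UNIV_in_lattice H_not_UNIV[OF assms] by auto
  qed
  then show ?thesis
    using fin H_in_lattice[OF assms] H_not_UNIV[OF assms] moebius_UNIV by (subst moebius.simps) simp
qed

lemma finite_localization: "finite (localization A X)"
  using fin by (simp add: localization_def)

text \<open>Only the whole space and the hyperplanes through \<open>X\<close> lie strictly above
  \<open>X\<close>, since two distinct ones meet in \<open>X\<close> itself.\<close>

lemma moebius_codim2:
  assumes X: "X \<in> int_lattice_codim2 A" shows "moebius A X = int (card (localization A X)) - 1"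
proof -
  have XL: "X \<in> int_lattice A" using X by (simp add: int_lattice_codim2_def)
  have dX: "vec.dim X + 2 = CARD('n)" using X by (simp add: int_lattice_codim2_def)
  have X_UNIV: "X \<noteq> UNIV" using dX vec_dim_card[where ?'a = 'k and ?'n = 'n] by auto
  have X_H: "X \<noteq> H" if "H \<in> A" for H using dX dimH[OF that] by auto
  have "{Y \<in> int_lattice A. X \<subset> Y} = insert UNIV (localization A X)"
  proof (intro set_eqI iffI)
    fix Y assume "Y \<in> {Y \<in> int_lattice A. X \<subset> Y}"
    then obtain B where B: "B \<subseteq> A" "Y = \<Inter>B" "X \<subset> Y" by (auto simp: int_lattice_def)
    show "Y \<in> insert UNIV (localization A X)"
    proof (cases "B = {}")
      case False
      then obtain H where H: "H \<in> B" by blast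
      have "K = H" if K: "K \<in> B" for K
      proof (rule ccontr)
        assume "K \<noteq> H"
        then have "X = K \<inter> H" using B H K by (intro codim2_eq_inter[OF X]) auto
        then show False using B H K by auto
      qed
      then have "B = {H}" using H by blast
      then show ?thesis using B by (auto simp: localization_def)
    qed (use B in simp)
  next
    fix Y assume "Y \<in> insert UNIV (localization A X)"
    then show "Y \<in> {Y \<in> int_lattice A. X \<subset> Y}"
      using UNIV_in_lattice H_in_lattice X_UNIV X_H by (auto simp: localization_def)
  qed
  moreover have "UNIV \<notin> localization A X" using H_not_UNIV by (auto simp: localization_def)
  moreover have "(\<Sum>H\<in>localization A X. moebius A H) = - int (card (localization A X))"
    by (subst sum.cong[OF refl, of _ _ "\<lambda>_. - 1"]) (auto simp: localization_def moebius_hyperplane)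
  ultimately show ?thesis
    using fin XL X_UNIV moebius_UNIV finite_localization by (subst moebius.simps) simp
qed

lemma finite_codim2: "finite (int_lattice_codim2 A)"
  using finite_int_lattice[OF fin] by (simp add: int_lattice_codim2_def)

lemma betti_2: "betti 2 A = (\<Sum>X\<in>int_lattice_codim2 A. int (card (localization A X)) - 1)"
proof (cases "2 \<le> CARD('n)")
  case True
  have "betti 2 A = (\<Sum>X\<in>int_lattice A. if vec.dim X = CARD('n) - 2 then moebius A X else 0)"
    using True by (simp add: betti_def char_poly_def coeff_sum)
  also have "\<dots> = (\<Sum>X\<in>{X \<in> int_lattice A. vec.dim X = CARD('n) - 2}. moebius A X)"
    using finite_int_lattice[OF fin] by (simp add: sum.inter_filter)
  also have "{X \<in> int_lattice A. vec.dim X = CARD('n) - 2} = int_lattice_codim2 A"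
    using True by (auto simp: int_lattice_codim2_def)
  finally show ?thesis by (simp add: moebius_codim2 cong: sum.cong)
next
  \<comment> \<open>Below dimension two \<open>betti\<close> is zero by convention, and no flat of
    codimension two exists.\<close>
  case False
  then have "int_lattice_codim2 A = {}" by (auto simp: int_lattice_codim2_def)
  with False show ?thesis by (simp add: betti_def)
qed

lemma sum_off_diagonal:
  fixes k :: "'b \<Rightarrow> int"
  assumes "finite L"
  shows "(\<Sum>(H, K)\<in>{(H, K). H \<in> L \<and> K \<in> L \<and> H \<noteq> K}. k H) = (\<Sum>H\<in>L. k H) * (int (card L) - 1)"
proof -
  have "{(H, K). H \<in> L \<and> K \<in> L \<and> H \<noteq> K} = (SIGMA H:L. L - {H})" by auto
  then have "(\<Sum>(H, K)\<in>{(H, K). H \<in> L \<and> K \<in> L \<and> H \<noteq> K}. k H) = (\<Sum>H\<in>L. \<Sum>K\<in>L - {H}. k H)"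
    using sum.Sigma[of L "\<lambda>H. L - {H}" "\<lambda>H K. k H"] assms by simp
  also have "\<dots> = (\<Sum>H\<in>L. k H * (int (card L) - 1))"
  proof (rule sum.cong[OF refl])
    fix H assume H: "H \<in> L"
    then have "card L \<ge> 1" using assms by (metis One_nat_def Suc_leI card_gt_0_iff empty_iff)
    then show "(\<Sum>K\<in>L - {H}. k H) = k H * (int (card L) - 1)"
      using H assms by (simp add: of_nat_diff mult.commute)
  qed
  finally show ?thesis by (simp add: sum_distrib_right)
qed

text \<open>Double counting: every ordered pair of distinct hyperplanes meets in exactly one flat of
  codimension two. With \<open>k H = m H - 1\<close> this distributes the excess (|m| - |A|)(|A| -
  1) over the flats.\<close>

lemma sum_pairs:
  fixes k :: "('k ^ 'n) set \<Rightarrow> int"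
  shows "(\<Sum>H\<in>A. k H) * (int (card A) - 1) =
    (\<Sum>X\<in>int_lattice_codim2 A. (\<Sum>H\<in>localization A X. k H) * (int (card (localization A X)) - 1))"
proof -
  let ?P = "{(H, K). H \<in> A \<and> K \<in> A \<and> H \<noteq> K}"
  have finP: "finite ?P" by (rule finite_subset[of _ "A \<times> A"]) (use fin in auto)
  have "(\<Sum>H\<in>A. k H) * (int (card A) - 1) = (\<Sum>(H, K)\<in>?P. k H)"
    using sum_off_diagonal[OF fin] by simp
  also have "\<dots> = (\<Sum>X\<in>int_lattice_codim2 A. \<Sum>(H, K)\<in>{p \<in> ?P. (\<lambda>(H, K). H \<inter> K) p = X}. k H)"
    using codim2_iff by (intro sum.group[symmetric] finP finite_codim2) blast
  also have "\<dots> = (\<Sum>X\<in>int_lattice_codim2 A. (\<Sum>H\<in>localization A X. k H) * (int (card (localization A X)) - 1))"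
  proof (rule sum.cong[OF refl])
    fix X assume X: "X \<in> int_lattice_codim2 A"
    have "{p \<in> ?P. (\<lambda>(H, K). H \<inter> K) p = X} =
        {(H, K). H \<in> localization A X \<and> K \<in> localization A X \<and> H \<noteq> K}"
      using codim2_eq_inter[OF X] by (auto simp: localization_def)
    then show "(\<Sum>(H, K)\<in>{p \<in> ?P. (\<lambda>(H, K). H \<inter> K) p = X}. k H) =
        (\<Sum>H\<in>localization A X. k H) * (int (card (localization A X)) - 1)"
      using sum_off_diagonal[OF finite_localization] by simp
  qed
  finally show ?thesis .
qed

lemma card_le_sum_m:
  assumes "L \<subseteq> A" shows "card L \<le> (\<Sum>H\<in>L. m H)"
proof -
  have "(\<Sum>H\<in>L. 1) \<le> (\<Sum>H\<in>L. m H)"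
  proof (rule sum_mono)
    fix H assume "H \<in> L"
    with assms show "1 \<le> m H" by (intro m1) (rule subsetD)
  qed
  then show ?thesis by simp
qed

lemma betti_equality_local:
  assumes eq: "int (multi_betti2 \<alpha> A m) =
           betti 2 A + (int (\<Sum>H\<in>A. m H) - int (card A)) * (int (card A) - 1)"
    and X: "X \<in> int_lattice_codim2 A"
  shows "local_exponent_product \<alpha> A m X =
    (card (localization A X) - 1) * ((\<Sum>H\<in>localization A X. m H) - card (localization A X) + 1)"
proof -
  let ?L = "localization A"
  let ?b = "\<lambda>X. (card (?L X) - 1) * ((\<Sum>H\<in>?L X. m H) - card (?L X) + 1)"
  have bound: "?b X \<le> local_exponent_product \<alpha> A m X" if X: "X \<in> int_lattice_codim2 A" for X
  proof -
    obtain H K where HK: "H \<in> A" "K \<in> A" "H \<noteq> K" "X = H \<inter> K"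
      using X unfolding codim2_iff by blast
    show ?thesis unfolding HK(4) by (rule local_exponent_product_bound(1)[OF ma HK(1-3)])
  qed
  \<comment> \<open>The first summand is the Moebius value that enters \<open>betti 2 A\<close>, the
    second one the share of \<open>X\<close> in the pair count. Since |A_X| is positive and at most
    |m_X|, the truncated differences are genuine.\<close>
  have b_int: "int (?b X) = (int (card (?L X)) - 1) + (\<Sum>H\<in>?L X. int (m H) - 1) * (int (card (?L X)) - 1)"
    if X: "X \<in> int_lattice_codim2 A" for X
  proof -
    have LA: "?L X \<subseteq> A" by (auto simp: localization_def)
    obtain H K where "H \<in> A" "X = H \<inter> K" using X unfolding codim2_iff by blast
    then have "H \<in> ?L X" by (simp add: localization_def)
    then have "?L X \<noteq> {}" by blast
    then have c: "1 \<le> card (?L X)" using finite_localization by (simp add: Suc_le_eq card_gt_0_iff)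
    have "int (?b X) = int (card (?L X) - 1) * int ((\<Sum>H\<in>?L X. m H) - card (?L X) + 1)"
      by (rule of_nat_mult)
    also have "int (card (?L X) - 1) = int (card (?L X)) - 1" using c by (simp add: of_nat_diff)
    also have "int ((\<Sum>H\<in>?L X. m H) - card (?L X) + 1) = (\<Sum>H\<in>?L X. int (m H)) - int (card (?L X)) + 1"
      using card_le_sum_m[OF LA] by (simp add: of_nat_diff)
    finally have "int (?b X) = (int (card (?L X)) - 1) * ((\<Sum>H\<in>?L X. int (m H)) - int (card (?L X)) + 1)" .
    then show ?thesis by (simp add: sum_subtractf algebra_simps)
  qed
  have "int (\<Sum>X\<in>int_lattice_codim2 A. ?b X) =
      (\<Sum>X\<in>int_lattice_codim2 A. (int (card (?L X)) - 1) + (\<Sum>H\<in>?L X. int (m H) - 1) * (int (card (?L X)) - 1))"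
    unfolding of_nat_sum by (rule sum.cong[OF refl b_int])
  also have "\<dots> = betti 2 A + (\<Sum>H\<in>A. int (m H) - 1) * (int (card A) - 1)"
    by (simp add: sum.distrib betti_2 sum_pairs)
  also have "\<dots> = int (multi_betti2 \<alpha> A m)" by (simp add: eq sum_subtractf)
  finally have "(\<Sum>X\<in>int_lattice_codim2 A. ?b X) = (\<Sum>X\<in>int_lattice_codim2 A. local_exponent_product \<alpha> A m X)"
    unfolding multi_betti2_def of_nat_eq_iff .
  from sum_mono_inv[OF this bound X finite_codim2] show ?thesis by simp
qed

theorem log_der_split:
  assumes eq: "int (multi_betti2 \<alpha> A m) =
           betti 2 A + (int (\<Sum>H\<in>A. m H) - int (card A)) * (int (card A) - 1)"
    and \<theta>: "\<theta> \<in> log_der \<alpha> A (\<lambda>_. 1)"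
  shows "\<exists>f. \<theta> - f *s euler \<in> log_der \<alpha> A m"
proof -
  have "\<exists>g. ap \<theta> (\<alpha> H) = lf (\<alpha> H) * g" if "H \<in> A" for H
    using \<theta> that by (auto simp: log_der_iff dvd_def)
  then obtain g where g: "\<And>H. H \<in> A \<Longrightarrow> ap \<theta> (\<alpha> H) = lf (\<alpha> H) * g H" by metis
  \<comment> \<open>Both sides of the divisibility carry one common factor
    \<open>lf (\<alpha> H)\<close>; cancelling it lowers the exponent to
    \<open>m H - 1\<close>.\<close>
  have pow: "lf (\<alpha> H) ^ m H dvd ap \<theta> (\<alpha> H) - f * lf (\<alpha> H) \<longleftrightarrow>
      lf (\<alpha> H) ^ (m H - 1) dvd f - g H" if H: "H \<in> A" for H f
  proof -
    have "ap \<theta> (\<alpha> H) - f * lf (\<alpha> H) = lf (\<alpha> H) * (g H - f)"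
      by (simp add: g[OF H] algebra_simps)
    moreover have "lf (\<alpha> H) ^ m H = lf (\<alpha> H) * lf (\<alpha> H) ^ (m H - 1)"
      using m1[OF H] by (simp flip: power_Suc)
    ultimately have "lf (\<alpha> H) ^ m H dvd ap \<theta> (\<alpha> H) - f * lf (\<alpha> H) \<longleftrightarrow>
        lf (\<alpha> H) ^ (m H - 1) dvd g H - f"
      using nz[OF H] by (simp add: mpoly_dvd_mult_cancel linear_form_eq_0_iff)
    also have "\<dots> \<longleftrightarrow> lf (\<alpha> H) ^ (m H - 1) dvd f - g H" 
      using dvd_minus_iff[of _ "g H - f"] by simp
    finally show ?thesis .
  qed
  have "\<exists>f. \<forall>H\<in>A. lf (\<alpha> H) ^ (m H - 1) dvd f - g H"
  proof (rule codim2_chinese_remainder[OF fin nz])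
    show "inj_on (\<lambda>H. hyperplane (\<alpha> H)) A" by (auto simp: inj_on_def hyp)
    fix H K assume HK: "H \<in> A" "K \<in> A" "H \<noteq> K"
    then have "H \<inter> K \<in> int_lattice_codim2 A" using codim2_iff by blast
    from local_exponent_product_bound(2)[OF ma HK betti_equality_local[OF eq this] \<theta>]
    obtain f where f: "\<And>L. L \<in> localization A (H \<inter> K) \<Longrightarrow>
        lf (\<alpha> L) ^ m L dvd ap \<theta> (\<alpha> L) - f * lf (\<alpha> L)" by blast
    show "\<exists>f. \<forall>L\<in>A. hyperplane (\<alpha> H) \<inter> hyperplane (\<alpha> K) \<subseteq> hyperplane (\<alpha> L) \<longrightarrow>
        lf (\<alpha> L) ^ (m L - 1) dvd f - g L"
    proof (intro exI ballI impI)
      fix L assume L: "L \<in> A" "hyperplane (\<alpha> H) \<inter> hyperplane (\<alpha> K) \<subseteq> hyperplane (\<alpha> L)"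
      then have "L \<in> localization A (H \<inter> K)" using HK by (simp add: hyp localization_def)
      from f[OF this] show "lf (\<alpha> L) ^ (m L - 1) dvd f - g L" by (simp only: pow[OF L(1)])
    qed
  qed
  then obtain f where f: "\<And>H. H \<in> A \<Longrightarrow> lf (\<alpha> H) ^ (m H - 1) dvd f - g H" by blast
  have "\<theta> - f *s euler \<in> log_der \<alpha> A m"
    unfolding log_der_iff ap_simps ap_euler using f pow by blast
  then show ?thesis ..
qed

end

section \<open>Submodules of free modules are finitely generated\<close>

text \<open>A decreasing sequence of natural numbers is constant from the point on where it attains
  its minimum.\<close>

lemma nat_seq_mono_subseq: "\<exists>\<phi>. strict_mono (\<phi> :: nat \<Rightarrow> nat) \<and> mono (\<lambda>k. (x :: nat \<Rightarrow> nat) (\<phi> k))"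
proof -
  obtain \<phi> where \<phi>: "strict_mono \<phi>" "monoseq (\<lambda>k. x (\<phi> k))" using seq_monosub by blast
  then consider "\<forall>m. \<forall>n\<ge>m. x (\<phi> m) \<le> x (\<phi> n)" | "\<forall>m. \<forall>n\<ge>m. x (\<phi> n) \<le> x (\<phi> m)"
    unfolding monoseq_def by blast
  then show ?thesis
  proof cases
    case 1 then show ?thesis using \<phi>(1) by (auto simp: mono_def)
  next
    case 2
    obtain N where N: "\<And>k. x (\<phi> N) \<le> x (\<phi> k)"
      using ex_has_least_nat[of "\<lambda>_. True" 0 "\<lambda>k. x (\<phi> k)"] by auto
    have const: "x (\<phi> (N + k)) = x (\<phi> N)" for k using 2 N[of "N + k"] by (simp add: order_antisym)
    have "strict_mono (\<lambda>k. \<phi> (N + k))" using \<phi>(1) by (simp add: strict_mono_def)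
    moreover have "mono (\<lambda>k. x (\<phi> (N + k)))" by (simp add: const mono_def)
    ultimately show ?thesis by blast
  qed
qed

text \<open>Dickson's lemma for sequences: the sequence is thinned out once for each coordinate, and
  thinning preserves what the earlier coordinates have gained.\<close>

lemma dickson:
  assumes "finite J"
  shows "\<exists>\<phi>. strict_mono (\<phi> :: nat \<Rightarrow> nat) \<and> (\<forall>j\<in>J. mono (\<lambda>k. (x :: 'j \<Rightarrow> nat \<Rightarrow> nat) j (\<phi> k)))"
  using assms
proof (induction J rule: finite_induct)
  case empty show ?case by (auto intro!: exI[of _ "\<lambda>k. k"] simp: strict_mono_def)
next
  case (insert i J)
  then obtain \<phi> :: "nat \<Rightarrow> nat" where \<phi>: "strict_mono \<phi>" "\<And>j. j \<in> J \<Longrightarrow> mono (\<lambda>k. x j (\<phi> k))" by blast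
  obtain \<psi> :: "nat \<Rightarrow> nat" where \<psi>: "strict_mono \<psi>" "mono (\<lambda>k. x i (\<phi> (\<psi> k)))"
    using nat_seq_mono_subseq[of "\<lambda>k. x i (\<phi> k)"] by blast
  have "strict_mono (\<lambda>k. \<phi> (\<psi> k))" using \<phi>(1) \<psi>(1) by (simp add: strict_mono_def)
  moreover have "mono (\<lambda>k. x j (\<phi> (\<psi> k)))" if "j \<in> J" for j
    using \<phi>(2)[OF that] strict_mono_mono[OF \<psi>(1)] by (simp add: mono_def)
  ultimately show ?case using \<psi>(2) by (intro exI[of _ "\<lambda>k. \<phi> (\<psi> k)"]) auto
qed

section \<open>A monomial order on the free module\<close>

definition support :: "('n::finite, 'k::field) der \<Rightarrow> (('n \<Rightarrow>\<^sub>0 nat) \<times> 'n) set" where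
  "support \<theta> = {(t, i). look (\<theta> $ i) t \<noteq> 0}"

lemma finite_support: "finite (support \<theta>)"
proof -
  have "support \<theta> \<subseteq> (\<Union>i. keys (\<theta> $ i)) \<times> UNIV"
    by (auto simp: support_def in_keys_iff)
  then show ?thesis by (rule finite_subset) simp
qed

lemma support_empty_iff: "support \<theta> = {} \<longleftrightarrow> \<theta> = 0"
  by (auto simp: support_def vec_eq_iff poly_mapping_eq_iff fun_eq_iff)

definition all_indices :: "'n::finite list" where
  "all_indices = (SOME xs. set xs = UNIV \<and> distinct xs)"

lemma set_all_indices: "set all_indices = UNIV"
  unfolding all_indices_def by (rule someI_ex[OF finite_distinct_list[OF finite[of UNIV]], THEN conjunct1])

text \<open>Monomials of the free module are compared lexicographically, first by their exponents and
  then by their position.\<close>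

definition key :: "('n::finite \<Rightarrow>\<^sub>0 nat) \<times> 'n \<Rightarrow> nat list" where
  "key p = map (look (fst p)) all_indices @ map (\<lambda>j. if j = snd p then 1 else 0) all_indices"

lemma inj_key: "key p = key q \<Longrightarrow> p = q"
proof -
  assume "key p = key q"
  then have "map (look (fst p)) all_indices = map (look (fst q)) all_indices"
    "map (\<lambda>j. if j = snd p then 1 else 0 :: nat) all_indices = map (\<lambda>j. if j = snd q then 1 else 0) all_indices"
    by (simp_all add: key_def)
  then have *: "\<forall>j\<in>UNIV. look (fst p) j = look (fst q) j"
    "\<forall>j\<in>UNIV. (if j = snd p then 1 else 0 :: nat) = (if j = snd q then 1 else 0)"
    unfolding map_eq_conv set_all_indices .
  have "fst p = fst q" using *(1) by (intro poly_mapping_eqI) blast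
  moreover have "snd p = snd q" using *(2)[rule_format, of "snd p"] by (simp split: if_splits)
  ultimately show "p = q" by (simp add: prod_eq_iff)
qed

text \<open>All keys have the same length, so \<open>lenlex\<close> is the lexicographic order on
  them, in a form known to be well-founded.\<close>

definition key_less :: "('n::finite \<Rightarrow>\<^sub>0 nat) \<times> 'n \<Rightarrow> ('n \<Rightarrow>\<^sub>0 nat) \<times> 'n \<Rightarrow> bool" where
  "key_less p q \<longleftrightarrow> (key p, key q) \<in> lenlex less_than"

lemma key_less_linear: "p \<noteq> q \<Longrightarrow> key_less p q \<or> key_less q p"
proof -
  assume "p \<noteq> q"
  then have "key p \<noteq> key q" using inj_key by blast
  moreover have "total (lenlex (less_than :: (nat \<times> nat) set))"
    by (rule total_lenlex) (auto simp: total_on_def)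
  ultimately show ?thesis unfolding key_less_def total_on_def by blast
qed

lemma key_less_trans: "key_less p q \<Longrightarrow> key_less q r \<Longrightarrow> key_less p r"
  using lenlex_trans[OF _ _ trans_less_than] by (auto simp: key_less_def)

lemma wf_key_less: "wf {(p :: ('n::finite \<Rightarrow>\<^sub>0 nat) \<times> 'n, q). key_less p q}"
proof -
  have "{(p :: ('n \<Rightarrow>\<^sub>0 nat) \<times> 'n, q). key_less p q} = inv_image (lenlex less_than) key"
    by (auto simp: key_less_def inv_image_def)
  then show ?thesis by (simp add: wf_lenlex)
qed

lemma lex_map_add:
  assumes "(xs, ys) \<in> lex less_than" "length zs = length xs"
  shows "(map2 (+) zs xs, map2 (+) zs ys) \<in> lex (less_than :: (nat \<times> nat) set)"
  using assms
proof (induction xs arbitrary: ys zs)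
  case (Cons x xs)
  then obtain y ys' where "ys = y # ys'" by (cases ys) auto
  moreover obtain z zs' where "zs = z # zs'" using Cons.prems by (cases zs) auto
  ultimately show ?case using Cons by (auto simp: Cons_in_lex)
qed simp

text \<open>Multiplication by a monomial adds a fixed list to the key, with zeros in the part that
  encodes the position, and lexicographic comparison is invariant under such a translation.\<close>

lemma key_less_shift:
  fixes s t t' :: "'n::finite \<Rightarrow>\<^sub>0 nat"
  assumes "key_less (t, i) (t', i')" shows "key_less (s + t, i) (s + t', i')"
proof -
  let ?l = "all_indices :: 'n list"
  let ?z = "map (look s) ?l @ map (\<lambda>_. 0) ?l"
  have k: "key (s + t, i) = map2 (+) ?z (key (t, i))" for t i
    by (rule nth_equalityI) (auto simp: key_def nth_append lookup_add)
  have "length (key (t, i)) = length (key (t', i'))" "length ?z = length (key (t, i))"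
    by (simp_all add: key_def)
  then show ?thesis
    using assms lex_map_add[of "key (t, i)" "key (t', i')" ?z] by (simp add: key_less_def k lenlex_conv)
qed

definition lead :: "('n::finite, 'k::field) der \<Rightarrow> ('n \<Rightarrow>\<^sub>0 nat) \<times> 'n" where
  "lead \<theta> = (SOME p. p \<in> support \<theta> \<and> (\<forall>q\<in>support \<theta>. q \<noteq> p \<longrightarrow> key_less q p))"

lemma lead:
  assumes "\<theta> \<noteq> 0"
  shows "lead \<theta> \<in> support \<theta>" "q \<in> support \<theta> \<Longrightarrow> q \<noteq> lead \<theta> \<Longrightarrow> key_less q (lead \<theta>)"
proof -
  have max: "\<exists>p\<in>P. \<forall>q\<in>P. q \<noteq> p \<longrightarrow> key_less q p" if "finite P" "P \<noteq> {}" for P :: "(('a \<Rightarrow>\<^sub>0 nat) \<times> 'a) set"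
    using that
  proof (induction P rule: finite_ne_induct)
    case (insert x P)
    then obtain p where p: "p \<in> P" "\<And>q. q \<in> P \<Longrightarrow> q \<noteq> p \<Longrightarrow> key_less q p" by blast
    have "x \<noteq> p" using p(1) insert.hyps by blast
    show ?case
    proof (cases "key_less x p")
      case True
      then show ?thesis using p by (intro bexI[of _ p]) auto
    next
      case False
      then have "key_less p x" using key_less_linear[OF \<open>x \<noteq> p\<close>] by blast
      then have "key_less q x" if "q \<in> P" for q
        using p(2)[OF that] key_less_trans[of q p x] by (cases "q = p") auto
      then show ?thesis by (intro bexI[of _ x]) auto
    qed
  qed simp
  have "\<exists>p. p \<in> support \<theta> \<and> (\<forall>q\<in>support \<theta>. q \<noteq> p \<longrightarrow> key_less q p)"
    using max[OF finite_support, of \<theta>] assms by (auto simp: support_empty_iff)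
  from someI_ex[OF this, folded lead_def]
  show "lead \<theta> \<in> support \<theta>" "q \<in> support \<theta> \<Longrightarrow> q \<noteq> lead \<theta> \<Longrightarrow> key_less q (lead \<theta>)" by blast+
qed

lemma lookup_single_mult:
  fixes s :: "'n \<Rightarrow>\<^sub>0 nat"
  shows "look (single s c * g) (s + t) = c * (look g t :: 'k::field)"
proof -
  have "single s c * g = (\<Sum>u\<in>keys g. single (s + u) (c * look g u))"
    by (subst mpoly_expand[of g]) (simp add: sum_distrib_left mult_single)
  then show ?thesis by (simp add: lookup_sum lookup_single when_def in_keys_iff)
qed

text \<open>An element of minimal leading exponent outside the span of its predecessors cannot have
  a leading exponent divisible by that of a predecessor, contradicting Dickson's lemma.\<close>

theorem subspace_finitely_generated:
  fixes M :: "('n::finite, 'k::field) der set"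
  assumes M: "der.subspace M"
  shows "\<exists>G. finite G \<and> der.span G = M"
proof (rule ccontr)
  assume contra: "\<nexists>G. finite G \<and> der.span G = M"
  define P where "P f x r \<longleftrightarrow> r \<in> M - der.span (f ` {..<x}) \<and>
      (\<forall>\<theta>\<in>M - der.span (f ` {..<x}). \<not> key_less (lead \<theta>) (lead r))"
    for f :: "nat \<Rightarrow> ('n, 'k) der" and x :: nat and r
  have "\<exists>f. \<forall>x. P f x (f x)"
  proof (rule dependent_wellorder_choice)
    fix r and f g :: "nat \<Rightarrow> ('n, 'k) der" and x :: nat
    assume "\<And>y. y < x \<Longrightarrow> f y = g y"
    then have "f ` {..<x} = g ` {..<x}" by auto
    then show "P f x r = P g x r" by (simp add: P_def)
  next
    fix x :: nat and f assume f: "\<And>y. y < x \<Longrightarrow> P f y (f y)"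
    then have "f ` {..<x} \<subseteq> M" by (auto simp: P_def)
    then have "der.span (f ` {..<x}) \<subseteq> M" using M by (rule der.span_minimal)
    moreover have "der.span (f ` {..<x}) \<noteq> M" using contra by blast
    ultimately obtain \<theta> where \<theta>: "\<theta> \<in> M - der.span (f ` {..<x})" by blast
    have "wf (inv_image {(p :: ('n \<Rightarrow>\<^sub>0 nat) \<times> 'n, q). key_less p q} lead)" by (rule wf_inv_image[OF wf_key_less])
    from wfE_min[OF this \<theta>] show "\<exists>r. P f x r"
      unfolding P_def inv_image_def by (metis (mono_tags, lifting) case_prodI mem_Collect_eq)
  qed
  then obtain f where f: "\<And>x. P f x (f x)" by blast
  have fM: "f x \<in> M" and fspan: "f x \<notin> der.span (f ` {..<x})" for x
    using f[of x] by (simp_all add: P_def)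
  have fmin: "\<not> key_less (lead \<theta>) (lead (f x))" if "\<theta> \<in> M" "\<theta> \<notin> der.span (f ` {..<x})" for x \<theta>
    using f[of x] that by (simp add: P_def)
  have f0: "f x \<noteq> 0" for x using fspan[of x] der.span_zero by metis
  define T where "T x = fst (lead (f x))" for x
  define J where "J x = snd (lead (f x))" for x
  obtain \<phi> :: "nat \<Rightarrow> nat" where \<phi>: "strict_mono \<phi>" "\<And>j. mono (\<lambda>k. look (T (\<phi> k)) j)"
    using dickson[of "UNIV :: 'n set" "\<lambda>j k. look (T k) j"] by auto
  \<comment> \<open>There are finitely many positions, so two members of the subsequence have their
    leading monomials at the same one.\<close>
  have "\<not> inj (\<lambda>k. J (\<phi> k))"
    using finite_imageD[of "\<lambda>k. J (\<phi> k)" UNIV] by auto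
  then obtain p q where pq: "p < q" "J (\<phi> p) = J (\<phi> q)"
    unfolding inj_def by (metis linorder_neqE_nat)
  define a b where "a = \<phi> p" and "b = \<phi> q"
  have ab: "a < b" using \<phi>(1) pq(1) by (simp add: a_def b_def strict_mono_def)
  have Jab: "J a = J b" using pq(2) by (simp add: a_def b_def)
  have le: "look (T a) j \<le> look (T b) j" for j
    using \<phi>(2)[of j] pq(1) by (simp add: a_def b_def mono_def)
  define s where "s = T b - T a"
  have s: "s + T a = T b"
    using le by (intro poly_mapping_eqI) (simp add: s_def lookup_add lookup_minus)
  define ca cb where "ca = look (f a $ J a) (T a)" and "cb = look (f b $ J b) (T b)"
  have "lead (f a) \<in> support (f a)" "lead (f b) \<in> support (f b)" using lead(1) f0 by blast+
  then have ca: "ca \<noteq> 0" by (simp add: support_def ca_def T_def J_def case_prod_beta)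
  let ?mon = "single s (cb / ca) :: ('n, 'k) mpoly"
  \<comment> \<open>The leading terms cancel. As \<open>f a\<close> is one of the predecessors of
    \<open>f b\<close>, the difference remains outside their span and competes with
    \<open>f b\<close> for the least leading monomial.\<close>
  define g where "g = f b - ?mon *s f a"
  have gM: "g \<in> M" unfolding g_def using fM M by (intro der.subspace_diff der.subspace_scale)
  have "f a \<in> der.span (f ` {..<b})" using ab by (intro der.span_base) auto
  then have gspan: "g \<notin> der.span (f ` {..<b})"
    using fspan[of b] der.span_add[of g "f ` {..<b}" "?mon *s f a"] der.span_scale by (auto simp: g_def)
  then have g0: "g \<noteq> 0" using der.span_zero by metis
  obtain t i where ti: "lead g = (t, i)" by fastforce
  have "(t, i) \<in> support g" using lead(1)[OF g0] ti by simp
  then have nz: "look (f b $ i) t - look (?mon * f a $ i) t \<noteq> 0"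
    by (simp add: support_def g_def lookup_minus)
  have leadb: "lead (f b) = (T b, J b)" and leada: "lead (f a) = (T a, J a)" by (simp_all add: T_def J_def)
  have "(t, i) \<noteq> (T b, J b)"
  proof
    assume "(t, i) = (T b, J b)"
    then have "look (?mon * f a $ i) t = cb / ca * ca"
      using lookup_single_mult[of s "cb / ca" "f a $ i" "T a"] by (simp add: s Jab ca_def)
    then show False using nz ca \<open>(t, i) = (T b, J b)\<close> by (simp add: cb_def)
  qed
  moreover have "(t, i) = (T b, J b) \<or> key_less (t, i) (T b, J b)"
  proof (cases "look (f b $ i) t = 0")
    case False
    then have "(t, i) \<in> support (f b)" by (simp add: support_def)
    then show ?thesis using lead(2)[OF f0, of "(t, i)" b] leadb by auto
  next
    case True
    then have "t \<in> keys (?mon * f a $ i)" using nz by (simp add: in_keys_iff)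
    then obtain u where u: "t = s + u" "u \<in> keys (f a $ i)"
      using keys_mult[of ?mon "f a $ i"] by (auto split: if_splits)
    then have "(u, i) \<in> support (f a)" by (simp add: support_def in_keys_iff)
    then have "(u, i) = (T a, J a) \<or> key_less (u, i) (T a, J a)"
      using lead(2)[OF f0, of "(u, i)" a] leada by auto
    then show ?thesis
    proof
      assume "(u, i) = (T a, J a)" then show ?thesis using u(1) s Jab by simp
    next
      assume "key_less (u, i) (T a, J a)"
      from key_less_shift[OF this, of s] show ?thesis using u(1) s Jab by simp
    qed
  qed
  ultimately have "key_less (lead g) (lead (f b))" using ti leadb by auto
  then show False using fmin[OF gM gspan] by blast
qed

section \<open>Minimal generators of free graded modules\<close>

text \<open>Fraction-free Gaussian elimination: the pivot \<open>v r i\<close> clears equation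
  \<open>i\<close> by cross-multiplication, and absence of zero divisors keeps the resulting
  relation nontrivial. It is used over the polynomials as well as over the field.\<close>

lemma linear_relation_exists:
  fixes v :: "'j \<Rightarrow> 'i \<Rightarrow> 'a::comm_ring_1"
  assumes dom: "\<And>a b :: 'a. a * b = 0 \<Longrightarrow> a = 0 \<or> b = 0"
    and "finite I" "finite J" "card I < card J"
  shows "\<exists>c. (\<exists>j\<in>J. c j \<noteq> 0) \<and> (\<forall>i\<in>I. (\<Sum>j\<in>J. c j * v j i) = 0)"
  using assms(2-)
proof (induction I arbitrary: J v rule: finite_induct)
  case empty
  then obtain j where "j \<in> J" by fastforce
  then show ?case by (intro exI[of _ "\<lambda>_. 1"]) auto
next
  case (insert i I)
  show ?case
  proof (cases "\<forall>j\<in>J. v j i = 0")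
    case True
    have "card I < card J" using insert by simp
    from insert.IH[OF insert.prems(1) this, of v] True show ?thesis by auto
  next
    case False
    then obtain r where r: "r \<in> J" "v r i \<noteq> 0" by blast
    let ?J = "J - {r}" and ?w = "\<lambda>j k. v r i * v j k - v j i * v r k"
    have "card I < card ?J" using insert r by simp
    from insert.IH[OF _ this, of ?w] insert.prems(1) obtain c where
      c: "\<exists>j\<in>?J. c j \<noteq> 0" "\<And>k. k \<in> I \<Longrightarrow> (\<Sum>j\<in>?J. c j * ?w j k) = 0" by auto
    \<comment> \<open>The coefficient at the pivot row is the one that makes equation
      \<open>i\<close> hold after scaling the others by \<open>v r i\<close>.\<close>
    define c' where "c' j = (if j = r then - (\<Sum>j\<in>?J. c j * v j i) else c j * v r i)" for j
    have "(\<Sum>j\<in>J. c' j * v j k) = (\<Sum>j\<in>?J. c j * ?w j k)" for k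
    proof -
      have "(\<Sum>j\<in>J. c' j * v j k) = c' r * v r k + (\<Sum>j\<in>?J. c' j * v j k)"
        using insert.prems(1) r(1) by (rule sum.remove)
      also have "(\<Sum>j\<in>?J. c' j * v j k) = (\<Sum>j\<in>?J. c j * v r i * v j k)"
        by (intro sum.cong) (auto simp: c'_def)
      also have "c' r * v r k = - (\<Sum>j\<in>?J. c j * v j i * v r k)"
        by (simp add: c'_def sum_distrib_right)
      finally show ?thesis by (simp add: sum_subtractf algebra_simps)
    qed
    moreover have "(\<Sum>j\<in>?J. c j * ?w j i) = 0" by (intro sum.neutral) (simp add: mult.commute)
    ultimately have "\<forall>k\<in>insert i I. (\<Sum>j\<in>J. c' j * v j k) = 0" using c(2) by auto
    moreover have "\<exists>j\<in>J. c' j \<noteq> 0" using c(1) r(2) dom by (auto simp: c'_def)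
    ultimately show ?thesis by blast
  qed
qed

lemma in_span_finite_iff:
  "finite T \<Longrightarrow> x \<in> der.span T \<longleftrightarrow> (\<exists>c. x = (\<Sum>v\<in>T. c v *s v))"
  by (auto simp: der.span_finite)

lemma span_coefficients:
  assumes "finite T" "W \<subseteq> der.span T"
  obtains a where "\<And>w. w \<in> W \<Longrightarrow> (\<Sum>v\<in>T. a w v *s v) = w"
proof
  fix w assume "w \<in> W"
  then have "\<exists>c. (\<Sum>v\<in>T. c v *s v) = w"
    using assms(2) in_span_finite_iff[OF assms(1), of w] by blast
  from someI_ex[OF this] show "(\<Sum>v\<in>T. (\<lambda>w. SOME c. (\<Sum>v\<in>T. c v *s v) = w) w v *s v) = w" .
qed

lemma independent_card_le:
  fixes W U :: "('n::finite, 'k::field) der set"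
  assumes "finite W" "der.independent W" "finite U" "W \<subseteq> der.span U"
  shows "card W \<le> card U"
proof (rule ccontr)
  assume "\<not> card W \<le> card U"
  then have less: "card U < card W" by simp
  obtain a where a: "\<And>w. w \<in> W \<Longrightarrow> (\<Sum>u\<in>U. a w u *s u) = w"
    using span_coefficients[OF assms(3,4)] by blast
  have dom: "x = 0 \<or> y = 0" if "x * y = 0" for x y :: "('n, 'k) mpoly"
    using that by (simp add: mpoly_mult_eq_0_iff)
  obtain c where c: "\<exists>w\<in>W. c w \<noteq> 0" "\<And>u. u \<in> U \<Longrightarrow> (\<Sum>w\<in>W. c w * a w u) = 0"
    using linear_relation_exists[OF dom assms(3,1) less, of a] by blast
  have "(\<Sum>w\<in>W. c w *s w) = (\<Sum>w\<in>W. \<Sum>u\<in>U. (c w * a w u) *s u)"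
  proof (rule sum.cong[OF refl])
    fix w assume "w \<in> W"
    from arg_cong[where f = "\<lambda>x. c w *s x", OF a[OF this, symmetric]] show "c w *s w = (\<Sum>u\<in>U. (c w * a w u) *s u)" by (simp add: der.scale_sum_right)
  qed
  also have "\<dots> = (\<Sum>u\<in>U. \<Sum>w\<in>W. (c w * a w u) *s u)" by (rule sum.swap)
  also have "\<dots> = 0" by (simp add: c(2) flip: der.scale_sum_left)
  finally show False using der.independentD[OF assms(2,1) subset_refl] c(1) by blast
qed

lemma component_sum_axis:
  fixes f :: "'n::finite \<Rightarrow> 'a::comm_ring_1"
  shows "(\<Sum>i\<in>UNIV. f i *s axis i q) $ j = f j * q"
proof -
  have "(\<Sum>i\<in>UNIV. f i *s axis i q) $ j = (\<Sum>i\<in>UNIV. if i = j then f i * q else 0)"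
    unfolding sum_component by (intro sum.cong) (auto simp: axis_def)
  then show ?thesis by simp
qed

lemma span_axis: "der.span (range (\<lambda>i. axis i 1)) = (UNIV :: ('n::finite, 'k::field) der set)"
proof -
  have "x \<in> der.span (range (\<lambda>i. axis i 1))" for x :: "('n, 'k) der"
  proof -
    have "x = (\<Sum>i\<in>UNIV. x $ i *s axis i 1)" by (simp only: vec_eq_iff component_sum_axis) simp
    moreover have "(\<Sum>i\<in>UNIV. x $ i *s axis i 1) \<in> der.span (range (\<lambda>i. axis i 1))"
      by (intro der.span_sum der.span_scale der.span_base rangeI)
    ultimately show ?thesis by simp
  qed
  then show ?thesis by blast
qed

lemma independent_finite:
  fixes B :: "('n::finite, 'k::field) der set"
  assumes "der.independent B" shows "finite B"
proof -
  have "card C \<le> card (range (\<lambda>i. axis i 1) :: ('n, 'k) der set)" if "finite C" "C \<subseteq> B" for C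
    using that der.independent_mono[OF assms] span_axis by (intro independent_card_le) auto
  then show ?thesis by (meson finite_if_finite_subsets_card_bdd)
qed

lemma independent_card_le_dim:
  fixes B :: "('n::finite, 'k::field) der set"
  assumes "der.independent B" shows "card B \<le> CARD('n)"
proof -
  have "card B \<le> card (range (\<lambda>i. axis i 1) :: ('n, 'k) der set)"
    using assms independent_finite span_axis by (intro independent_card_le) auto
  also have "\<dots> \<le> CARD('n)" by (rule card_image_le) simp
  finally show ?thesis .
qed

text \<open>A logarithmic module need not contain the axes, but it contains their multiples by the
  defining polynomial; these are still independent and thus witness full rank.\<close>

lemma dim_le_card_spanning:
  fixes U :: "('n::finite, 'k::field) der set"
  assumes q: "q \<noteq> 0" and "finite U" and "\<And>i. axis i q \<in> der.span U"
  shows "CARD('n) \<le> card U"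
proof -
  let ?W = "range (\<lambda>i. axis i q) :: ('n, 'k) der set"
  have inj: "inj (\<lambda>i. axis i q :: ('n, 'k) der)" using q by (auto simp: inj_on_def axis_eq_axis)
  have "der.independent ?W"
  proof (rule notI)
    assume "der.dependent ?W"
    then obtain c v where c: "(\<Sum>v\<in>?W. c v *s v) = 0" "v \<in> ?W" "c v \<noteq> 0"
      by (auto simp: der.dependent_finite)
    have "(\<Sum>i\<in>UNIV. c (axis i q) *s axis i q) = 0"
      using c(1) by (simp add: sum.reindex[OF inj])
    then have "c (axis j q) * q = 0" for j
      using component_sum_axis[of "\<lambda>i. c (axis i q)" q j] by simp
    then have "c (axis j q) = 0" for j using q by (simp add: mpoly_mult_eq_0_iff)
    then show False using c(2,3) by auto
  qed
  then have "card ?W \<le> card U" using assms by (intro independent_card_le) auto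
  then show ?thesis using inj by (simp add: card_image)
qed

text \<open>A relation with nonzero coefficient \<open>c v\<close> moves \<open>c v\<close> times
  the whole span into the span of \<open>T - {v}\<close>. This would then contain the axes scaled by
  \<open>c v * q\<close>, which is too much for so few generators.\<close>

lemma spanning_independent:
  fixes T :: "('n::finite, 'k::field) der set"
  assumes q: "q \<noteq> 0" "\<And>i. axis i q \<in> der.span T" and T: "finite T" "card T \<le> CARD('n)"
  shows "der.independent T \<and> card T = CARD('n)"
proof
  have ge: "CARD('n) \<le> card T" using dim_le_card_spanning[OF q(1) T(1) q(2)] .
  then show "card T = CARD('n)" using T by simp
  show "der.independent T"
  proof (rule notI)
    assume "der.dependent T"
    then obtain c v where c: "(\<Sum>v\<in>T. c v *s v) = 0" "v \<in> T" "c v \<noteq> 0"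
      using T(1) by (auto simp: der.dependent_finite)
    have "c v *s v + (\<Sum>u\<in>T - {v}. c u *s u) = 0"
      using c(1) sum.remove[OF T(1) c(2), of "\<lambda>u. c u *s u"] by simp
    then have "c v *s v = - (\<Sum>u\<in>T - {v}. c u *s u)" by (rule add_eq_0_iff2[THEN iffD1])
    moreover have "- (\<Sum>u\<in>T - {v}. c u *s u) \<in> der.span (T - {v})"
      by (intro der.span_neg der.span_sum der.span_scale der.span_base)
    ultimately have cv: "c v *s v \<in> der.span (T - {v})" by (rule ssubst)
    have all: "c v *s x \<in> der.span (T - {v})" if "x \<in> der.span T" for x
      using that
    proof (induction rule: der.span_induct_alt)
      case base show ?case by (simp add: der.span_zero)
    next
      case (step a u y)
      have "c v *s u \<in> der.span (T - {v})"
        using cv step.hyps by (cases "u = v") (auto intro: der.span_scale der.span_base)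
      from der.span_add[OF der.span_scale[OF this] step.IH]
      have "a *s (c v *s u) + c v *s y \<in> der.span (T - {v})" .
      then show ?case by (simp add: der.scale_right_distrib mult.commute[of _ a])
    qed
    have "c v *s axis i q = axis i (c v * q)" for i by (simp add: vec_eq_iff axis_def)
    then have "axis i (c v * q) \<in> der.span (T - {v})" for i using all[OF q(2)] by metis
    then have "CARD('n) \<le> card (T - {v})"
      using q(1) c(3) T(1) by (intro dim_le_card_spanning[of "c v * q"]) (auto simp: mpoly_mult_eq_0_iff)
    then show False using c(2) T by (metis card_Diff1_less leD le_trans)
  qed
qed

text \<open>Evaluation at the origin, so that compatibility with sums and products is
  inherited.\<close>

definition const_coeff :: "('n::finite, 'k::field) mpoly \<Rightarrow> 'k" where
  "const_coeff = insertion (\<lambda>x. x) (\<lambda>_. 0)"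

lemma const_coeff_eq:
  fixes f :: "('n::finite, 'k::field) mpoly"
  shows "const_coeff f = look f 0"
proof -
  have "(\<Prod>i\<in>UNIV. (0::'k) ^ look t i) = (if t = 0 then 1 else 0)" for t :: "'n \<Rightarrow>\<^sub>0 nat"
  proof (cases "t = 0")
    case False
    then obtain i where "look t i \<noteq> 0" using poly_mapping_eqI[of t 0] by auto
    then have "(0::'k) ^ look t i = 0" by simp
    then show ?thesis using False prod_zero[of UNIV "\<lambda>i. (0::'k) ^ look t i"] by auto
  qed simp
  moreover have "look f t * (if t = 0 then 1 else 0) = (if t = 0 then look f 0 else 0)" for t
    by simp
  ultimately show ?thesis
    by (simp add: const_coeff_def insertion_def in_keys_iff)
qed

lemma const_coeff_hom:
  "const_coeff (f * g) = const_coeff f * const_coeff g"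
  "const_coeff (sum h I) = (\<Sum>i\<in>I. const_coeff (h i))"
  "const_coeff (Const c) = c"
  by (simp_all add: const_coeff_def insertion_mult insertion_sum insertion_Const coeff_hom_id)

lemma hcomp_0_eq:
  fixes f :: "('n::finite, 'k::field) mpoly"
  shows "hcomp 0 f = Const (const_coeff f)"
proof (rule poly_mapping_eqI)
  fix t :: "'n \<Rightarrow>\<^sub>0 nat"
  have "tdeg t = 0 \<longleftrightarrow> t = 0"
    by (auto simp: tdeg_def intro!: poly_mapping_eqI)
  then show "look (hcomp 0 f) t = look (Const (const_coeff f)) t"
    by (auto simp: lookup_hcomp const_coeff_eq Const_def lookup_single when_def)
qed

lemma span_remove_unit:
  fixes T :: "('n::finite, 'k::field) der set"
  assumes "finite T" "v \<in> T" "(\<Sum>u\<in>T. e u *s u) = x" "e v = Const c" "c \<noteq> 0"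
  shows "v \<in> der.span (insert x (T - {v}))"
proof -
  have "e v *s v + (\<Sum>u\<in>T - {v}. e u *s u) = x"
    using assms(3) sum.remove[OF assms(1,2), of "\<lambda>u. e u *s u"] by simp
  then have "e v *s v = x - (\<Sum>u\<in>T - {v}. e u *s u)" by (simp add: eq_diff_eq)
  also have "\<dots> \<in> der.span (insert x (T - {v}))"
    by (intro der.span_diff der.span_sum der.span_scale der.span_base) auto
  finally have "Const (1 / c) *s (e v *s v) \<in> der.span (insert x (T - {v}))" by (rule der.span_scale)
  moreover have "Const (1 / c) * e v = 1" using assms(4,5) by (simp flip: Const_mult)
  ultimately show ?thesis by (simp add: vector_smult_assoc)
qed

text \<open>The ranks of a graded module modulo the maximal ideal: a relation between constant
  coefficients would make one of the homogeneous generators redundant.\<close>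

lemma minimal_generators_card_le:
  fixes T B :: "('n::finite, 'k::field) der set"
  assumes B: "der.independent B" "der.span B = M" and T: "finite T" "der.span T = M"
    and hom: "\<And>\<tau>. \<tau> \<in> T \<Longrightarrow> \<exists>d. homogeneous_der d \<tau>"
    and irr: "\<And>\<tau>. \<tau> \<in> T \<Longrightarrow> \<tau> \<notin> der.span (T - {\<tau>})"
  shows "card T \<le> card B"
proof (rule ccontr)
  assume "\<not> card T \<le> card B"
  then have less: "card B < card T" by simp
  have finB: "finite B" using B(1) by (rule independent_finite)
  obtain p where p: "\<And>\<tau>. \<tau> \<in> T \<Longrightarrow> (\<Sum>b\<in>B. p \<tau> b *s b) = \<tau>"
    using span_coefficients[OF finB, of T] der.span_superset[of T] T(2) B(2) by blast
  obtain r where r: "\<And>b. b \<in> B \<Longrightarrow> (\<Sum>\<tau>\<in>T. r b \<tau> *s \<tau>) = b"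
    using span_coefficients[OF T(1), of B] der.span_superset[of B] T(2) B(2) by blast
  obtain deg where deg: "\<And>\<tau>. \<tau> \<in> T \<Longrightarrow> homogeneous_der (deg \<tau>) \<tau>" using hom by metis
  obtain c where c: "\<exists>\<tau>\<in>T. c \<tau> \<noteq> 0" "\<And>b. b \<in> B \<Longrightarrow> (\<Sum>\<tau>\<in>T. c \<tau> * const_coeff (p \<tau> b)) = 0"
    using linear_relation_exists[OF mult_eq_0_iff[THEN iffD1] finB T(1) less, of "\<lambda>\<tau> b. const_coeff (p \<tau> b)"] by blast
  \<comment> \<open>The combination of \<open>T\<close> with coefficients \<open>c\<close> is
    written in the basis as \<open>h\<close> and expanded again in \<open>T\<close> as
    \<open>g\<close>. The choice of \<open>c\<close> removes the constant terms of \<open>h\<close>,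
    hence those of \<open>g\<close>, so \<open>Const (c \<tau>) - g \<tau>\<close> is a relation
    with a nonzero constant term.\<close>
  define h where "h b = (\<Sum>\<tau>\<in>T. Const (c \<tau>) * p \<tau> b)" for b
  define g where "g \<tau> = (\<Sum>b\<in>B. h b * r b \<tau>)" for \<tau>
  have h0: "const_coeff (h b) = 0" if "b \<in> B" for b
    using c(2)[OF that] by (simp add: h_def const_coeff_hom)
  have g0: "const_coeff (g \<tau>) = 0" for \<tau> by (simp add: g_def const_coeff_hom h0)
  have "(\<Sum>\<tau>\<in>T. Const (c \<tau>) *s \<tau>) = (\<Sum>\<tau>\<in>T. \<Sum>b\<in>B. (Const (c \<tau>) * p \<tau> b) *s b)"
  proof (rule sum.cong[OF refl])
    fix \<tau> assume "\<tau> \<in> T"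
    from arg_cong[where f = "\<lambda>x. Const (c \<tau>) *s x", OF p[OF this, symmetric]] show "Const (c \<tau>) *s \<tau> = (\<Sum>b\<in>B. (Const (c \<tau>) * p \<tau> b) *s b)" by (simp add: der.scale_sum_right)
  qed
  also have "\<dots> = (\<Sum>b\<in>B. h b *s b)"
    by (subst sum.swap) (simp add: h_def der.scale_sum_left)
  also have "\<dots> = (\<Sum>b\<in>B. \<Sum>\<tau>\<in>T. (h b * r b \<tau>) *s \<tau>)"
  proof (rule sum.cong[OF refl])
    fix b assume "b \<in> B"
    from arg_cong[where f = "\<lambda>x. h b *s x", OF r[OF this, symmetric]] show "h b *s b = (\<Sum>\<tau>\<in>T. (h b * r b \<tau>) *s \<tau>)" by (simp add: der.scale_sum_right)
  qed
  also have "\<dots> = (\<Sum>\<tau>\<in>T. g \<tau> *s \<tau>)"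
    by (subst sum.swap) (simp add: g_def der.scale_sum_left)
  finally have rel: "(\<Sum>\<tau>\<in>T. (Const (c \<tau>) - g \<tau>) *s \<tau>) = 0"
    by (simp add: der.scale_left_diff_distrib sum_subtractf)
  obtain \<tau>0 where \<tau>0: "\<tau>0 \<in> T" "c \<tau>0 \<noteq> 0" using c(1) by blast
  define d where "d = deg \<tau>0"
  \<comment> \<open>In the component of degree \<open>deg \<tau>0\<close> the coefficient of
    \<open>\<tau>0\<close> shrinks to its constant term \<open>c \<tau>0\<close>, which is a
    unit.\<close>
  define e where "e \<tau> = (if deg \<tau> \<le> d then hcomp (d - deg \<tau>) (Const (c \<tau>) - g \<tau>) else 0)" for \<tau>
  have "(\<Sum>\<tau>\<in>T. e \<tau> *s \<tau>) = dcomp d (\<Sum>\<tau>\<in>T. (Const (c \<tau>) - g \<tau>) *s \<tau>)"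
    unfolding dcomp_sum by (intro sum.cong) (auto simp: dcomp_scale[OF deg] e_def)
  then have "(\<Sum>\<tau>\<in>T. e \<tau> *s \<tau>) = 0" by (simp add: rel)
  moreover have "e \<tau>0 = Const (c \<tau>0)"
    by (simp add: e_def d_def hcomp_diff hcomp_0_eq const_coeff_hom g0)
  ultimately have "\<tau>0 \<in> der.span (insert 0 (T - {\<tau>0}))"
    using span_remove_unit[OF T(1) \<tau>0(1)] \<tau>0(2) by blast
  then show False using irr[OF \<tau>0(1)] by (metis der.span_breakdown_eq der.scale_zero_right diff_zero)
qed

text \<open>Irredundancy bounds the number of generators by the size of a basis, hence by the
  dimension; full rank, witnessed by \<open>q\<close>, leaves no room for a relation among so
  few.\<close>

theorem minimal_generators_independent:
  fixes T :: "('n::finite, 'k::field) der set"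
  assumes "free_module M" and q: "q \<noteq> 0" "\<And>i. axis i q \<in> M"
    and T: "finite T" "der.span T = M"
    and hom: "\<And>\<tau>. \<tau> \<in> T \<Longrightarrow> \<exists>d. homogeneous_der d \<tau>"
    and irr: "\<And>\<tau>. \<tau> \<in> T \<Longrightarrow> \<tau> \<notin> der.span (T - {\<tau>})"
  shows "der.independent T \<and> card T = CARD('n)"
proof -
  obtain B where B: "der.independent B" "der.span B = M" using assms(1) by (auto simp: free_module_def)
  have "card T \<le> CARD('n)"
    using minimal_generators_card_le[OF B T hom irr] independent_card_le_dim[OF B(1)] by linarith
  then show ?thesis using q T by (intro spanning_independent) auto
qed

section \<open>Generators of the logarithmic derivation modules\<close>

text \<open>The finitely many nonzero components of finitely many generators generate the same
  graded module.\<close>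

lemma homogeneous_generators_exist:
  fixes M :: "('n::finite, 'k::field) der set"
  assumes M: "der.subspace M" and graded: "\<And>\<theta> d. \<theta> \<in> M \<Longrightarrow> dcomp d \<theta> \<in> M"
  shows "\<exists>G. finite G \<and> der.span G = M \<and> (\<forall>\<theta>\<in>G. \<exists>d. homogeneous_der d \<theta>)"
proof -
  obtain G where G: "finite G" "der.span G = M" using subspace_finitely_generated[OF M] by blast
  obtain D where D: "\<And>\<theta> :: ('n, 'k) der. finite (D \<theta>) \<and> \<theta> = (\<Sum>d\<in>D \<theta>. dcomp d \<theta>)"
    using sum_dcomp by metis
  define G' where "G' = (\<Union>\<theta>\<in>G. (\<lambda>d. dcomp d \<theta>) ` D \<theta>)"
  have "finite G'" using G D by (simp add: G'_def)
  moreover have "der.span G' = M"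
  proof (rule der.span_subspace[OF _ _ M])
    show "G' \<subseteq> M" using G graded der.span_superset[of G] by (auto simp: G'_def)
    have "G \<subseteq> der.span G'"
    proof
      fix \<theta> assume "\<theta> \<in> G"
      then have "(\<Sum>d\<in>D \<theta>. dcomp d \<theta>) \<in> der.span G'"
        by (intro der.span_sum der.span_base) (auto simp: G'_def)
      then show "\<theta> \<in> der.span G'" using D[of \<theta>] by simp
    qed
    then show "M \<subseteq> der.span G'" using der.span_minimal[OF _ der.subspace_span] G(2) by blast
  qed
  moreover have "\<forall>\<theta>\<in>G'. \<exists>d. homogeneous_der d \<theta>" by (auto simp: G'_def intro: homogeneous_dcomp)
  ultimately show ?thesis by blast
qed

lemma ap_sum: "ap (sum f T) a = (\<Sum>\<tau>\<in>T. ap (f \<tau>) a)"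
  by (induction T rule: infinite_finite_induct) (auto simp: ap_simps)

context arrangement
begin

abbreviation D1 where "D1 \<equiv> log_der \<alpha> A (\<lambda>_. 1)"
abbreviation Dm where "Dm \<equiv> log_der \<alpha> A m"
abbreviation quot where "quot \<equiv> defining_quot \<alpha> A m"

lemma Dm_subset: "Dm \<subseteq> D1"
proof
  fix \<theta> assume \<theta>: "\<theta> \<in> Dm"
  have "lf (\<alpha> H) ^ 1 dvd ap \<theta> (\<alpha> H)" if H: "H \<in> A" for H
    using \<theta> H le_imp_power_dvd[OF m1[OF H], of "lf (\<alpha> H)"] dvd_trans
    by (auto simp: log_der_iff)
  then show "\<theta> \<in> D1" by (simp add: log_der_iff)
qed

lemma euler_D1: "euler \<in> D1"
  by (simp add: log_der_iff ap_euler)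

text \<open>The Euler derivation contributes one factor of each form, so \<open>f\<close> has to
  supply the other \<open>m H - 1\<close>; this is where the quotient of the defining polynomials
  originates.\<close>

lemma euler_multiple_Dm: "f *s euler \<in> Dm \<longleftrightarrow> quot dvd f"
proof -
  have eq: "lf (\<alpha> H) ^ m H dvd f * lf (\<alpha> H) \<longleftrightarrow> lf (\<alpha> H) ^ (m H - 1) dvd f"
    if "H \<in> A" for H
  proof -
    have "lf (\<alpha> H) ^ m H = lf (\<alpha> H) * lf (\<alpha> H) ^ (m H - 1)"
      using m1[OF that] by (simp flip: power_Suc)
    then show ?thesis
      using nz[OF that] by (simp add: mult.commute[of f] mpoly_dvd_mult_cancel linear_form_eq_0_iff)
  qed
  show ?thesis
  proof
    assume "f *s euler \<in> Dm"
    then have "lf (\<alpha> H) ^ (m H - 1) dvd f" if "H \<in> A" for H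
      using that eq by (simp add: log_der_iff ap_simps ap_euler)
    then show "quot dvd f"
      unfolding defining_quot_def using fin nz hyp
      by (intro prod_power_dvd) (auto simp: linear_form_dvd_iff)
  next
    assume q: "quot dvd f"
    have "lf (\<alpha> H) ^ (m H - 1) dvd f" if "H \<in> A" for H
      using dvd_trans[OF dvd_prodI[OF fin that] q[unfolded defining_quot_def]] .
    then show "f *s euler \<in> Dm" using eq by (simp add: log_der_iff ap_simps ap_euler)
  qed
qed

lemma quot_euler_Dm: "quot *s euler \<in> Dm"
  by (simp add: euler_multiple_Dm)

lemma homogeneous_quot_euler: "\<exists>d. homogeneous_der d (quot *s euler)"
proof -
  have "homogeneous_poly (\<Sum>H\<in>A. m H - 1) quot"
    unfolding defining_quot_def
    using homogeneous_power[OF homogeneous_linear_form] by (intro homogeneous_prod) simp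
  from homogeneous_der_scale[OF this homogeneous_euler] show ?thesis by blast
qed

lemma defining_poly_nz: "defining_poly \<alpha> A m \<noteq> 0"
  using fin nz by (simp add: defining_poly_def mpoly_prod_eq_0_iff mpoly_power_eq_0_iff linear_form_eq_0_iff)

lemma axis_Dm: "axis i (defining_poly \<alpha> A m) \<in> Dm"
proof -
  have "ap (axis i q) a = Const (a $ i) * q" for q :: "('n, 'k) mpoly" and a
  proof -
    have "ap (axis i q) a = (\<Sum>j\<in>UNIV. if j = i then Const (a $ i) * q else 0)"
      unfolding ap_def by (intro sum.cong) (auto simp: axis_def)
    then show ?thesis by simp
  qed
  moreover have "lf (\<alpha> H) ^ m H dvd defining_poly \<alpha> A m" if "H \<in> A" for H
    unfolding defining_poly_def using fin that by (rule dvd_prodI)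
  ultimately show ?thesis by (simp add: log_der_iff)
qed

lemma log_der_degree_0:
  assumes "homogeneous_der 0 \<tau>" "\<tau> \<in> Dm" "H \<in> A" shows "ap \<tau> (\<alpha> H) = 0"
proof (rule homogeneous_0_linear_form_dvd[OF homogeneous_ap[OF assms(1)] nz[OF assms(3)]])
  have "\<tau> \<in> D1" using assms(2) Dm_subset by blast
  then show "lf (\<alpha> H) dvd ap \<tau> (\<alpha> H)" using assms(3) by (simp add: log_der_iff)
qed

text \<open>In degree one, generators of degree one could occur with constant coefficients only, and
  a nonzero constant would make such a generator redundant beside \<open>euler\<close>. Those of
  degree zero kill every \<open>\<alpha> H\<close>, whereas \<open>euler\<close> reproduces
  it.\<close>

lemma euler_indecomposable:
  assumes "A \<noteq> {}" and T: "finite T" "T \<subseteq> Dm" "\<And>\<tau>. \<tau> \<in> T \<Longrightarrow> \<exists>d. homogeneous_der d \<tau>"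
    and irr: "\<And>\<tau>. \<tau> \<in> T \<Longrightarrow> \<tau> \<notin> der.span (insert euler (T - {\<tau>}))"
  shows "euler \<notin> der.span T"
proof
  assume "euler \<in> der.span T"
  then obtain h where h: "euler = (\<Sum>\<tau>\<in>T. h \<tau> *s \<tau>)" using in_span_finite_iff[OF T(1)] by blast
  obtain deg where deg: "\<And>\<tau>. \<tau> \<in> T \<Longrightarrow> homogeneous_der (deg \<tau>) \<tau>" using T(3) by metis
  define e where "e \<tau> = (if deg \<tau> \<le> 1 then hcomp (1 - deg \<tau>) (h \<tau>) else 0)" for \<tau>
  have "euler = dcomp 1 (\<Sum>\<tau>\<in>T. h \<tau> *s \<tau>)"
    unfolding h[symmetric] by (simp add: dcomp_homogeneous[OF homogeneous_euler])
  also have "\<dots> = (\<Sum>\<tau>\<in>T. e \<tau> *s \<tau>)"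
    unfolding dcomp_sum by (intro sum.cong) (auto simp: dcomp_scale[OF deg] e_def)
  finally have e: "euler = (\<Sum>\<tau>\<in>T. e \<tau> *s \<tau>)" .
  have e0: "e \<tau> = 0" if \<tau>: "\<tau> \<in> T" "deg \<tau> = 1" for \<tau>
  proof (rule ccontr)
    assume "e \<tau> \<noteq> 0"
    moreover have "e \<tau> = Const (const_coeff (h \<tau>))" using \<tau> by (simp add: e_def hcomp_0_eq)
    ultimately have "\<tau> \<in> der.span (insert euler (T - {\<tau>}))"
      using span_remove_unit[OF T(1) \<tau>(1) e[symmetric]] by auto
    then show False using irr[OF \<tau>(1)] by blast
  qed
  obtain H where H: "H \<in> A" using assms(1) by blast
  have "ap euler (\<alpha> H) = (\<Sum>\<tau>\<in>T. e \<tau> * ap \<tau> (\<alpha> H))"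
    by (subst e) (simp add: ap_sum ap_simps)
  also have "\<dots> = 0"
  proof (intro sum.neutral ballI)
    fix \<tau> assume \<tau>: "\<tau> \<in> T"
    consider "deg \<tau> = 0" | "deg \<tau> = 1" | "deg \<tau> > 1" by linarith
    then show "e \<tau> * ap \<tau> (\<alpha> H) = 0"
    proof cases
      case 1
      then show ?thesis using log_der_degree_0[OF _ _ H] deg[OF \<tau>] T(2) \<tau> by auto
    next
      case 2 then show ?thesis using e0 \<tau> by simp
    next
      case 3 then show ?thesis by (simp add: e_def)
    qed
  qed
  finally show False using nz[OF H] by (simp add: ap_euler linear_form_eq_0_iff)
qed

text \<open>Choosing the homogeneous generators from the smaller module, and as few of them as possible,
  makes the Euler derivation the only generator that has to be replaced.\<close>

theorem split_generators:
  assumes ne: "A \<noteq> {}" and split: "\<forall>\<theta>\<in>D1. \<exists>f. \<theta> - f *s euler \<in> Dm"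
  shows "\<exists>T. finite T \<and> (\<forall>\<tau>\<in>T. \<exists>d. homogeneous_der d \<tau>) \<and>
    der.span (insert euler T) = D1 \<and> der.span (insert (quot *s euler) T) = Dm \<and> euler \<notin> der.span T \<and>
    (\<forall>\<tau>\<in>T. \<tau> \<notin> der.span (insert euler (T - {\<tau>})))"
proof -
  have sub: "der.subspace D1" "der.subspace Dm" by (rule subspace_log_der)+
  obtain G where G: "finite G" "der.span G = Dm" "\<And>\<theta>. \<theta> \<in> G \<Longrightarrow> \<exists>d. homogeneous_der d \<theta>"
    using homogeneous_generators_exist[OF sub(2) dcomp_log_der] by blast
  have "der.span (insert euler G) = D1"
  proof (rule der.span_subspace[OF _ _ sub(1)])
    show "insert euler G \<subseteq> D1" using euler_D1 Dm_subset G(2) der.span_superset[of G] by blast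
    show "D1 \<subseteq> der.span (insert euler G)"
      using split unfolding G(2)[symmetric] by (auto simp: der.span_breakdown_eq)
  qed
  then have "G \<subseteq> G \<and> der.span (insert euler G) = D1" by simp
  from ex_has_least_nat[of "\<lambda>T. T \<subseteq> G \<and> der.span (insert euler T) = D1", OF this, of card]
  obtain T where T: "T \<subseteq> G" "der.span (insert euler T) = D1"
    and min: "\<And>T'. T' \<subseteq> G \<Longrightarrow> der.span (insert euler T') = D1 \<Longrightarrow> card T \<le> card T'"
    by auto
  have finT: "finite T" using T(1) G(1) by (rule finite_subset)
  have TDm: "T \<subseteq> Dm" using T(1) G(2) der.span_superset[of G] by blast
  have homT: "\<exists>d. homogeneous_der d \<tau>" if "\<tau> \<in> T" for \<tau> using that T(1) G(3) by blast
  have irr: "\<tau> \<notin> der.span (insert euler (T - {\<tau>}))" if \<tau>: "\<tau> \<in> T" for \<tau>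
  proof
    assume a: "\<tau> \<in> der.span (insert euler (T - {\<tau>}))"
    have "insert euler T \<subseteq> der.span (insert euler (T - {\<tau>}))"
      using a der.span_superset[of "insert euler (T - {\<tau>})"] by auto
    then have "D1 \<subseteq> der.span (insert euler (T - {\<tau>}))"
      using T(2) der.span_minimal[OF _ der.subspace_span] by metis
    moreover have "der.span (insert euler (T - {\<tau>})) \<subseteq> D1"
      using T(2) der.span_mono[of "insert euler (T - {\<tau>})" "insert euler T"] by auto
    ultimately have "card T \<le> card (T - {\<tau>})" using T(1) by (intro min) auto
    then show False using \<tau> finT by (metis card_Diff1_less leD)
  qed
  have "der.span (insert (quot *s euler) T) = Dm"
  proof (rule der.span_subspace[OF _ _ sub(2)])
    show "insert (quot *s euler) T \<subseteq> Dm" using quot_euler_Dm TDm by blast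
    show "Dm \<subseteq> der.span (insert (quot *s euler) T)"
    proof
      fix \<theta> assume \<theta>: "\<theta> \<in> Dm"
      then have "\<theta> \<in> der.span (insert euler T)" using T(2) Dm_subset by blast
      \<comment> \<open>The remainder lies in the span of \<open>T\<close> and so in
        \<open>Dm\<close>. Hence \<open>f *s euler\<close> does too, which makes \<open>f\<close> a
        multiple of \<open>quot\<close>.\<close>
      then obtain f where f: "\<theta> - f *s euler \<in> der.span T" by (auto simp: der.span_breakdown_eq)
      then have "\<theta> - f *s euler \<in> Dm" using der.span_minimal[OF TDm sub(2)] by blast
      then have "\<theta> - (\<theta> - f *s euler) \<in> Dm" by (rule der.subspace_diff[OF sub(2) \<theta>])
      then obtain g where "f = g * quot"
        by (auto simp: euler_multiple_Dm dvd_def mult.commute)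
      then have "\<theta> - g *s (quot *s euler) \<in> der.span T" using f by (simp add: vector_smult_assoc)
      then show "\<theta> \<in> der.span (insert (quot *s euler) T)" by (auto simp: der.span_breakdown_eq)
    qed
  qed
  then show ?thesis
    using finT homT T(2) irr euler_indecomposable[OF ne finT TDm homT irr] by blast
qed

end

text \<open>Every proper subset is contained in the set with a single element removed, so it
  suffices to test such removals.\<close>

lemma minimal_generators_iff:
  "minimal_generators M \<theta>s \<longleftrightarrow>
     (\<forall>\<theta>\<in>set \<theta>s. \<exists>d. homogeneous_der d \<theta>) \<and> distinct \<theta>s \<and> der.span (set \<theta>s) = M \<and>
     (\<forall>\<theta>\<in>set \<theta>s. \<theta> \<notin> der.span (set \<theta>s - {\<theta>}))"
proof -
  have "(\<forall>T. T \<subset> S \<longrightarrow> der.span T \<noteq> der.span S) \<longleftrightarrow> (\<forall>\<theta>\<in>S. \<theta> \<notin> der.span (S - {\<theta>}))"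
    for S :: "('a, 'b) der set"
  proof (intro iffI ballI allI impI notI)
    fix \<theta> assume *: "\<forall>T. T \<subset> S \<longrightarrow> der.span T \<noteq> der.span S" "\<theta> \<in> S" "\<theta> \<in> der.span (S - {\<theta>})"
    have "S \<subseteq> der.span (S - {\<theta>})" using *(3) der.span_superset[of "S - {\<theta>}"] by auto
    then have "der.span S \<subseteq> der.span (S - {\<theta>})" using der.span_minimal[OF _ der.subspace_span] by blast
    moreover have "der.span (S - {\<theta>}) \<subseteq> der.span S" by (rule der.span_mono) auto
    moreover have "S - {\<theta>} \<subset> S" using *(2) by auto
    ultimately show False using *(1) by blast
  next
    fix T assume *: "\<forall>\<theta>\<in>S. \<theta> \<notin> der.span (S - {\<theta>})" "T \<subset> S" "der.span T = der.span S"
    then obtain \<theta> where \<theta>: "\<theta> \<in> S" "\<theta> \<notin> T" by blast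
    then have "\<theta> \<in> der.span T" using *(3) der.span_base[of \<theta> S] by simp
    moreover have "der.span T \<subseteq> der.span (S - {\<theta>})" using \<theta> *(2) by (intro der.span_mono) auto
    ultimately show False using *(1) \<theta>(1) by blast
  qed
  from this[of "set \<theta>s"] show ?thesis unfolding minimal_generators_def by auto
qed

theorem theorem1p6:
  fixes \<alpha> :: "('k::field ^ 'n::finite) set \<Rightarrow> 'k ^ 'n"
    and A :: "('k ^ 'n) set set"
    and m :: "('k ^ 'n) set \<Rightarrow> nat"
  assumes "multiarrangement \<alpha> A m"
    and "A \<noteq> {}"
    and "int (multi_betti2 \<alpha> A m) =
           betti 2 A + (int (\<Sum>H\<in>A. m H) - int (card A)) * (int (card A) - 1)"
  shows
    "(\<exists>\<theta>s. minimal_generators (log_der \<alpha> A (\<lambda>_. 1)) (euler # \<theta>s) \<and>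
        der.span (set ((defining_quot \<alpha> A m *s euler) # \<theta>s)) = log_der \<alpha> A m \<and>
        (minimal_generators (log_der \<alpha> A m) ((defining_quot \<alpha> A m *s euler) # \<theta>s) \<longleftrightarrow>
           der.span (set \<theta>s) \<noteq> log_der \<alpha> A m)) \<and>
     (free_module (log_der \<alpha> A m) \<and> \<not> free_module (log_der \<alpha> A (\<lambda>_. 1)) \<longrightarrow>
        (\<exists>\<theta>s. length \<theta>s = CARD('n) \<and>
           minimal_generators (log_der \<alpha> A (\<lambda>_. 1)) (euler # \<theta>s) \<and>
           homogeneous_basis (log_der \<alpha> A m) \<theta>s)) \<and>
     (free_module (log_der \<alpha> A m) \<and> free_module (log_der \<alpha> A (\<lambda>_. 1)) \<longrightarrow>
        (\<exists>\<theta>s. length \<theta>s = CARD('n) - 1 \<and>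
           homogeneous_basis (log_der \<alpha> A (\<lambda>_. 1)) (euler # \<theta>s) \<and>
           homogeneous_basis (log_der \<alpha> A m) (\<theta>s @ [defining_quot \<alpha> A m *s euler])))"
proof -
  interpret arrangement \<alpha> A m by unfold_locales (rule assms(1))
  let ?q = "quot *s euler"
  have "\<forall>\<theta>\<in>D1. \<exists>f. \<theta> - f *s euler \<in> Dm" using log_der_split[OF assms(3)] by blast
  from split_generators[OF assms(2) this] obtain T where
    *: "finite T \<and> (\<forall>\<tau>\<in>T. \<exists>d. homogeneous_der d \<tau>) \<and> der.span (insert euler T) = D1 \<and>
      der.span (insert ?q T) = Dm \<and> euler \<notin> der.span T \<and>
      (\<forall>\<tau>\<in>T. \<tau> \<notin> der.span (insert euler (T - {\<tau>})))" ..
  then have T: "finite T" and span1: "der.span (insert euler T) = D1"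
    and spanm: "der.span (insert ?q T) = Dm" and E: "euler \<notin> der.span T" by simp_all
  have hom: "\<exists>d. homogeneous_der d \<tau>" and irr: "\<tau> \<notin> der.span (insert euler (T - {\<tau>}))"
    if "\<tau> \<in> T" for \<tau>
    using * that by simp_all
  obtain \<theta>s where \<theta>s: "set \<theta>s = T" "distinct \<theta>s" using finite_distinct_list[OF T] by blast
  have len: "length \<theta>s = card T" using \<theta>s distinct_card by fastforce
  have ET: "euler \<notin> T" using E der.span_base by blast
  have hom1: "\<exists>d. homogeneous_der d \<tau>" if "\<tau> \<in> insert euler T" for \<tau>
    using that hom homogeneous_euler by blast
  have homm: "\<exists>d. homogeneous_der d \<tau>" if "\<tau> \<in> insert ?q T" for \<tau>
    using that hom homogeneous_quot_euler by blast
  have irr0: "\<tau> \<notin> der.span (T - {\<tau>})" if "\<tau> \<in> T" for \<tau>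
    using irr[OF that] der.span_mono[of "T - {\<tau>}" "insert euler (T - {\<tau>})"] by blast
  have irr1: "\<tau> \<notin> der.span (insert euler T - {\<tau>})" if "\<tau> \<in> insert euler T" for \<tau>
  proof (cases "\<tau> = euler")
    case True then show ?thesis using E ET by simp
  next
    case False
    then have "insert euler T - {\<tau>} = insert euler (T - {\<tau>})" by auto
    then show ?thesis using irr[of \<tau>] that False by simp
  qed
  have qT: "?q \<notin> der.span T" if "der.span T \<noteq> Dm"
  proof
    assume "?q \<in> der.span T"
    then have "insert ?q T \<subseteq> der.span T" using der.span_superset[of T] by blast
    then have "Dm \<subseteq> der.span T" using der.span_minimal[OF _ der.subspace_span] spanm by metis
    moreover have "der.span T \<subseteq> Dm" unfolding spanm[symmetric] by (rule der.span_mono) auto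
    ultimately show False using that by blast
  qed
  have irrm: "\<tau> \<notin> der.span (insert ?q T - {\<tau>})" if "der.span T \<noteq> Dm" "\<tau> \<in> insert ?q T" for \<tau>
  proof (cases "\<tau> = ?q")
    case True
    have "der.span (insert ?q T - {?q}) \<subseteq> der.span T" by (rule der.span_mono) auto
    then show ?thesis using True qT[OF that(1)] by blast
  next
    case False
    then have \<tau>: "\<tau> \<in> T" "insert ?q T - {\<tau>} = insert ?q (T - {\<tau>})" using that(2) by auto
    \<comment> \<open>\<open>?q\<close> is a multiple of \<open>euler\<close>, so irredundancy of
      \<open>\<tau>\<close> beside \<open>euler\<close> implies irredundancy beside
      \<open>?q\<close>.\<close>
    have "der.span (insert ?q (T - {\<tau>})) \<subseteq> der.span (insert euler (T - {\<tau>}))"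
    proof (rule der.span_minimal[OF _ der.subspace_span])
      show "insert ?q (T - {\<tau>}) \<subseteq> der.span (insert euler (T - {\<tau>}))"
        by (auto intro: der.span_base der.span_scale)
    qed
    then show ?thesis using irr[OF \<tau>(1)] \<tau>(2) by auto
  qed
  have gens1: "minimal_generators D1 (euler # \<theta>s)"
    using hom1 irr1 ET span1 \<theta>s by (simp add: minimal_generators_iff)
  have gensm: "minimal_generators Dm (?q # \<theta>s) \<longleftrightarrow> der.span T \<noteq> Dm"
  proof
    assume a: "minimal_generators Dm (?q # \<theta>s)"
    then have "?q \<notin> T" using \<theta>s by (simp add: minimal_generators_def)
    then have "T \<subset> set (?q # \<theta>s)" using \<theta>s by auto
    then show "der.span T \<noteq> Dm" using a unfolding minimal_generators_def by blast
  next
    assume a: "der.span T \<noteq> Dm"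
    then have "?q \<notin> T" using qT der.span_base by blast
    then show "minimal_generators Dm (?q # \<theta>s)"
      using homm irrm[OF a] spanm \<theta>s by (simp add: minimal_generators_iff)
  qed
  have axis1: "axis i (defining_poly \<alpha> A m) \<in> D1" for i using axis_Dm Dm_subset by blast
  have indep_T: "der.independent T \<and> card T = CARD('n)" if "free_module Dm" "der.span T = Dm"
    using minimal_generators_independent[OF that(1) defining_poly_nz axis_Dm T that(2) hom irr0] .
  have indep_qT: "der.independent (insert ?q T) \<and> Suc (card T) = CARD('n)"
    if "free_module Dm" "der.span T \<noteq> Dm"
  proof -
    have "?q \<notin> T" using qT[OF that(2)] der.span_base by blast
    then show ?thesis
      using minimal_generators_independent[OF that(1) defining_poly_nz axis_Dm _ spanm homm irrm[OF that(2)]] T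
      by simp
  qed
  have part1: "\<exists>\<theta>s. minimal_generators D1 (euler # \<theta>s) \<and> der.span (set (?q # \<theta>s)) = Dm \<and>
      (minimal_generators Dm (?q # \<theta>s) \<longleftrightarrow> der.span (set \<theta>s) \<noteq> Dm)"
    using gens1 gensm spanm \<theta>s by (intro exI[of _ \<theta>s]) simp
  have part2: "\<exists>\<theta>s. length \<theta>s = CARD('n) \<and> minimal_generators D1 (euler # \<theta>s) \<and> homogeneous_basis Dm \<theta>s"
    if free: "free_module Dm" "\<not> free_module D1"
  proof -
    have "der.span T = Dm"
    proof (rule ccontr)
      \<comment> \<open>In this case \<open>?q\<close> belongs to a basis of \<open>Dm\<close>, so
        \<open>T\<close> has one element less than the dimension. Putting \<open>euler\<close> in
        place of \<open>?q\<close> gives a generating set of \<open>D1\<close> small enough to be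
        independent, and \<open>D1\<close> would be free.\<close>
      assume "der.span T \<noteq> Dm"
      with indep_qT free have "card (insert euler T) = CARD('n)" using ET T by simp
      then have "der.independent (insert euler T)"
        using spanning_independent[OF defining_poly_nz, of "insert euler T"] axis1 span1 T by simp
      then show False using free(2) span1 by (auto simp: free_module_def)
    qed
    with indep_T free have "der.independent T" "card T = CARD('n)" by auto
    then show ?thesis
      using gens1 hom \<theta>s len \<open>der.span T = Dm\<close>
      by (intro exI[of _ \<theta>s]) (simp add: homogeneous_basis_def)
  qed
  have part3: "\<exists>\<theta>s. length \<theta>s = CARD('n) - 1 \<and> homogeneous_basis D1 (euler # \<theta>s) \<and>
      homogeneous_basis Dm (\<theta>s @ [?q])"
    if free: "free_module Dm" "free_module D1"
  proof -
    have "der.independent (insert euler T) \<and> card (insert euler T) = CARD('n)"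
      using minimal_generators_independent[OF free(2) defining_poly_nz axis1 _ span1 hom1 irr1] T by simp
    then have 1: "der.independent (insert euler T)" "Suc (card T) = CARD('n)" using ET T by simp_all
    \<comment> \<open>Equality would give \<open>T\<close> as many elements as the dimension, one
      more than freeness of \<open>D1\<close> allows.\<close>
    have ne: "der.span T \<noteq> Dm" using indep_T[OF free(1)] 1(2) by auto
    have 2: "der.independent (insert ?q T)" using indep_qT[OF free(1) ne] by simp
    have "?q \<notin> T" using qT[OF ne] der.span_base by blast
    then show ?thesis
      using 1 2 ET hom1 homm span1 spanm \<theta>s len
      by (intro exI[of _ \<theta>s]) (simp add: homogeneous_basis_def)
  qed
  show ?thesis using part1 part2 part3 by blast
qed

end
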